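(* Let $\Omega\subset\mathbb{R}^n$ be open and let $P(x,D)=\sum_{j=1}^n a_j(x)D_j+a_0(x)$ be a first order partial differential operator whose coefficients $a_0,\dots,a_n\in\mathcal{G}(\Omega)$ are of slow scale. Let $P_1(x,D)=\sum_{j=1}^na_j(x)D_j$ be its principal part. Then for every $u\in\mathcal{G}(\Omega)$, $$\mathrm{WF}_g(u)\subseteq\mathrm{WF}_g(Pu)\cup\mathrm{W}_{\mathrm{sc}}\text{-}\mathrm{Ell}(P_1)^{c},$$ where the complement is taken in $T^*(\Omega)\setminus0$.
   Context: Colombeau algebra: for $\Omega\subset\mathbb{R}^n$ open, $\mathcal{E}_{\mathrm M}(\Omega)$ is the set of nets $(u_\varepsilon)_{\varepsilon\in(0,1]}$ in $C^\infty(\Omega)$ such that for every compact $K\subset\Omega$ and $\alpha\in\mathbb{N}_0^n$ there is $p\ge0$ with $\sup_{K}|\partial^\alpha u_\varepsilon|=O(\varepsilon^{-p})$ as $\varepsilon\to0$; $\mathcal{N}(\Omega)$ is the set of nets such that for all $K,\alpha$ and all $q\ge0$, $\sup_{K}|\partial^\alpha u_\varepsilon|=O(\varepsilon^{q})$. $\mathcal{G}(\Omega)=\mathcal{E}_{\mathrm M}(\Omega)/\mathcal{N}(\Omega)$, with operations on representatives. $D_j=-i\partial_j$. $T^*(\Omega)\setminus0=\Omega\times(\mathbb{R}^n\setminus\{0\})$. Slow scale net: a net $(r_\varepsilon)_\varepsilon$ of numbers with $|r_\varepsilon|^t=O(1/\varepsilon)$ as $\varepsilon\to0$ for every $t\ge0$.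 Function of slow scale: $v\in\mathcal{G}(\Omega)$ is of slow scale if it has a representative $(v_\varepsilon)_\varepsilon$ such that for every compact $K\subset\Omega$ and every $\alpha\in\mathbb{N}_0^n$ there are a slow scale net $(r_\varepsilon)_\varepsilon$, $r_\varepsilon>0$, and $\varepsilon_0>0$ with $|\partial^\alpha v_\varepsilon(x)|\le r_\varepsilon$ for all $x\in K$, $\varepsilon\in(0,\varepsilon_0)$. Generalized wave front set: $u\in\mathcal{G}(\Omega)$ is microlocally regular at $(x_0,\xi_0)\in T^*(\Omega)\setminus0$ if (for a representative $(u_\varepsilon)_\varepsilon$) there are an open neighborhood $U$ of $x_0$ and a conic neighborhood $\Gamma$ of $\xi_0$ such that for all $\varphi\in\mathcal{D}(U)=C_c^\infty(U)$: there is $N\in\mathbb{R}$ such that for all $l\in\mathbb{N}_0$ there are $C>0$ and $\varepsilon_0>0$ with $|\widehat{(\varphi u_\varepsilon)}(\xi)|\le C\varepsilon^{-N}(1+|\xi|)^{-l}$ for all $\xi\in\Gamma$, $\varepsilon\in(0,\varepsilon_0)$ (classical Fourier transform). $\mathrm{WF}_g(u)$ is the complement in $T^*(\Omega)\setminus0$ of the set of points where $u$ is microlocally regular. $\mathrm{W}_{\mathrm{sc}}$-ellipticity: a partial differential operator $Q(x,D)$ of order $m$ with coefficients in $\mathcal{G}(\Omega)$ is $\mathrm{W}_{\mathrm{sc}}$-elliptic at $(x_0,\xi_0)\in T^*(\Omega)\setminus0$ if for some representative $(Q_\varepsilon(x,\xi))_\varepsilon$ of its symbol (polynomials in $\xi$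 whose coefficients are representatives of the coefficients of $Q$) there are an open neighborhood $U$ of $x_0$, a conic neighborhood $\Gamma$ of $\xi_0$, slow scale nets $(s_\varepsilon)_\varepsilon,(r_\varepsilon)_\varepsilon$ with $s_\varepsilon>0$, $r_\varepsilon>0$, and $\varepsilon_0>0$ such that $|Q_\varepsilon(x,\xi)|\ge s_\varepsilon^{-1}(1+|\xi|)^m$ for all $x\in U$, $\xi\in\Gamma$ with $|\xi|\ge r_\varepsilon$, $\varepsilon\in(0,\varepsilon_0)$. $\mathrm{W}_{\mathrm{sc}}\text{-}\mathrm{Ell}(Q)$ is the set of all points of $T^*(\Omega)\setminus 0$ at which $Q$ is $\mathrm{W}_{\mathrm{sc}}$-elliptic. Here it is applied to $Q=P_1$ with $m=1$. *)

theory Defs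
  imports "HOL-Analysis.Analysis" "HOL-Library.Landau_Symbols"
begin

section \<open>Smooth functions and multi-indices\<close>

text \<open>Functions on an open set \<open>\<Omega>\<close> are total functions of which only the values on \<open>\<Omega>\<close> matter.\<close>

definition partial_deriv :: "'n::finite \<Rightarrow> (real^'n \<Rightarrow> complex) \<Rightarrow> (real^'n \<Rightarrow> complex)" where
  "partial_deriv j f = (\<lambda>x. frechet_derivative f (at x) (axis j 1))"

text \<open>For open \<open>\<Omega>\<close> this is \<open>C\<^sup>\<infinity>(\<Omega>)\<close>: all iterated partial derivatives exist and are
  differentiable (hence continuous) on \<open>\<Omega>\<close>.\<close>

definition smooth_functions :: "(real^'n::finite) set \<Rightarrow> (real^'n \<Rightarrow> complex) set" where
  "smooth_functions \<Omega> = {f. \<forall>js. \<forall>x\<in>\<Omega>. foldr partial_deriv js f differentiable (at x)}"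

definition mi_order :: "nat^'n::finite \<Rightarrow> nat" where
  "mi_order \<alpha> = (\<Sum>j\<in>UNIV. \<alpha> $ j)"

definition mi_power :: "real^'n::finite \<Rightarrow> nat^'n \<Rightarrow> real" where
  "mi_power \<xi> \<alpha> = (\<Prod>j\<in>UNIV. (\<xi> $ j) ^ (\<alpha> $ j))"

text \<open>The index type carries no order, so some sequence of differentiations realizing \<open>\<alpha>\<close> is
  chosen; on smooth functions the result does not depend on the choice (Schwarz).\<close>

definition mi_deriv :: "nat^'n::finite \<Rightarrow> (real^'n \<Rightarrow> complex) \<Rightarrow> (real^'n \<Rightarrow> complex)" where
  "mi_deriv \<alpha> f = foldr partial_deriv (SOME js. \<forall>j. count_list js j = \<alpha> $ j) f"

text \<open>\<open>D\<^sup>\<alpha>\<close> for \<open>D\<^sub>j = - \<i> \<partial>\<^sub>j\<close>.\<close>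

definition mi_D :: "nat^'n::finite \<Rightarrow> (real^'n \<Rightarrow> complex) \<Rightarrow> (real^'n \<Rightarrow> complex)" where
  "mi_D \<alpha> f = (\<lambda>x. (- \<i>) ^ mi_order \<alpha> * mi_deriv \<alpha> f x)"

definition test_functions :: "(real^'n::finite) set \<Rightarrow> (real^'n \<Rightarrow> complex) set" where
  "test_functions U = {\<phi> \<in> smooth_functions UNIV.
     compact (closure {x. \<phi> x \<noteq> 0}) \<and> closure {x. \<phi> x \<noteq> 0} \<subseteq> U}"

definition fourier :: "(real^'n::finite \<Rightarrow> complex) \<Rightarrow> real^'n \<Rightarrow> complex" where
  "fourier f \<xi> = (\<integral>x. exp (- \<i> * complex_of_real (x \<bullet> \<xi>)) * f x \<partial>lborel)"


section \<open>The Colombeau algebra\<close>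

text \<open>A net is a function of \<open>\<epsilon> :: real\<close> of which only the values for \<open>0 < \<epsilon> \<le> 1\<close> matter.
  The asymptotic bound \<open>sup\<^sub>K \<bar>f\<^sub>\<epsilon>\<bar> = O(g \<epsilon>)\<close> is written pointwise on \<open>K\<close>, because
  \<^term>\<open>Sup\<close> of the empty set of reals is unspecified.\<close>

type_synonym 'n net = "real \<Rightarrow> real^'n \<Rightarrow> complex"

definition moderate_nets :: "(real^'n::finite) set \<Rightarrow> 'n net set" where
  "moderate_nets \<Omega> = {u. (\<forall>\<epsilon>\<in>{0<..1}. u \<epsilon> \<in> smooth_functions \<Omega>) \<and>
     (\<forall>K \<alpha>. compact K \<and> K \<subseteq> \<Omega> \<longrightarrow>
       (\<exists>p\<ge>0. \<exists>C. \<forall>\<^sub>F \<epsilon> in at_right 0. \<forall>x\<in>K. cmod (mi_deriv \<alpha> (u \<epsilon>) x) \<le> C * \<epsilon> powr (- p)))}"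

definition negligible_nets :: "(real^'n::finite) set \<Rightarrow> 'n net set" where
  "negligible_nets \<Omega> = {u. (\<forall>\<epsilon>\<in>{0<..1}. u \<epsilon> \<in> smooth_functions \<Omega>) \<and>
     (\<forall>K \<alpha>. compact K \<and> K \<subseteq> \<Omega> \<longrightarrow>
       (\<forall>q\<ge>0. \<exists>C. \<forall>\<^sub>F \<epsilon> in at_right 0. \<forall>x\<in>K. cmod (mi_deriv \<alpha> (u \<epsilon>) x) \<le> C * \<epsilon> powr q))}"

definition colombeau_rel :: "(real^'n::finite) set \<Rightarrow> ('n net \<times> 'n net) set" where
  "colombeau_rel \<Omega> = {(u, v). u \<in> moderate_nets \<Omega> \<and> v \<in> moderate_nets \<Omega> \<and>
     (\<lambda>\<epsilon> x. u \<epsilon> x - v \<epsilon> x) \<in> negligible_nets \<Omega>}"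

definition colombeau :: "(real^'n::finite) set \<Rightarrow> 'n net set set" where
  "colombeau \<Omega> = moderate_nets \<Omega> // colombeau_rel \<Omega>"

definition colombeau_class :: "(real^'n::finite) set \<Rightarrow> 'n net \<Rightarrow> 'n net set" where
  "colombeau_class \<Omega> u = colombeau_rel \<Omega> `` {u}"


section \<open>Slow scale\<close>

definition slow_scale_net :: "(real \<Rightarrow> real) \<Rightarrow> bool" where
  "slow_scale_net r \<longleftrightarrow> (\<forall>t\<ge>0. (\<lambda>\<epsilon>. \<bar>r \<epsilon>\<bar> powr t) \<in> O[at_right 0](\<lambda>\<epsilon>. 1 / \<epsilon>))"

definition pos_slow_scale_net :: "(real \<Rightarrow> real) \<Rightarrow> bool" where
  "pos_slow_scale_net r \<longleftrightarrow> slow_scale_net r \<and> (\<forall>\<epsilon>\<in>{0<..1}. r \<epsilon> > 0)"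

definition slow_scale :: "(real^'n::finite) set \<Rightarrow> 'n net set \<Rightarrow> bool" where
  "slow_scale \<Omega> v \<longleftrightarrow> (\<exists>w\<in>v. \<forall>K \<alpha>. compact K \<and> K \<subseteq> \<Omega> \<longrightarrow>
     (\<exists>r. pos_slow_scale_net r \<and>
       (\<forall>\<^sub>F \<epsilon> in at_right 0. \<forall>x\<in>K. cmod (mi_deriv \<alpha> (w \<epsilon>) x) \<le> r \<epsilon>)))"


section \<open>Generalized wave front set\<close>

definition cotangent_nonzero :: "(real^'n::finite) set \<Rightarrow> ((real^'n) \<times> (real^'n)) set" where
  "cotangent_nonzero \<Omega> = \<Omega> \<times> (UNIV - {0})"

text \<open>The library's \<^const>\<open>conic\<close> sets contain 0, so an open one that is nonempty is everything.\<close>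

definition conic_nbhd :: "real^'n::finite \<Rightarrow> (real^'n) set \<Rightarrow> bool" where
  "conic_nbhd \<xi>\<^sub>0 \<Gamma> \<longleftrightarrow> open \<Gamma> \<and> \<xi>\<^sub>0 \<in> \<Gamma> \<and> 0 \<notin> \<Gamma> \<and> (\<forall>\<xi>\<in>\<Gamma>. \<forall>t>0. t *\<^sub>R \<xi> \<in> \<Gamma>)"

definition microlocally_regular ::
  "(real^'n::finite) set \<Rightarrow> 'n net set \<Rightarrow> real^'n \<Rightarrow> real^'n \<Rightarrow> bool" where
  "microlocally_regular \<Omega> u x\<^sub>0 \<xi>\<^sub>0 \<longleftrightarrow> (\<exists>v\<in>u. \<exists>U \<Gamma>.
     open U \<and> x\<^sub>0 \<in> U \<and> U \<subseteq> \<Omega> \<and> conic_nbhd \<xi>\<^sub>0 \<Gamma> \<and>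
     (\<forall>\<phi>\<in>test_functions U. \<exists>N::real. \<forall>l::nat. \<exists>C>0.
        \<forall>\<^sub>F \<epsilon> in at_right 0. \<forall>\<xi>\<in>\<Gamma>.
          cmod (fourier (\<lambda>x. \<phi> x * v \<epsilon> x) \<xi>)
            \<le> C * \<epsilon> powr (- N) * (1 + norm \<xi>) powr (- real l)))"

definition WF_g :: "(real^'n::finite) set \<Rightarrow> 'n net set \<Rightarrow> ((real^'n) \<times> (real^'n)) set" where
  "WF_g \<Omega> u = cotangent_nonzero \<Omega> - {(x, \<xi>). microlocally_regular \<Omega> u x \<xi>}"


section \<open>Partial differential operators with Colombeau coefficients\<close>

text \<open>An operator \<open>\<Sum>\<bar>\<alpha>\<bar>\<le>m. c\<^sub>\<alpha>(x) D\<^sup>\<alpha>\<close> of order \<open>m\<close> is given by its coefficient family \<open>c\<close>,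
  of which only the entries with \<open>\<bar>\<alpha>\<bar> \<le> m\<close> matter.\<close>

type_synonym 'n coeffs = "nat^'n \<Rightarrow> 'n net set"

definition coeff_reps :: "nat \<Rightarrow> 'n::finite coeffs \<Rightarrow> (nat^'n \<Rightarrow> 'n net) set" where
  "coeff_reps m c = {b. \<forall>\<alpha>. mi_order \<alpha> \<le> m \<longrightarrow> b \<alpha> \<in> c \<alpha>}"

text \<open>The action on representatives; all choices of representatives give the same class, so the
  union is that single class.\<close>

definition pdo_apply ::
  "(real^'n::finite) set \<Rightarrow> nat \<Rightarrow> 'n coeffs \<Rightarrow> 'n net set \<Rightarrow> 'n net set" where
  "pdo_apply \<Omega> m c u = (\<Union>b\<in>coeff_reps m c. \<Union>v\<in>u.
     colombeau_class \<Omega> (\<lambda>\<epsilon> x. \<Sum>\<alpha> | mi_order \<alpha> \<le> m. b \<alpha> \<epsilon> x * mi_D \<alpha> (v \<epsilon>) x))"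

definition pdo_symbol :: "nat \<Rightarrow> (nat^'n::finite \<Rightarrow> 'n net) \<Rightarrow> real \<Rightarrow> real^'n \<Rightarrow> real^'n \<Rightarrow> complex" where
  "pdo_symbol m b \<epsilon> x \<xi> = (\<Sum>\<alpha> | mi_order \<alpha> \<le> m. b \<alpha> \<epsilon> x * complex_of_real (mi_power \<xi> \<alpha>))"

definition principal_part :: "(real^'n::finite) set \<Rightarrow> nat \<Rightarrow> 'n coeffs \<Rightarrow> 'n coeffs" where
  "principal_part \<Omega> m c \<alpha> = (if mi_order \<alpha> = m then c \<alpha> else colombeau_class \<Omega> (\<lambda>\<epsilon> x. 0))"

text \<open>The coefficient family of \<open>\<Sum>j. a\<^sub>j(x) D\<^sub>j + a\<^sub>0(x)\<close>: the multi-indices of order at most 1 are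
  \<open>0\<close> and the unit vectors \<^term>\<open>axis j 1\<close>.\<close>

definition first_order_pdo :: "'n::finite net set \<Rightarrow> ('n \<Rightarrow> 'n net set) \<Rightarrow> 'n coeffs" where
  "first_order_pdo a\<^sub>0 a \<alpha> = (if \<alpha> = 0 then a\<^sub>0 else a (THE j. \<alpha> = axis j 1))"

definition Wsc_elliptic_at ::
  "(real^'n::finite) set \<Rightarrow> nat \<Rightarrow> 'n coeffs \<Rightarrow> real^'n \<Rightarrow> real^'n \<Rightarrow> bool" where
  "Wsc_elliptic_at \<Omega> m c x\<^sub>0 \<xi>\<^sub>0 \<longleftrightarrow> (\<exists>b\<in>coeff_reps m c. \<exists>U \<Gamma> s r.
     open U \<and> x\<^sub>0 \<in> U \<and> U \<subseteq> \<Omega> \<and> conic_nbhd \<xi>\<^sub>0 \<Gamma> \<and>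
     pos_slow_scale_net s \<and> pos_slow_scale_net r \<and>
     (\<forall>\<^sub>F \<epsilon> in at_right 0. \<forall>x\<in>U. \<forall>\<xi>\<in>\<Gamma>. norm \<xi> \<ge> r \<epsilon> \<longrightarrow>
        cmod (pdo_symbol m b \<epsilon> x \<xi>) \<ge> inverse (s \<epsilon>) * (1 + norm \<xi>) ^ m))"

definition Wsc_Ell ::
  "(real^'n::finite) set \<Rightarrow> nat \<Rightarrow> 'n coeffs \<Rightarrow> ((real^'n) \<times> (real^'n)) set" where
  "Wsc_Ell \<Omega> m c = {(x, \<xi>) \<in> cotangent_nonzero \<Omega>. Wsc_elliptic_at \<Omega> m c x \<xi>}"

end

theory Submission
  imports Defs "HOL-Probability.Characteristic_Functions" "HOL-Probability.Sinc_Integral"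
begin

text \<open>
  Write \<open>p(x, \<xi>) = \<Sum>j. a\<^sub>j(x) \<xi>\<^sub>j\<close> and let \<open>P\<^sup>t\<close> be the transpose of \<open>P\<close>. Since \<open>P\<close> has order one,
  \<open>P\<^sup>t(exp(-i x\<xi>) v) = exp(-i x\<xi>) (p(x, \<xi>) v + P\<^sup>t v)\<close> exactly, so for \<open>q = \<bar>\<xi>\<bar> / p(\<cdot>, \<xi>)\<close> and a cutoff \<open>w\<close>
  integration by parts gives
  \<open>\<bar>\<xi>\<bar> \<integral> exp(-i x\<xi>) w u = \<integral> exp(-i x\<xi>) (q w) P u - \<integral> exp(-i x\<xi>) P\<^sup>t(q w) u\<close>.
  By slow scale ellipticity, \<open>q w\<close> and \<open>P\<^sup>t(q w)\<close> are again families all of whose derivatives grow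
  at a slow scale, uniformly in \<open>\<xi>\<close>, so the identity can be iterated: each round gains a factor
  \<open>1 / \<bar>\<xi>\<bar>\<close> while the power of \<open>1 / \<epsilon>\<close> in the last integral stays bounded, because a slow scale net
  is at most \<open>C / \<epsilon>\<close>. The integrals with \<open>P u\<close> are convolutions of the Fourier transform of
  \<open>\<psi> P u\<close>, for one fixed cutoff \<open>\<psi>\<close>, with the rapidly decreasing transform of \<open>q w / \<psi>\<close>.
\<close>

section \<open>Partial derivatives and smooth functions\<close>

text \<open>Microlocal regularity fixes the exponent \<open>N\<close> before the decay order
  \<open>l\<close>, and this shapes the proof. For \<open>P u\<close> that exponent may depend on
  the test function, while the cutoffs of the iteration vary with \<epsilon>, \<xi> and the round;
  so the hypothesis on \<open>P u\<close> is applied to one bump \<psi>, and every other cutoff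
  becomes \<psi> times a factor with a rapidly decreasing transform. Likewise a fixed bound
  \<open>1 / \<epsilon>\<close> on the cutoffs would get worse with each product. Slow scale bounds
  are therefore kept as bounds by \<open>\<epsilon> powr (- \<delta>)\<close> for every \<delta> >
  0, stable under products and derivatives, and are exchanged for one power of
  \<open>1 / \<epsilon>\<close> only when an integral is estimated. Representatives are a second
  obstacle: regularity of \<open>P u\<close>, the action of \<open>P\<close> and ellipticity each
  come with their own, whereas integration by parts needs \<open>P\<close> applied exactly to the
  representative of \<open>u\<close>. The other two are transferred to it up to negligible nets. As
  \<open>mi_deriv\<close> leaves the order of differentiation open, reading bounds off
  representatives rests on Schwarz's theorem.\<close>

lemma partial_deriv_eq:
  assumes "(f has_derivative f') (at x)"
  shows "partial_deriv j f x = f' (axis j 1)"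
  using frechet_derivative_at[OF assms] by (simp add: partial_deriv_def)

lemma has_derivative_frechet:
  "f differentiable (at x) \<Longrightarrow> (f has_derivative frechet_derivative f (at x)) (at x)"
  by (simp add: frechet_derivative_works)

lemma partial_deriv_const [simp]: "partial_deriv j (\<lambda>x. c) = (\<lambda>x. 0)"
  by (simp add: partial_deriv_def)

lemma partial_deriv_add:
  assumes "f differentiable (at x)" "g differentiable (at x)"
  shows "partial_deriv j (\<lambda>x. f x + g x) x = partial_deriv j f x + partial_deriv j g x"
  by (subst partial_deriv_eq[OF has_derivative_add[OF assms[THEN has_derivative_frechet]]])
    (simp add: partial_deriv_def)

lemma partial_deriv_mult:
  assumes "f differentiable (at x)" "g differentiable (at x)"
  shows "partial_deriv j (\<lambda>x. f x * g x) x = f x * partial_deriv j g x + partial_deriv j f x * g x"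
  by (subst partial_deriv_eq[OF has_derivative_mult[OF assms[THEN has_derivative_frechet]]])
    (simp add: partial_deriv_def)

lemma partial_deriv_chain:
  fixes F :: "complex \<Rightarrow> complex"
  assumes "f differentiable (at x)" and "(F has_field_derivative D) (at (f x))"
  shows "(\<lambda>x. F (f x)) differentiable (at x)"
    and "partial_deriv j (\<lambda>x. F (f x)) x = D * partial_deriv j f x"
proof -
  have *: "((\<lambda>x. F (f x)) has_derivative (\<lambda>h. D * frechet_derivative f (at x) h)) (at x)"
    using has_derivative_compose[OF has_derivative_frechet[OF assms(1)], of F "(*) D"] assms(2)
    by (simp add: has_field_derivative_def)
  then show "(\<lambda>x. F (f x)) differentiable (at x)"
    by (rule differentiableI)
  show "partial_deriv j (\<lambda>x. F (f x)) x = D * partial_deriv j f x"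
    by (subst partial_deriv_eq[OF *]) (simp add: partial_deriv_def)
qed

lemma differentiable_cong_open:
  assumes "open V" "x \<in> V" "\<And>y. y \<in> V \<Longrightarrow> f y = g y" "f differentiable (at x)"
  shows "g differentiable (at x)"
  using has_derivative_transform_within_open[OF has_derivative_frechet[OF assms(4)] assms(1,2)] assms(3)
  by (blast intro: differentiableI)

lemma partial_deriv_cong_open:
  assumes "open V" "x \<in> V" "\<And>y. y \<in> V \<Longrightarrow> f y = g y"
  shows "partial_deriv j f x = partial_deriv j g x"
proof -
  have "(f has_derivative F) (at x) \<longleftrightarrow> (g has_derivative F) (at x)" for F
    using has_derivative_transform_within_open[OF _ assms(1,2), of f F UNIV g]
      has_derivative_transform_within_open[OF _ assms(1,2), of g F UNIV f] assms(3) by auto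
  then show ?thesis by (simp add: partial_deriv_def frechet_derivative_def)
qed

lemma iter_partial_deriv_cong_open:
  assumes "open V" "\<And>y. y \<in> V \<Longrightarrow> f y = g y" "x \<in> V"
  shows "foldr partial_deriv js f x = foldr partial_deriv js g x"
  using assms(3) by (induction js arbitrary: x) (auto intro: partial_deriv_cong_open[OF assms(1)] assms(2))

lemma iter_partial_deriv_zero_open:
  assumes "open V" "\<And>y. y \<in> V \<Longrightarrow> f y = 0" "x \<in> V"
  shows "foldr partial_deriv js f x = 0"
proof -
  have "foldr partial_deriv js (\<lambda>x. 0) = (\<lambda>x. 0)" for js :: "'a list" by (induction js) auto
  then show ?thesis
    using iter_partial_deriv_cong_open[OF assms(1), of f "\<lambda>_. 0" x js] assms(2,3) by simp
qed

text \<open>The derivative of a product or an inverse contains the functions themselves, so closure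
  properties are proved by induction on a finite order. The last entry of a list acts first; peeling
  it off, as \<open>smooth_upto_Suc\<close> does, exposes the innermost derivative, to which the
  product or chain rule applies.\<close>

definition smooth_upto :: "nat \<Rightarrow> (real^'n::finite) set \<Rightarrow> (real^'n \<Rightarrow> complex) \<Rightarrow> bool" where
  "smooth_upto n V f \<longleftrightarrow>
     (\<forall>js. length js \<le> n \<longrightarrow> (\<forall>x\<in>V. foldr partial_deriv js f differentiable (at x)))"

lemma smooth_functions_iff: "f \<in> smooth_functions V \<longleftrightarrow> (\<forall>n. smooth_upto n V f)"
  unfolding smooth_functions_def smooth_upto_def by blast

lemma smooth_upto_0: "smooth_upto 0 V f \<longleftrightarrow> (\<forall>x\<in>V. f differentiable (at x))"
  by (auto simp: smooth_upto_def)

lemma smooth_upto_Suc: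
  "smooth_upto (Suc n) V f \<longleftrightarrow>
     (\<forall>x\<in>V. f differentiable (at x)) \<and> (\<forall>j. smooth_upto n V (partial_deriv j f))"
  (is "?L \<longleftrightarrow> ?R")
proof
  assume L: ?L
  have "foldr partial_deriv js (partial_deriv j f) differentiable (at x)"
    if "length js \<le> n" "x \<in> V" for js j x
    using L that by (auto simp: smooth_upto_def dest!: spec[of _ "js @ [j]"])
  moreover have "f differentiable (at x)" if "x \<in> V" for x
    using L that by (auto simp: smooth_upto_def dest!: spec[of _ "[]"])
  ultimately show ?R by (auto simp: smooth_upto_def)
next
  assume R: ?R
  have "foldr partial_deriv js f differentiable (at x)" if "length js \<le> Suc n" "x \<in> V" for js x
  proof (cases js rule: rev_cases)
    case Nil
    then show ?thesis using R that by simp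
  next
    case (snoc ks j)
    then show ?thesis using R that by (simp add: smooth_upto_def)
  qed
  then show ?L by (simp add: smooth_upto_def)
qed

lemma smooth_upto_mono: "smooth_upto n V f \<Longrightarrow> m \<le> n \<Longrightarrow> W \<subseteq> V \<Longrightarrow> smooth_upto m W f"
  unfolding smooth_upto_def by (meson order_trans subsetD)

lemma smooth_upto_cong:
  assumes "open V" "\<And>y. y \<in> V \<Longrightarrow> f y = g y" "smooth_upto n V f"
  shows "smooth_upto n V g"
  unfolding smooth_upto_def
proof (intro allI impI ballI)
  fix js :: "'a list" and x assume "length js \<le> n" "x \<in> V"
  then show "foldr partial_deriv js g differentiable (at x)"
    using differentiable_cong_open[OF assms(1) _ iter_partial_deriv_cong_open[OF assms(1,2)]] assms(3)
    by (simp add: smooth_upto_def)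
qed

lemma smooth_upto_const: "smooth_upto n V (\<lambda>x. c)"
  by (induction n arbitrary: c) (auto simp: smooth_upto_0 smooth_upto_Suc)

lemma smooth_upto_add:
  assumes "open V" "smooth_upto n V f" "smooth_upto n V g"
  shows "smooth_upto n V (\<lambda>x. f x + g x)"
  using assms(2,3)
proof (induction n arbitrary: f g)
  case (Suc n)
  have "smooth_upto n V (partial_deriv j (\<lambda>x. f x + g x))" for j
    by (rule smooth_upto_cong[OF assms(1) _ Suc.IH[of "partial_deriv j f" "partial_deriv j g"]])
      (use Suc.prems in \<open>auto simp: smooth_upto_Suc partial_deriv_add\<close>)
  with Suc.prems show ?case by (auto simp: smooth_upto_Suc)
qed (auto simp: smooth_upto_0)

lemma smooth_upto_mult:
  assumes "open V" "smooth_upto n V f" "smooth_upto n V g"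
  shows "smooth_upto n V (\<lambda>x. f x * g x)"
  using assms(2,3)
proof (induction n arbitrary: f g)
  case (Suc n)
  have *: "smooth_upto n V f" "smooth_upto n V g"
    using Suc.prems by (auto elim: smooth_upto_mono)
  have "smooth_upto n V (partial_deriv j (\<lambda>x. f x * g x))" for j
    by (rule smooth_upto_cong[OF assms(1) _ smooth_upto_add[OF assms(1)
          Suc.IH[of f "partial_deriv j g"] Suc.IH[of "partial_deriv j f" g]]])
      (use Suc.prems * in \<open>auto simp: smooth_upto_Suc partial_deriv_mult\<close>)
  with Suc.prems show ?case by (auto simp: smooth_upto_Suc)
qed (auto simp: smooth_upto_0)

lemma smooth_upto_inverse:
  assumes "open V" "smooth_upto n V f" "\<And>x. x \<in> V \<Longrightarrow> f x \<noteq> 0"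
  shows "smooth_upto n V (\<lambda>x. inverse (f x))"
  using assms(2)
proof (induction n)
  case 0
  then show ?case using assms(3) by (auto simp: smooth_upto_0)
next
  case (Suc n)
  have *: "smooth_upto n V (\<lambda>x. inverse (f x))" and d: "\<And>x. x \<in> V \<Longrightarrow> f differentiable (at x)"
    using Suc.IH[OF smooth_upto_mono[OF Suc.prems]] Suc.prems by (auto simp: smooth_upto_Suc)
  have p: "partial_deriv j (\<lambda>x. inverse (f x)) x
      = - (inverse (f x) * inverse (f x)) * partial_deriv j f x" if "x \<in> V" for j x
    using partial_deriv_chain(2)[OF d DERIV_inverse, OF that assms(3)] that by simp
  have "smooth_upto n V (partial_deriv j (\<lambda>x. inverse (f x)))" for j
  proof (rule smooth_upto_cong[OF assms(1)])
    show "smooth_upto n V (\<lambda>x. (- 1) * (inverse (f x) * inverse (f x)) * partial_deriv j f x)"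
      using Suc.prems by (intro smooth_upto_mult[OF assms(1)] * smooth_upto_const) (simp add: smooth_upto_Suc)
  qed (simp add: p)
  with d assms(3) show ?case by (auto simp: smooth_upto_Suc)
qed

lemma smooth_upto_exp:
  assumes "open V" "smooth_upto n V f"
  shows "smooth_upto n V (\<lambda>x. exp (f x))"
  using assms(2)
proof (induction n)
  case 0
  then show ?case using partial_deriv_chain(1)[OF _ DERIV_exp, of f] by (simp add: smooth_upto_0)
next
  case (Suc n)
  have *: "smooth_upto n V (\<lambda>x. exp (f x))" and d: "\<And>x. x \<in> V \<Longrightarrow> f differentiable (at x)"
    using Suc.IH[OF smooth_upto_mono[OF Suc.prems]] Suc.prems by (auto simp: smooth_upto_Suc)
  have "smooth_upto n V (partial_deriv j (\<lambda>x. exp (f x)))" for j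
    by (rule smooth_upto_cong[OF assms(1) partial_deriv_chain(2)[OF d DERIV_exp, symmetric]])
      (use Suc.prems in \<open>auto intro!: smooth_upto_mult[OF assms(1)] * simp: smooth_upto_Suc\<close>)
  with d show ?case using partial_deriv_chain(1)[OF d DERIV_exp] by (simp add: smooth_upto_Suc)
qed

section \<open>Closure properties of the space of smooth functions\<close>

lemma smooth_const: "(\<lambda>x. c) \<in> smooth_functions V"
  by (simp add: smooth_functions_iff smooth_upto_const)

lemma smooth_add:
  "open V \<Longrightarrow> f \<in> smooth_functions V \<Longrightarrow> g \<in> smooth_functions V
    \<Longrightarrow> (\<lambda>x. f x + g x) \<in> smooth_functions V"
  by (simp add: smooth_functions_iff smooth_upto_add)

lemma smooth_mult:
  "open V \<Longrightarrow> f \<in> smooth_functions V \<Longrightarrow> g \<in> smooth_functions V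
    \<Longrightarrow> (\<lambda>x. f x * g x) \<in> smooth_functions V"
  by (simp add: smooth_functions_iff smooth_upto_mult)

lemma smooth_uminus:
  "open V \<Longrightarrow> f \<in> smooth_functions V \<Longrightarrow> (\<lambda>x. - f x) \<in> smooth_functions V"
  using smooth_mult[OF _ smooth_const, of V f "-1"] by simp

lemma smooth_diff:
  "open V \<Longrightarrow> f \<in> smooth_functions V \<Longrightarrow> g \<in> smooth_functions V
    \<Longrightarrow> (\<lambda>x. f x - g x) \<in> smooth_functions V"
  using smooth_add[of V f "\<lambda>x. - g x"] smooth_uminus[of V g] by simp

lemma smooth_sum:
  "open V \<Longrightarrow> (\<And>i. i \<in> A \<Longrightarrow> f i \<in> smooth_functions V)
    \<Longrightarrow> (\<lambda>x. \<Sum>i\<in>A. f i x) \<in> smooth_functions V"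
  by (induction A rule: infinite_finite_induct) (auto intro: smooth_const smooth_add)

lemma smooth_inverse:
  "open V \<Longrightarrow> f \<in> smooth_functions V \<Longrightarrow> (\<And>x. x \<in> V \<Longrightarrow> f x \<noteq> 0)
    \<Longrightarrow> (\<lambda>x. inverse (f x)) \<in> smooth_functions V"
  by (simp add: smooth_functions_iff smooth_upto_inverse)

lemma smooth_exp:
  "open V \<Longrightarrow> f \<in> smooth_functions V \<Longrightarrow> (\<lambda>x. exp (f x)) \<in> smooth_functions V"
  by (simp add: smooth_functions_iff smooth_upto_exp)

lemma smooth_differentiable: "f \<in> smooth_functions V \<Longrightarrow> x \<in> V \<Longrightarrow> f differentiable (at x)"
  unfolding smooth_functions_def by (auto dest!: spec[of _ "[]"])

lemma smooth_continuous_on: "f \<in> smooth_functions V \<Longrightarrow> continuous_on V f"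
  by (meson continuous_at_imp_continuous_on differentiable_imp_continuous_within smooth_differentiable)

lemma smooth_partial_deriv:
  assumes "f \<in> smooth_functions V" shows "partial_deriv j f \<in> smooth_functions V"
  using assms unfolding smooth_functions_iff by (metis smooth_upto_Suc)

lemma smooth_iter_partial_deriv:
  "f \<in> smooth_functions V \<Longrightarrow> foldr partial_deriv js f \<in> smooth_functions V"
  by (induction js) (auto intro: smooth_partial_deriv)

lemma smooth_subset: "f \<in> smooth_functions V \<Longrightarrow> W \<subseteq> V \<Longrightarrow> f \<in> smooth_functions W"
  unfolding smooth_functions_def by blast

lemma smooth_Un: "f \<in> smooth_functions V \<Longrightarrow> f \<in> smooth_functions W \<Longrightarrow> f \<in> smooth_functions (V \<union> W)"
  unfolding smooth_functions_def by blast

lemma smooth_cong: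
  assumes "open V" "\<And>y. y \<in> V \<Longrightarrow> f y = g y" "f \<in> smooth_functions V"
  shows "g \<in> smooth_functions V"
  using assms smooth_upto_cong unfolding smooth_functions_iff by blast

text \<open>\<open>V\<close> and \<open>- L\<close> are open and cover the space, and on
  \<open>- L\<close> the function is zero. In this way products that are smooth only near the
  support of a cutoff become globally smooth.\<close>

lemma smooth_extend_zero:
  assumes "f \<in> smooth_functions V" "closed L" "L \<subseteq> V" "\<And>x. x \<notin> L \<Longrightarrow> f x = 0"
  shows "f \<in> smooth_functions UNIV"
proof -
  have "f \<in> smooth_functions (- L)"
    by (rule smooth_cong[OF _ _ smooth_const[of 0]]) (use assms in auto)
  from smooth_Un[OF assms(1) this] show ?thesis
    by (rule smooth_subset) (use assms(3) in auto)
qed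

lemma smooth_bounded_linear:
  assumes "bounded_linear f" shows "f \<in> smooth_functions V"
proof -
  have "partial_deriv j f = (\<lambda>x. f (axis j 1))" for j
    using partial_deriv_eq[OF bounded_linear_imp_has_derivative[OF assms]] by auto
  then have "smooth_upto n V f" for n
    using bounded_linear_imp_differentiable[OF assms]
    by (cases n) (auto simp: smooth_upto_0 smooth_upto_Suc smooth_upto_const)
  then show ?thesis by (simp add: smooth_functions_iff)
qed

text \<open>The second difference of \<open>f\<close> is symmetric in \<open>i\<close> and
  \<open>j\<close>, so approximating both mixed derivatives by it makes them agree. It is estimated
  by applying the mean value inequality in direction \<open>i\<close> to the increment of
  \<open>f\<close> in direction \<open>j\<close>.\<close>

lemma partial_deriv_second_difference:
  fixes f :: "real^'n::finite \<Rightarrow> complex"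
  assumes V: "open V" "x \<in> V" and f: "\<And>y. y \<in> V \<Longrightarrow> f differentiable (at y)"
    and fi: "partial_deriv i f differentiable (at x)" and e: "e > 0"
  obtains d where "d > 0" and "\<And>t. 0 < t \<Longrightarrow> t < d \<Longrightarrow>
    cmod (f (x + t *\<^sub>R axis i 1 + t *\<^sub>R axis j 1) - f (x + t *\<^sub>R axis i 1) - f (x + t *\<^sub>R axis j 1) + f x
      - t\<^sup>2 *\<^sub>R partial_deriv j (partial_deriv i f) x) \<le> e * t\<^sup>2"
proof -
  define L where "L = frechet_derivative (partial_deriv i f) (at x)"
  have hd: "(partial_deriv i f has_derivative L) (at x)"
    unfolding L_def by (rule has_derivative_frechet[OF fi])
  then have lin: "linear L" by (rule has_derivative_linear)
  from hd obtain d1 where d1: "d1 > 0" and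
    b1: "\<And>y. norm (y - x) < d1 \<Longrightarrow>
      norm (partial_deriv i f y - partial_deriv i f x - L (y - x)) \<le> e / 3 * norm (y - x)"
    unfolding has_derivative_at_alt using e by (metis divide_pos_pos zero_less_numeral)
  obtain d2 where d2: "d2 > 0" "ball x d2 \<subseteq> V" using V by (meson openE)
  \<comment> \<open>All points that occur lie within \<open>2 * t\<close> of \<open>x\<close>;
    halving keeps them inside both balls.\<close>
  define d where "d = min d1 d2 / 2"
  have "d > 0" using d1 d2 by (simp add: d_def)
  moreover have "cmod (f (x + t *\<^sub>R axis i 1 + t *\<^sub>R axis j 1) - f (x + t *\<^sub>R axis i 1) - f (x + t *\<^sub>R axis j 1) + f x
      - t\<^sup>2 *\<^sub>R partial_deriv j (partial_deriv i f) x) \<le> e * t\<^sup>2" if t: "0 < t" "t < d" for t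
  proof -
    define p where "p s = x + s *\<^sub>R axis i 1" for s :: real
    \<comment> \<open>With the linear term subtracted, the derivative of \<open>g\<close> is a
      difference of two remainders in the first order expansion of \<open>partial_deriv i f\<close>
      at \<open>x\<close>. Their points have distance at most \<open>2 * t\<close> and
      \<open>t\<close> from \<open>x\<close>, so the tolerance \<open>e / 3\<close> adds up to
      \<open>e * t\<close>.\<close>
    define g where "g s = f (p s + t *\<^sub>R axis j 1) - f (p s) - (s * t) *\<^sub>R L (axis j 1)" for s
    have n1: "norm (p s + t *\<^sub>R axis j 1 - x) \<le> 2 * t" and n2: "norm (p s - x) \<le> t"
      if "s \<in> {0..t}" for s
    proof -
      show "norm (p s - x) \<le> t" using that by (simp add: p_def norm_axis_1)
      then show "norm (p s + t *\<^sub>R axis j 1 - x) \<le> 2 * t"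
        using norm_triangle_ineq[of "p s - x" "t *\<^sub>R axis j 1 :: real^'n"] t
        by (simp add: norm_axis_1 algebra_simps)
    qed
    have V1: "p s + t *\<^sub>R axis j 1 \<in> V" and V2: "p s \<in> V"
      and s1: "norm (p s + t *\<^sub>R axis j 1 - x) < d1" and s2: "norm (p s - x) < d1"
      if "s \<in> {0..t}" for s
      using n1[OF that] n2[OF that] t d2 by (auto simp: d_def dist_norm norm_minus_commute subset_iff)
    have gd: "(g has_derivative (\<lambda>h. h *\<^sub>R (partial_deriv i f (p s + t *\<^sub>R axis j 1)
        - partial_deriv i f (p s) - t *\<^sub>R L (axis j 1)))) (at s within {0..t})"
      if s: "s \<in> {0..t}" for s
    proof -
      have a: "((\<lambda>s. f (p s + c)) has_derivative (\<lambda>h. h *\<^sub>R partial_deriv i f (p s + c))) (at s within {0..t})"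
        if "p s + c \<in> V" for c
      proof -
        have "((\<lambda>s. p s + c) has_derivative (\<lambda>h. h *\<^sub>R axis i 1)) (at s within {0..t})"
          unfolding p_def by (auto intro!: derivative_eq_intros)
        from has_derivative_compose[OF this has_derivative_frechet[OF f[OF that]]]
        show ?thesis
          using linear_frechet_derivative[OF f[OF that]]
          by (simp add: partial_deriv_def linear_scale)
      qed
      have a0: "((\<lambda>s. f (p s)) has_derivative (\<lambda>h. h *\<^sub>R partial_deriv i f (p s))) (at s within {0..t})"
        using a[of 0] V2[OF s] by simp
      show ?thesis unfolding g_def
        by (rule derivative_eq_intros a[OF V1[OF s]] a0 refl)+ (auto simp: algebra_simps scaleR_diff_right)
    qed
    have "norm (g t - g 0) \<le> (e * t) * norm (t - 0)"
    proof (rule differentiable_bound[OF convex_real_interval(5)[of 0 t] gd])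
      fix s assume s: "s \<in> {0..t}"
      let ?A = "p s + t *\<^sub>R axis j 1"
      have "L (?A - x) - L (p s - x) = t *\<^sub>R L (axis j 1)"
        by (subst linear_diff[OF lin, symmetric]) (simp add: linear_scale[OF lin])
      then have "partial_deriv i f ?A - partial_deriv i f (p s) - t *\<^sub>R L (axis j 1)
        = (partial_deriv i f ?A - partial_deriv i f x - L (?A - x))
          - (partial_deriv i f (p s) - partial_deriv i f x - L (p s - x))" by (simp add: algebra_simps)
      also have "norm \<dots> \<le> e / 3 * norm (?A - x) + e / 3 * norm (p s - x)"
        by (intro order_trans[OF norm_triangle_ineq4] add_mono b1 s1 s2 s)
      also have "\<dots> \<le> e / 3 * (2 * t) + e / 3 * t"
        by (intro add_mono mult_left_mono n1 n2 s) (use e in auto)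
      finally have "norm (partial_deriv i f ?A - partial_deriv i f (p s) - t *\<^sub>R L (axis j 1)) \<le> e * t"
        by simp
      then show "onorm (\<lambda>h. h *\<^sub>R (partial_deriv i f ?A - partial_deriv i f (p s) - t *\<^sub>R L (axis j 1))) \<le> e * t"
        by (simp add: onorm_scaleR_left[of "\<lambda>x. x"] onorm_id[unfolded id_def])
    qed (use t in auto)
    then show ?thesis
      using t by (simp add: g_def p_def L_def partial_deriv_def power2_eq_square algebra_simps)
  qed
  ultimately show ?thesis using that by blast
qed

lemma partial_deriv_commute:
  fixes f :: "real^'n::finite \<Rightarrow> complex"
  assumes V: "open V" "x \<in> V" and f: "f \<in> smooth_functions V"
  shows "partial_deriv i (partial_deriv j f) x = partial_deriv j (partial_deriv i f) x"
proof -
  have "norm (partial_deriv i (partial_deriv j f) x - partial_deriv j (partial_deriv i f) x) \<le> 2 * e"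
    if e: "e > 0" for e
  proof -
    note * = partial_deriv_second_difference[OF V smooth_differentiable[OF f]
        smooth_differentiable[OF smooth_partial_deriv[OF f] V(2)] e]
    obtain d1 where d1: "d1 > 0" "\<And>t. 0 < t \<Longrightarrow> t < d1 \<Longrightarrow>
      cmod (f (x + t *\<^sub>R axis i 1 + t *\<^sub>R axis j 1) - f (x + t *\<^sub>R axis i 1) - f (x + t *\<^sub>R axis j 1) + f x
      - t\<^sup>2 *\<^sub>R partial_deriv j (partial_deriv i f) x) \<le> e * t\<^sup>2" using * by blast
    obtain d2 where d2: "d2 > 0" "\<And>t. 0 < t \<Longrightarrow> t < d2 \<Longrightarrow>
      cmod (f (x + t *\<^sub>R axis j 1 + t *\<^sub>R axis i 1) - f (x + t *\<^sub>R axis j 1) - f (x + t *\<^sub>R axis i 1) + f x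
      - t\<^sup>2 *\<^sub>R partial_deriv i (partial_deriv j f) x) \<le> e * t\<^sup>2" using * by blast
    define t where "t = min d1 d2 / 2"
    have t: "0 < t" "t < d1" "t < d2" using d1(1) d2(1) by (auto simp: t_def)
    define X where "X = f (x + t *\<^sub>R axis i 1 + t *\<^sub>R axis j 1) - f (x + t *\<^sub>R axis i 1) - f (x + t *\<^sub>R axis j 1) + f x"
    have X': "f (x + t *\<^sub>R axis j 1 + t *\<^sub>R axis i 1) - f (x + t *\<^sub>R axis j 1) - f (x + t *\<^sub>R axis i 1) + f x = X"
      by (simp add: X_def algebra_simps)
    have "norm (t\<^sup>2 *\<^sub>R (partial_deriv i (partial_deriv j f) x - partial_deriv j (partial_deriv i f) x))
      = norm ((X - t\<^sup>2 *\<^sub>R partial_deriv j (partial_deriv i f) x) - (X - t\<^sup>2 *\<^sub>R partial_deriv i (partial_deriv j f) x))"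
      by (simp add: algebra_simps)
    also have "\<dots> \<le> e * t\<^sup>2 + e * t\<^sup>2"
      by (intro order_trans[OF norm_triangle_ineq4] add_mono d1(2)[OF t(1,2), folded X_def]
          d2(2)[OF t(1,3), unfolded X'])
    finally have "t\<^sup>2 * norm (partial_deriv i (partial_deriv j f) x - partial_deriv j (partial_deriv i f) x) \<le> t\<^sup>2 * (2 * e)"
      by (simp add: mult.commute mult.left_commute)
    then show ?thesis using t by simp
  qed
  then have "norm (partial_deriv i (partial_deriv j f) x - partial_deriv j (partial_deriv i f) x) \<le> e"
    if "e > 0" for e using that by (metis field_sum_of_halves half_gt_zero mult_2)
  then show ?thesis by (metis dense_ge norm_le_zero_iff right_minus_eq)
qed

lemma partial_deriv_iter_commute:
  assumes V: "open V" and f: "f \<in> smooth_functions V" and "x \<in> V"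
  shows "partial_deriv i (foldr partial_deriv js f) x = foldr partial_deriv js (partial_deriv i f) x"
  using assms(3)
proof (induction js arbitrary: x)
  case (Cons j js)
  have "partial_deriv i (partial_deriv j (foldr partial_deriv js f)) x
      = partial_deriv j (partial_deriv i (foldr partial_deriv js f)) x"
    by (rule partial_deriv_commute[OF V Cons.prems smooth_iter_partial_deriv[OF f]])
  also have "\<dots> = partial_deriv j (foldr partial_deriv js (partial_deriv i f)) x"
    by (rule partial_deriv_cong_open[OF V Cons.prems Cons.IH])
  finally show ?case by simp
qed simp

lemma iter_partial_deriv_mset:
  assumes V: "open V" and f: "f \<in> smooth_functions V" and "x \<in> V" and "mset js = mset ks"
  shows "foldr partial_deriv js f x = foldr partial_deriv ks f x"
  using assms(2-)
proof (induction js arbitrary: ks f)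
  case (Cons i js)
  from Cons.prems(3) have "i \<in> set ks" by (metis list.set_intros(1) mset_eq_setD)
  then obtain p q where ks: "ks = p @ i # q" by (meson split_list)
  have "foldr partial_deriv (i # js) f x = foldr partial_deriv js (partial_deriv i f) x"
    using partial_deriv_iter_commute[OF V Cons.prems(1,2)] by simp
  also have "\<dots> = foldr partial_deriv (p @ q) (partial_deriv i f) x"
    by (rule Cons.IH) (use Cons.prems ks smooth_partial_deriv in auto)
  also have "\<dots> = foldr partial_deriv p (foldr partial_deriv q (partial_deriv i f)) x" by simp
  also have "\<dots> = foldr partial_deriv p (partial_deriv i (foldr partial_deriv q f)) x"
    by (rule iter_partial_deriv_cong_open[OF V _ Cons.prems(2)])
      (simp add: partial_deriv_iter_commute[OF V Cons.prems(1)])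
  finally show ?case by (simp add: ks)
qed simp

text \<open>\<open>mi_deriv\<close> differentiates along whichever list the choice operator selects;
  that list is a permutation of \<open>js\<close>, so Schwarz's theorem identifies the two. Bounds
  on nets pass from multi-indices to lists through this equation.\<close>

lemma mi_deriv_count_list:
  assumes "open V" "f \<in> smooth_functions V" "x \<in> V"
  shows "mi_deriv (\<chi> j. count_list js j) f x = foldr partial_deriv js f x"
proof -
  define ks where "ks = (SOME ks. \<forall>j. count_list ks j = (\<chi> j. count_list js j) $ j)"
  have "\<forall>j. count_list ks j = (\<chi> j. count_list js j) $ j"
    unfolding ks_def by (rule someI[of _ js]) simp
  then have "mset ks = mset js" by (simp add: multiset_eq_iff count_mset)
  then show ?thesis
    using iter_partial_deriv_mset[OF assms, of ks js] by (simp add: mi_deriv_def ks_def)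
qed

section \<open>Integration over Euclidean space\<close>

lemma
  fixes f :: "'a::euclidean_space \<Rightarrow> real \<Rightarrow> complex"
  assumes "\<And>b. b \<in> Basis \<Longrightarrow> integrable lborel (f b)"
  shows integrable_lborel_prod: "integrable lborel (\<lambda>x::'a. \<Prod>b\<in>Basis. f b (x \<bullet> b))"
    and integral_lborel_prod:
      "(\<integral>x. (\<Prod>b\<in>Basis. f b (x \<bullet> b)) \<partial>lborel) = (\<Prod>b\<in>Basis. \<integral>t. f b t \<partial>lborel)"
proof -
  interpret product_sigma_finite "\<lambda>_::'a. lborel :: real measure" ..
  have [measurable]: "f b \<in> borel_measurable borel" if "b \<in> Basis" for b
    using borel_measurable_integrable[OF assms[OF that]] by simp
  have [measurable]: "(\<lambda>x::'a. \<Prod>b\<in>Basis. f b (x \<bullet> b)) \<in> borel_measurable borel"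
    by measurable
  have *: "(\<Prod>b\<in>Basis. f b ((\<Sum>c\<in>Basis. y c *\<^sub>R c) \<bullet> b)) = (\<Prod>b\<in>Basis. f b (y b))" for y :: "'a \<Rightarrow> real"
    by (intro prod.cong refl) simp
  show "integrable lborel (\<lambda>x::'a. \<Prod>b\<in>Basis. f b (x \<bullet> b))"
    by (subst lborel_eq, subst integrable_distr_eq) (auto simp: * intro!: product_integrable_prod assms)
  show "(\<integral>x. (\<Prod>b\<in>Basis. f b (x \<bullet> b)) \<partial>lborel) = (\<Prod>b\<in>Basis. \<integral>t. f b t \<partial>lborel)"
    by (subst lborel_eq, subst integral_distr) (auto simp: * intro!: product_integral_prod assms)
qed

lemma
  fixes f :: "'a::euclidean_space \<Rightarrow> complex"
  assumes [measurable]: "f \<in> borel_measurable borel" and c: "c \<noteq> 0"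
  shows integral_lborel_affine:
      "(\<integral>x. f x \<partial>lborel) = of_real (\<bar>c\<bar> ^ DIM('a)) * (\<integral>x. f (t + c *\<^sub>R x) \<partial>lborel)"
    and integrable_lborel_affine: "integrable lborel f \<Longrightarrow> integrable lborel (\<lambda>x. f (t + c *\<^sub>R x))"
proof -
  show "(\<integral>x. f x \<partial>lborel) = of_real (\<bar>c\<bar> ^ DIM('a)) * (\<integral>x. f (t + c *\<^sub>R x) \<partial>lborel)"
    by (subst lborel_affine[OF c, of t], subst integral_density, simp_all add: integral_distr)
      (simp add: scaleR_conv_of_real)
  assume "integrable lborel f"
  then have "integrable (density (distr lborel borel (\<lambda>x. t + c *\<^sub>R x)) (\<lambda>_. \<bar>c\<bar> ^ DIM('a))) f"
    using lborel_affine[OF c, of t] by simp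
  then have "integrable lborel (\<lambda>x. (\<bar>c\<bar> ^ DIM('a)) *\<^sub>R f (t + c *\<^sub>R x))"
    by (simp add: integrable_density integrable_distr_eq)
  then have "integrable lborel (\<lambda>x. inverse (\<bar>c\<bar> ^ DIM('a)) *\<^sub>R (\<bar>c\<bar> ^ DIM('a)) *\<^sub>R f (t + c *\<^sub>R x))"
    by (rule integrable_scaleR_right)
  then show "integrable lborel (\<lambda>x. f (t + c *\<^sub>R x))" using c by simp
qed

text \<open>Since \<open>1 + (x \<bullet> b)\<^sup>2 \<le> (1 + norm x)\<^sup>2\<close> for every
  coordinate, an exponent of two per dimension admits a product of integrable functions of one
  variable as majorant.\<close>

lemma integrable_inverse_norm_power:
  "integrable lborel (\<lambda>x::'a::euclidean_space. inverse ((1 + norm x) ^ (2 * DIM('a))))"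
proof (rule Bochner_Integration.integrable_bound)
  have "integrable lborel (\<lambda>t::real. inverse (1 + t\<^sup>2))"
    using integrable_inverse_1_plus_square by (simp add: set_integrable_def einterval_def)
  then have "integrable lborel (\<lambda>t::real. complex_of_real (inverse (1 + t\<^sup>2)))"
    by (rule integrable_of_real)
  then show "integrable lborel (\<lambda>x::'a. \<Prod>b\<in>Basis. complex_of_real (inverse (1 + (x \<bullet> b)\<^sup>2)))"
    by (intro integrable_lborel_prod)
  have "inverse ((1 + norm x) ^ (2 * DIM('a))) \<le> (\<Prod>b\<in>Basis. inverse (1 + (x \<bullet> b)\<^sup>2))" for x :: 'a
  proof -
    have "(1 + norm x) ^ (2 * DIM('a)) = (\<Prod>b\<in>(Basis::'a set). (1 + norm x)\<^sup>2)"
      by (simp add: power_mult)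
    moreover have "(\<Prod>b\<in>(Basis::'a set). inverse ((1 + norm x)\<^sup>2)) \<le> (\<Prod>b\<in>Basis. inverse (1 + (x \<bullet> b)\<^sup>2))"
    proof (intro prod_mono conjI le_imp_inverse_le)
      fix b :: 'a assume "b \<in> Basis"
      then have "(x \<bullet> b)\<^sup>2 \<le> (norm x)\<^sup>2"
        using power_mono[OF Basis_le_norm[of b x], of 2] by simp
      then show "1 + (x \<bullet> b)\<^sup>2 \<le> (1 + norm x)\<^sup>2" by (simp add: power2_sum add_increasing2)
      show "0 < 1 + (x \<bullet> b)\<^sup>2" by (simp add: add_pos_nonneg)
    qed auto
    ultimately show ?thesis by (simp add: power_inverse)
  qed
  from order_trans[OF this abs_ge_self]
  show "AE x::'a in lborel. norm (inverse ((1 + norm x) ^ (2 * DIM('a))))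
      \<le> norm (\<Prod>b\<in>Basis. complex_of_real (inverse (1 + (x \<bullet> b)\<^sup>2)))"
    by (simp only: norm_of_real abs_inverse power_abs real_norm_def flip: of_real_prod) simp
qed measurable

text \<open>Fubini for a bounded kernel. With an oscillating exponential as \<open>K\<close> it
  serves both the regularized inversion integral and the convolution formula.\<close>

lemma
  fixes f g :: "'a::euclidean_space \<Rightarrow> complex" and K :: "'a \<Rightarrow> 'a \<Rightarrow> complex"
  assumes f: "integrable lborel f" and g: "integrable lborel g"
    and [measurable]: "case_prod K \<in> borel_measurable borel" and K: "\<And>x y. norm (K x y) \<le> 1"
  shows integrable_kernel: "integrable lborel (\<lambda>y. g y * (\<integral>x. K x y * f x \<partial>lborel))"
    and integral_kernel_swap: "(\<integral>x. f x * (\<integral>y. K x y * g y \<partial>lborel) \<partial>lborel)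
      = (\<integral>y. g y * (\<integral>x. K x y * f x \<partial>lborel) \<partial>lborel)"
proof -
  note [measurable] = borel_measurable_integrable[OF f] borel_measurable_integrable[OF g]
  have Km[measurable]: "case_prod K \<in> borel_measurable (lborel \<Otimes>\<^sub>M lborel)"
    using assms(3) by (simp add: lborel_prod)
  have int: "integrable (lborel \<Otimes>\<^sub>M lborel) (\<lambda>(x, y). K x y * f x * g y)"
  proof (rule Bochner_Integration.integrable_bound)
    show "integrable (lborel \<Otimes>\<^sub>M lborel) (\<lambda>(x, y). f x * g y)"
      by (rule lborel_pair.Fubini_integrable)
        (auto intro!: integrable_mult_right integrable_mult_left integrable_norm f g simp: norm_mult)
    show "AE x in lborel \<Otimes>\<^sub>M lborel. norm (case x of (x, y) \<Rightarrow> K x y * f x * g y)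
        \<le> norm (case x of (x, y) \<Rightarrow> f x * g y)"
      using K by (auto intro!: AE_I2 mult_right_mono simp: norm_mult split: prod.splits
          intro: order_trans[OF mult_right_mono[OF K]])
  qed measurable
  have "integrable lborel (\<lambda>y. \<integral>x. K x y * f x * g y \<partial>lborel)"
    using lborel_pair.integrable_snd[OF int] by simp
  then show "integrable lborel (\<lambda>y. g y * (\<integral>x. K x y * f x \<partial>lborel))"
    by (simp add: mult.commute)
  have "(\<integral>x. f x * (\<integral>y. K x y * g y \<partial>lborel) \<partial>lborel) = (\<integral>x. (\<integral>y. K x y * f x * g y \<partial>lborel) \<partial>lborel)"
    by (simp add: mult.assoc mult.left_commute flip: integral_mult_right_zero)
  also have "\<dots> = (\<integral>y. (\<integral>x. K x y * f x * g y \<partial>lborel) \<partial>lborel)"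
    using lborel_pair.Fubini_integral[OF int] by simp
  finally show "(\<integral>x. f x * (\<integral>y. K x y * g y \<partial>lborel) \<partial>lborel)
      = (\<integral>y. g y * (\<integral>x. K x y * f x \<partial>lborel) \<partial>lborel)"
    by (simp add: mult.commute)
qed

lemma integrable_continuous_zero_off_compact:
  fixes f :: "'a::euclidean_space \<Rightarrow> complex"
  assumes "continuous_on UNIV f" "compact L" "\<And>x. x \<notin> L \<Longrightarrow> f x = 0"
  shows "integrable lborel f"
proof -
  have "(\<lambda>x. indicator L x *\<^sub>R f x) = f" using assms(3) by (auto simp: indicator_def)
  then show ?thesis
    using borel_integrable_compact[OF assms(2) continuous_on_subset[OF assms(1)]] by simp
qed

lemma integrable_smooth:
  "f \<in> smooth_functions UNIV \<Longrightarrow> compact L \<Longrightarrow> (\<And>x. x \<notin> L \<Longrightarrow> f x = 0) \<Longrightarrow> integrable lborel f"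
  using integrable_continuous_zero_off_compact smooth_continuous_on by blast

lemma norm_integral_zero_off_compact_le:
  fixes f :: "'a::euclidean_space \<Rightarrow> complex"
  assumes "integrable lborel f" "compact L" "\<And>x. x \<notin> L \<Longrightarrow> f x = 0" "\<And>x. x \<in> L \<Longrightarrow> norm (f x) \<le> B"
  shows "norm (\<integral>x. f x \<partial>lborel) \<le> measure lborel L * B"
proof -
  have fin: "emeasure lborel L < \<infinity>" using assms(2) by (rule emeasure_compact_finite)
  have [measurable]: "L \<in> sets borel" using assms(2) by (rule borel_compact)
  have "norm (\<integral>x. f x \<partial>lborel) \<le> (\<integral>x. indicator L x * B \<partial>lborel)"
    using assms fin
    by (intro Bochner_Integration.integral_norm_bound_integral integrable_mult_left integrable_real_indicator)
      (auto simp: indicator_def)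
  also have "\<dots> = measure lborel L * B" by simp
  finally show ?thesis .
qed

text \<open>Difference quotients have integral zero by translation invariance, and dominated
  convergence carries this over to the derivative.\<close>

lemma integral_partial_deriv_zero:
  fixes h :: "real^'n::finite \<Rightarrow> complex"
  assumes h: "h \<in> smooth_functions UNIV" and L: "compact L" "\<And>x. x \<notin> L \<Longrightarrow> h x = 0"
  shows "(\<integral>x. partial_deriv j h x \<partial>lborel) = 0"
proof -
  have d0: "partial_deriv j h x = 0" if "x \<notin> L" for x
    using iter_partial_deriv_zero_open[of "- L" h x "[j]"] L that open_Compl[OF compact_imp_closed[OF L(1)]] by auto
  have cont: "continuous_on UNIV h" "continuous_on UNIV (partial_deriv j h)"
    by (intro smooth_continuous_on smooth_partial_deriv h)+
  note meas[measurable] = cont[THEN borel_measurable_continuous_onI]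
  have "bounded (partial_deriv j h ` L)"
    by (intro compact_imp_bounded compact_continuous_image continuous_on_subset[OF cont(2)] L) auto
  then obtain B0 where B0: "\<And>x. x \<in> L \<Longrightarrow> norm (partial_deriv j h x) \<le> B0"
    by (auto simp: bounded_iff)
  \<comment> \<open>The maximum matters when \<open>L\<close> is empty: \<open>B0\<close> could then
    be negative.\<close>
  define B where "B = max B0 0"
  have B: "norm (partial_deriv j h x) \<le> B" for x
    using B0[of x] d0[of x] by (cases "x \<in> L") (auto simp: B_def)
  have hd: "((\<lambda>s. h (x + s *\<^sub>R axis j 1)) has_vector_derivative partial_deriv j h (x + s *\<^sub>R axis j 1)) (at s within S)"
    for x s S
  proof -
    have "((\<lambda>s. x + s *\<^sub>R axis j 1) has_derivative (\<lambda>r. r *\<^sub>R axis j 1)) (at s within S)"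
      by (auto intro!: derivative_eq_intros)
    from has_derivative_compose[OF this has_derivative_frechet[OF smooth_differentiable[OF h UNIV_I]]]
    show ?thesis
      using linear_frechet_derivative[OF smooth_differentiable[OF h UNIV_I]]
      by (simp add: partial_deriv_def linear_scale has_vector_derivative_def)
  qed
  obtain R where R: "\<And>x. x \<in> L \<Longrightarrow> norm x \<le> R"
    using compact_imp_bounded[OF L(1)] by (auto simp: bounded_iff)
  define t where "t k = inverse (real (Suc k))" for k
  have t: "0 < t k" "t k \<le> 1" for k by (auto simp: t_def inverse_eq_divide)
  define q where "q k x = (h (x + t k *\<^sub>R axis j 1) - h x) /\<^sub>R t k" for k x
  have inth: "integrable lborel h" by (rule integrable_smooth[OF h L])
  have iq: "(\<integral>x. q k x \<partial>lborel) = 0" for k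
  proof -
    have "integrable lborel (\<lambda>x. h (t k *\<^sub>R axis j 1 + 1 *\<^sub>R x))"
      by (rule integrable_lborel_affine) (use inth in auto)
    moreover have "(\<integral>x. h x \<partial>lborel) = of_real (\<bar>1\<bar> ^ DIM(real^'n)) * (\<integral>x. h (t k *\<^sub>R axis j 1 + 1 *\<^sub>R x) \<partial>lborel)"
      by (rule integral_lborel_affine) auto
    ultimately show ?thesis using inth by (simp add: q_def add.commute)
  qed
  have "(\<lambda>k. \<integral>x. q k x \<partial>lborel) \<longlonglongrightarrow> (\<integral>x. partial_deriv j h x \<partial>lborel)"
  proof (rule integral_dominated_convergence[where w = "\<lambda>x. indicator (cball 0 (R + 1)) x * B"])
    \<comment> \<open>The steps satisfy \<open>t k \<le> 1\<close>, so all quotients vanish outside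
      the ball of radius \<open>R + 1\<close>.\<close>
    show "integrable lborel (\<lambda>x. indicator (cball 0 (R + 1)) x * B :: real)"
      by (intro integrable_mult_left integrable_real_indicator) (auto intro: emeasure_compact_finite[OF compact_cball, unfolded infinity_ennreal_def])
    show "AE x in lborel. (\<lambda>k. q k x) \<longlonglongrightarrow> partial_deriv j h x"
    proof (intro AE_I2)
      fix x
      have "((\<lambda>s. (h (x + s *\<^sub>R axis j 1) - h x) /\<^sub>R s) \<longlongrightarrow> partial_deriv j h x) (at 0)"
      proof (rule LIM_zero_cancel, rule tendsto_norm_zero_cancel)
        have "((\<lambda>s. norm (h (x + s *\<^sub>R axis j 1) - h x - s *\<^sub>R partial_deriv j h x) / norm s) \<longlongrightarrow> 0) (at 0)"
          using hd[of x 0 UNIV] by (simp add: has_vector_derivative_def has_derivative_at)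
        then show "((\<lambda>s. norm ((h (x + s *\<^sub>R axis j 1) - h x) /\<^sub>R s - partial_deriv j h x)) \<longlongrightarrow> 0) (at 0)"
        proof (rule Lim_transform_eventually)
          have "norm (h (x + s *\<^sub>R axis j 1) - h x - s *\<^sub>R partial_deriv j h x) / norm s
              = norm ((h (x + s *\<^sub>R axis j 1) - h x) /\<^sub>R s - partial_deriv j h x)" if "s \<noteq> 0" for s
          proof -
            have "(h (x + s *\<^sub>R axis j 1) - h x) /\<^sub>R s - partial_deriv j h x
                = (h (x + s *\<^sub>R axis j 1) - h x - s *\<^sub>R partial_deriv j h x) /\<^sub>R s"
              using that by (simp add: scaleR_diff_right)
            then show ?thesis by (simp add: divide_inverse mult.commute)
          qed
          then show "\<forall>\<^sub>F s in at 0. norm (h (x + s *\<^sub>R axis j 1) - h x - s *\<^sub>R partial_deriv j h x) / norm s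
              = norm ((h (x + s *\<^sub>R axis j 1) - h x) /\<^sub>R s - partial_deriv j h x)"
            by (auto simp: eventually_at_filter)
        qed
      qed
      moreover have "filterlim t (at 0) sequentially"
        unfolding filterlim_at using t LIMSEQ_inverse_real_of_nat by (auto simp: t_def[abs_def])
      ultimately show "(\<lambda>k. q k x) \<longlonglongrightarrow> partial_deriv j h x"
        unfolding q_def by (rule filterlim_compose)
    qed
    show "AE x in lborel. norm (q k x) \<le> indicator (cball 0 (R + 1)) x * B" for k
    proof (intro AE_I2)
      fix x
      have "norm (h (x + t k *\<^sub>R axis j 1) - h (x + 0 *\<^sub>R axis j 1)) \<le> B * norm (t k - 0)"
      proof (rule differentiable_bound[of "{0..t k}"])
        fix s show "onorm (\<lambda>r. r *\<^sub>R partial_deriv j h (x + s *\<^sub>R axis j 1)) \<le> B"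
          using B by (simp add: onorm_scaleR_left[of "\<lambda>x. x"] onorm_id[unfolded id_def])
      qed (use t[of k] hd in \<open>auto simp: has_vector_derivative_def\<close>)
      moreover have "norm (q k x) = norm (h (x + t k *\<^sub>R axis j 1) - h x) / t k"
        using t[of k] by (simp add: q_def divide_inverse mult.commute)
      ultimately have "norm (q k x) \<le> B" using t[of k] by (simp add: pos_divide_le_eq)
      moreover have "q k x = 0" if "R + 1 < norm x"
      proof -
        have "norm x - norm (t k *\<^sub>R axis j 1 :: real^'n) \<le> norm (x + t k *\<^sub>R axis j 1)"
          by (metis add.commute norm_diff_ineq)
        then have "x + t k *\<^sub>R axis j 1 \<notin> L" "x \<notin> L"
          using R[of x] R[of "x + t k *\<^sub>R axis j 1"] that t[of k] by (auto simp: norm_axis_1)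
        then show ?thesis using L(2) by (simp add: q_def)
      qed
      ultimately show "norm (q k x) \<le> indicator (cball 0 (R + 1)) x * B"
        by (cases "norm x \<le> R + 1") (auto simp: indicator_def)
    qed
  qed (auto simp: q_def)
  then show ?thesis by (simp add: iq LIMSEQ_const_iff)
qed

section \<open>The Fourier transform\<close>

text \<open>The Gaussian factorizes over the coordinates, and each one-dimensional integral is, up
  to \<open>sqrt (2 * pi)\<close>, the characteristic function of the standard normal
  distribution.\<close>

lemma
  fixes x :: "'a::euclidean_space"
  shows integrable_gauss: "integrable lborel (\<lambda>t::'a. exp (\<i> * of_real (t \<bullet> x)) * of_real (exp (- (norm t)\<^sup>2 / 2)))"
    and integral_gauss: "(\<integral>t. exp (\<i> * of_real (t \<bullet> x)) * of_real (exp (- (norm t)\<^sup>2 / 2)) \<partial>lborel)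
      = of_real (sqrt (2 * pi) ^ DIM('a) * exp (- (norm x)\<^sup>2 / 2))"
proof -
  have nsq: "(norm y)\<^sup>2 = (\<Sum>b\<in>Basis. (y \<bullet> b)\<^sup>2)" for y :: 'a
    by (subst power2_norm_eq_inner, subst euclidean_inner) (simp add: power2_eq_square)
  have gexp: "exp (- (norm y)\<^sup>2 / 2) = (\<Prod>b\<in>Basis. exp (- (y \<bullet> b)\<^sup>2 / 2))" for y :: 'a
    by (simp add: nsq exp_sum[symmetric] sum_negf sum_divide_distrib)
  define G where "G b s = iexp ((x \<bullet> b) * s) * of_real (exp (- s\<^sup>2 / 2))" for b and s :: real
  have prod: "exp (\<i> * of_real (t \<bullet> x)) * of_real (exp (- (norm t)\<^sup>2 / 2)) = (\<Prod>b\<in>Basis. G b (t \<bullet> b))" for t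
  proof -
    have "exp (\<i> * of_real (t \<bullet> x)) = (\<Prod>b\<in>Basis. iexp ((x \<bullet> b) * (t \<bullet> b)))"
      by (subst euclidean_inner) (simp add: exp_sum[symmetric] sum_distrib_left mult.commute)
    then show ?thesis by (simp only: gexp G_def prod.distrib of_real_prod)
  qed
  have G: "G b s = of_real (sqrt (2 * pi)) * (std_normal_density s *\<^sub>R iexp ((x \<bullet> b) * s))" for b s
    by (simp add: G_def std_normal_density_def scaleR_conv_of_real)
  have int: "integrable lborel (G b)" for b
  proof (rule Bochner_Integration.integrable_bound)
    show "integrable lborel (\<lambda>s. sqrt (2 * pi) * std_normal_density s)"
      by (intro integrable_mult_right integrable_normal_density) simp
    show "AE s in lborel. norm (G b s) \<le> norm (sqrt (2 * pi) * std_normal_density s)"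
      by (simp add: G norm_mult)
    show "G b \<in> borel_measurable lborel" unfolding G_def by measurable
  qed
  have val: "(\<integral>s. G b s \<partial>lborel) = of_real (sqrt (2 * pi) * exp (- (x \<bullet> b)\<^sup>2 / 2))" for b
  proof -
    have "(\<integral>s. std_normal_density s *\<^sub>R iexp ((x \<bullet> b) * s) \<partial>lborel) = char std_normal_distribution (x \<bullet> b)"
      unfolding char_def by (subst integral_density) auto
    then show ?thesis
      by (simp only: G integral_mult_right_zero char_std_normal_distribution of_real_mult)
  qed
  show "integrable lborel (\<lambda>t::'a. exp (\<i> * of_real (t \<bullet> x)) * of_real (exp (- (norm t)\<^sup>2 / 2)))"
    unfolding prod by (rule integrable_lborel_prod[OF int])
  show "(\<integral>t. exp (\<i> * of_real (t \<bullet> x)) * of_real (exp (- (norm t)\<^sup>2 / 2)) \<partial>lborel)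
      = of_real (sqrt (2 * pi) ^ DIM('a) * exp (- (norm x)\<^sup>2 / 2))"
    unfolding prod integral_lborel_prod[OF int] val
    by (simp only: gexp of_real_prod of_real_mult prod.distrib prod_constant of_real_power)
qed

lemma norm_exp_i [simp]: "norm (exp (\<i> * complex_of_real t)) = 1" "norm (exp (- (\<i> * complex_of_real t))) = 1"
  by (simp_all add: norm_exp_eq_Re)

lemma fourier_measurable [measurable]:
  assumes [measurable]: "f \<in> borel_measurable borel"
  shows "fourier f \<in> borel_measurable borel"
  unfolding fourier_def by measurable

text \<open>The inversion integral is damped by \<open>g (d k *\<^sub>R \<eta>)\<close>. Exchanging
  integrals turns it into an average of \<open>f\<close> against a Gaussian of width
  \<open>d k\<close> around \<open>x\<close>, and \<open>d k\<close> tends to 0. One factor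
  \<open>sqrt (2 * pi)\<close> per dimension comes from the transform of the Gaussian and one from
  its mass.\<close>

theorem fourier_inversion:
  fixes f :: "real^'n::finite \<Rightarrow> complex"
  assumes cont: "continuous_on UNIV f" and bd: "\<And>x. norm (f x) \<le> B"
    and f: "integrable lborel f" and ff: "integrable lborel (fourier f)"
  shows "(\<integral>\<eta>. exp (\<i> * of_real (x \<bullet> \<eta>)) * fourier f \<eta> \<partial>lborel) = of_real ((2 * pi) ^ CARD('n)) * f x"
proof -
  let ?n = "CARD('n)"
  note [measurable] = borel_measurable_continuous_onI[OF cont]
  define g where "g t = complex_of_real (exp (- (norm t)\<^sup>2 / 2))" for t :: "real^'n"
  have [measurable]: "g \<in> borel_measurable borel" unfolding g_def by measurable
  have ig: "integrable lborel g" and vg: "(\<integral>t. g t \<partial>lborel) = of_real (sqrt (2 * pi) ^ ?n)"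
    using integrable_gauss[of "0::real^'n"] integral_gauss[of "0::real^'n"] by (simp_all add: g_def[abs_def])
  have ng: "norm (g t) \<le> 1" for t by (simp add: g_def)
  define d where "d k = inverse (real (Suc k))" for k
  have d0: "d k > 0" for k by (simp add: d_def)
  have dlim: "d \<longlonglongrightarrow> 0" using LIMSEQ_inverse_real_of_nat by (simp add: d_def[abs_def])
  have igd: "integrable lborel (\<lambda>\<eta>. g (d k *\<^sub>R \<eta>))" for k
    using integrable_lborel_affine[of g "d k" 0] ig d0[of k] by simp
  have regularized: "(\<integral>\<eta>. exp (\<i> * of_real (x \<bullet> \<eta>)) * fourier f \<eta> * g (d k *\<^sub>R \<eta>) \<partial>lborel)
      = of_real (sqrt (2 * pi) ^ ?n) * (\<integral>z. f (x + (- d k) *\<^sub>R z) * g z \<partial>lborel)" for k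
  proof -
    define K where "K y \<eta> = exp (\<i> * complex_of_real ((x - y) \<bullet> \<eta>))" for y \<eta>
    have Km: "case_prod K \<in> borel_measurable borel"
      unfolding K_def case_prod_unfold by (intro borel_measurable_continuous_onI continuous_intros)
    have Kn: "norm (K y \<eta>) \<le> 1" for y \<eta> unfolding K_def by simp
    have inner: "(\<integral>\<eta>. K y \<eta> * g (d k *\<^sub>R \<eta>) \<partial>lborel)
        = of_real (inverse (d k) ^ ?n) * of_real (sqrt (2 * pi) ^ ?n) * g (inverse (d k) *\<^sub>R (x - y))" for y
    proof -
      have "(\<integral>\<eta>. K y \<eta> * g (d k *\<^sub>R \<eta>) \<partial>lborel) = of_real (\<bar>inverse (d k)\<bar> ^ DIM(real^'n))
          * (\<integral>\<eta>. K y (0 + inverse (d k) *\<^sub>R \<eta>) * g (d k *\<^sub>R (0 + inverse (d k) *\<^sub>R \<eta>)) \<partial>lborel)"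
        using d0[of k] by (intro integral_lborel_affine) (auto simp: K_def)
      also have "(\<integral>\<eta>. K y (0 + inverse (d k) *\<^sub>R \<eta>) * g (d k *\<^sub>R (0 + inverse (d k) *\<^sub>R \<eta>)) \<partial>lborel)
          = (\<integral>t. exp (\<i> * of_real (t \<bullet> (inverse (d k) *\<^sub>R (x - y)))) * of_real (exp (- (norm t)\<^sup>2 / 2)) \<partial>lborel)"
        using d0[of k] by (intro Bochner_Integration.integral_cong) (auto simp: K_def g_def inner_commute)
      also note integral_gauss
      finally show ?thesis
        using d0[of k] by (simp add: g_def del: norm_scaleR)
    qed
    have "exp (\<i> * of_real (x \<bullet> \<eta>)) * fourier f \<eta> * g (d k *\<^sub>R \<eta>) = g (d k *\<^sub>R \<eta>) * (\<integral>y. K y \<eta> * f y \<partial>lborel)" for \<eta>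
    proof -
      have "K y \<eta> * f y = exp (\<i> * of_real (x \<bullet> \<eta>)) * (exp (- \<i> * complex_of_real (y \<bullet> \<eta>)) * f y)" for y
        by (simp add: K_def inner_diff_left algebra_simps exp_diff exp_minus field_simps)
      then have "(\<integral>y. K y \<eta> * f y \<partial>lborel) = exp (\<i> * of_real (x \<bullet> \<eta>)) * fourier f \<eta>"
        by (simp only: fourier_def integral_mult_right_zero)
      then show ?thesis by simp
    qed
    then have "(\<integral>\<eta>. exp (\<i> * of_real (x \<bullet> \<eta>)) * fourier f \<eta> * g (d k *\<^sub>R \<eta>) \<partial>lborel)
      = (\<integral>y. f y * (\<integral>\<eta>. K y \<eta> * g (d k *\<^sub>R \<eta>) \<partial>lborel) \<partial>lborel)"
      by (simp only: integral_kernel_swap[OF f igd Km Kn])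
    also have "\<dots> = (\<integral>y. f y * (of_real (inverse (d k) ^ ?n) * of_real (sqrt (2 * pi) ^ ?n) * g (inverse (d k) *\<^sub>R (x - y))) \<partial>lborel)"
      by (simp only: inner)
    also have "(\<integral>y. f y * (of_real (inverse (d k) ^ ?n) * of_real (sqrt (2 * pi) ^ ?n) * g (inverse (d k) *\<^sub>R (x - y))) \<partial>lborel)
        = of_real (inverse (d k) ^ ?n) * of_real (sqrt (2 * pi) ^ ?n) * (\<integral>y. f y * g (inverse (d k) *\<^sub>R (x - y)) \<partial>lborel)"
      by (simp add: mult.left_commute flip: integral_mult_right_zero)
    \<comment> \<open>The substitution \<open>y = x - d k *\<^sub>R z\<close> produces a power of
      \<open>d k\<close> that cancels the power of \<open>inverse (d k)\<close> coming from
      \<open>inner\<close>.\<close>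
    also have "(\<integral>y. f y * g (inverse (d k) *\<^sub>R (x - y)) \<partial>lborel)
        = of_real (\<bar>- d k\<bar> ^ DIM(real^'n))
          * (\<integral>z. f (x + (- d k) *\<^sub>R z) * g (inverse (d k) *\<^sub>R (x - (x + (- d k) *\<^sub>R z))) \<partial>lborel)"
      using d0[of k] by (intro integral_lborel_affine) auto
    finally show ?thesis
      using d0[of k] by (simp add: power_inverse field_simps)
  qed
  have lim1: "(\<lambda>k. \<integral>\<eta>. exp (\<i> * of_real (x \<bullet> \<eta>)) * fourier f \<eta> * g (d k *\<^sub>R \<eta>) \<partial>lborel)
      \<longlonglongrightarrow> (\<integral>\<eta>. exp (\<i> * of_real (x \<bullet> \<eta>)) * fourier f \<eta> \<partial>lborel)"
  proof (rule integral_dominated_convergence[where w = "\<lambda>\<eta>. norm (fourier f \<eta>)"])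
    show "AE \<eta> in lborel. (\<lambda>k. exp (\<i> * of_real (x \<bullet> \<eta>)) * fourier f \<eta> * g (d k *\<^sub>R \<eta>))
        \<longlonglongrightarrow> exp (\<i> * of_real (x \<bullet> \<eta>)) * fourier f \<eta>"
    proof (intro AE_I2)
      fix \<eta> :: "real^'n"
      have "(\<lambda>k. g (d k *\<^sub>R \<eta>)) \<longlonglongrightarrow> g (0 *\<^sub>R \<eta>)"
        unfolding g_def by (intro tendsto_intros dlim)
          simp
      from tendsto_mult_left[OF this]
      show "(\<lambda>k. exp (\<i> * of_real (x \<bullet> \<eta>)) * fourier f \<eta> * g (d k *\<^sub>R \<eta>))
        \<longlonglongrightarrow> exp (\<i> * of_real (x \<bullet> \<eta>)) * fourier f \<eta>" by (simp add: g_def)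
    qed
    show "AE \<eta> in lborel. norm (exp (\<i> * of_real (x \<bullet> \<eta>)) * fourier f \<eta> * g (d k *\<^sub>R \<eta>)) \<le> norm (fourier f \<eta>)" for k
      using ng by (auto simp: norm_mult intro!: AE_I2 mult_left_le)
  qed (use ff in auto)
  have lim2: "(\<lambda>k. \<integral>z. f (x + (- d k) *\<^sub>R z) * g z \<partial>lborel) \<longlonglongrightarrow> (\<integral>z. f x * g z \<partial>lborel)"
  proof (rule integral_dominated_convergence[where w = "\<lambda>z. B * norm (g z)"])
    show "AE z in lborel. (\<lambda>k. f (x + (- d k) *\<^sub>R z) * g z) \<longlonglongrightarrow> f x * g z"
    proof (intro AE_I2 tendsto_mult_right)
      fix z
      have "(\<lambda>k. x + (- d k) *\<^sub>R z) \<longlonglongrightarrow> x + (- 0) *\<^sub>R z" by (intro tendsto_intros dlim)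
      moreover have "isCont f x" using cont by (simp add: continuous_on_eq_continuous_at)
      ultimately show "(\<lambda>k. f (x + (- d k) *\<^sub>R z)) \<longlonglongrightarrow> f x"
        using isCont_tendsto_compose[of x f "\<lambda>k. x + (- d k) *\<^sub>R z"] by simp
    qed
    show "AE z in lborel. norm (f (x + (- d k) *\<^sub>R z) * g z) \<le> B * norm (g z)" for k
      using bd by (auto simp: norm_mult intro!: AE_I2 mult_right_mono)
  qed (use ig in auto)
  have "(\<integral>\<eta>. exp (\<i> * of_real (x \<bullet> \<eta>)) * fourier f \<eta> \<partial>lborel)
      = of_real (sqrt (2 * pi) ^ ?n) * (\<integral>z. f x * g z \<partial>lborel)"
    using LIMSEQ_unique[OF lim1[unfolded regularized] tendsto_mult_left[OF lim2]] .
  also have "\<dots> = of_real (sqrt (2 * pi) ^ ?n * sqrt (2 * pi) ^ ?n) * f x"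
    by (simp only: integral_mult_right_zero vg of_real_mult mult_ac)
  also have "sqrt (2 * pi) ^ ?n * sqrt (2 * pi) ^ ?n = (2 * pi) ^ ?n"
    by (subst power_mult_distrib[symmetric], subst real_sqrt_mult_self) simp
  finally show ?thesis .
qed

text \<open>The inversion formula for \<open>g\<close> is inserted and the integrals are exchanged.
  All regularity is asked of \<open>g\<close>: in the application \<open>f\<close> contains the
  representative of \<open>P u\<close>, for whose transform decay is known only in a cone.\<close>

theorem fourier_mult_eq_convolution:
  fixes f g :: "real^'n::finite \<Rightarrow> complex"
  assumes f: "integrable lborel f" and "continuous_on UNIV g" "\<And>x. norm (g x) \<le> B"
    and "integrable lborel g" and gg: "integrable lborel (fourier g)"
  shows "integrable lborel (\<lambda>\<eta>. fourier g \<eta> * fourier f (\<xi> - \<eta>))"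
    and "of_real ((2 * pi) ^ CARD('n)) * fourier (\<lambda>x. f x * g x) \<xi>
      = (\<integral>\<eta>. fourier g \<eta> * fourier f (\<xi> - \<eta>) \<partial>lborel)"
proof -
  define K where "K x \<eta> = exp (\<i> * complex_of_real (x \<bullet> \<eta>))" for x \<eta> :: "real^'n"
  have Km: "case_prod K \<in> borel_measurable borel"
    unfolding K_def case_prod_unfold by (intro borel_measurable_continuous_onI continuous_intros)
  have Kn: "norm (K y \<eta>) \<le> 1" for y \<eta> unfolding K_def by simp
  note [measurable] = borel_measurable_integrable[OF f]
  define F where "F x = exp (- \<i> * of_real (x \<bullet> \<xi>)) * f x" for x
  have F: "integrable lborel F"
    by (rule Bochner_Integration.integrable_bound[OF f]) (auto simp: F_def[abs_def] norm_mult)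
  have KF: "(\<integral>x. K x \<eta> * F x \<partial>lborel) = fourier f (\<xi> - \<eta>)" for \<eta>
    unfolding fourier_def
    by (intro Bochner_Integration.integral_cong)
      (simp_all add: K_def F_def inner_diff_right algebra_simps exp_diff exp_minus field_simps)
  show "integrable lborel (\<lambda>\<eta>. fourier g \<eta> * fourier f (\<xi> - \<eta>))"
    using integrable_kernel[OF F gg Km Kn] by (simp add: KF)
  have "of_real ((2 * pi) ^ CARD('n)) * fourier (\<lambda>x. f x * g x) \<xi>
      = (\<integral>x. F x * (of_real ((2 * pi) ^ CARD('n)) * g x) \<partial>lborel)"
    by (simp add: fourier_def F_def mult_ac flip: integral_mult_right_zero)
  also have "\<dots> = (\<integral>x. F x * (\<integral>\<eta>. K x \<eta> * fourier g \<eta> \<partial>lborel) \<partial>lborel)"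
    by (simp only: K_def fourier_inversion[OF assms(2-5)])
  also have "\<dots> = (\<integral>\<eta>. fourier g \<eta> * fourier f (\<xi> - \<eta>) \<partial>lborel)"
    by (simp add: integral_kernel_swap[OF F gg Km Kn] KF)
  finally show "of_real ((2 * pi) ^ CARD('n)) * fourier (\<lambda>x. f x * g x) \<xi>
      = (\<integral>\<eta>. fourier g \<eta> * fourier f (\<xi> - \<eta>) \<partial>lborel)" .
qed

section \<open>Decay of the Fourier transform of smooth functions with compact support\<close>

lemma smooth_inner: "(\<lambda>x. complex_of_real (x \<bullet> \<xi>)) \<in> smooth_functions V"
  by (rule smooth_bounded_linear)
    (intro bounded_linear_compose[OF bounded_linear_of_real bounded_linear_inner_left])

lemma smooth_iexp: "(\<lambda>x. exp (- \<i> * complex_of_real (x \<bullet> \<xi>))) \<in> smooth_functions UNIV"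
  by (intro smooth_exp smooth_mult smooth_const smooth_inner) auto

lemma partial_deriv_iexp:
  "partial_deriv j (\<lambda>x. exp (- \<i> * complex_of_real (x \<bullet> \<xi>))) x
    = - \<i> * of_real (\<xi> $ j) * exp (- \<i> * complex_of_real (x \<bullet> \<xi>))"
proof -
  have "((\<lambda>x. - \<i> * complex_of_real (x \<bullet> \<xi>)) has_derivative (\<lambda>x. - \<i> * complex_of_real (x \<bullet> \<xi>))) (at x)"
    by (intro bounded_linear_imp_has_derivative bounded_linear_compose[OF bounded_linear_mult_right]
        bounded_linear_compose[OF bounded_linear_of_real bounded_linear_inner_left])
  from partial_deriv_chain(2)[OF differentiableI[OF this] DERIV_exp, of j] partial_deriv_eq[OF this, of j]
  show ?thesis by (simp add: inner_axis' mult_ac)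
qed

lemma partial_deriv_iexp_mult:
  assumes "g differentiable (at x)"
  shows "partial_deriv j (\<lambda>x. exp (- \<i> * complex_of_real (x \<bullet> \<xi>)) * g x) x
    = exp (- \<i> * complex_of_real (x \<bullet> \<xi>)) * (partial_deriv j g x - \<i> * of_real (\<xi> $ j) * g x)"
  by (subst partial_deriv_mult[OF smooth_differentiable[OF smooth_iexp UNIV_I] assms])
    (simp add: partial_deriv_iexp[simplified] algebra_simps)

lemma fourier_partial_deriv:
  assumes g: "g \<in> smooth_functions UNIV" and L: "compact L" "\<And>x. x \<notin> L \<Longrightarrow> g x = 0"
  shows "fourier (partial_deriv j g) \<xi> = \<i> * of_real (\<xi> $ j) * fourier g \<xi>"
proof -
  let ?e = "\<lambda>x. exp (- \<i> * complex_of_real (x \<bullet> \<xi>))"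
  have z: "partial_deriv j g x = 0" if "x \<notin> L" for x
    using iter_partial_deriv_zero_open[of "- L" g x "[j]"] L(2) that open_Compl[OF compact_imp_closed[OF L(1)]]
    by auto
  have pd: "partial_deriv j (\<lambda>x. ?e x * g x) x
      = ?e x * partial_deriv j g x - (\<i> * of_real (\<xi> $ j)) * (?e x * g x)" for x
    unfolding partial_deriv_iexp_mult[OF smooth_differentiable[OF g UNIV_I]] by (simp add: algebra_simps)
  have "(\<integral>x. partial_deriv j (\<lambda>x. ?e x * g x) x \<partial>lborel) = 0"
    by (rule integral_partial_deriv_zero[OF _ L(1)]) (auto intro!: smooth_mult smooth_iexp[simplified] g simp: L(2))
  moreover have "integrable lborel (\<lambda>x. ?e x * partial_deriv j g x)" "integrable lborel (\<lambda>x. ?e x * g x)"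
    by (intro integrable_smooth[OF _ L(1)] smooth_mult smooth_iexp g smooth_partial_deriv; simp add: z L(2))+
  then have "(\<integral>x. partial_deriv j (\<lambda>x. ?e x * g x) x \<partial>lborel)
      = fourier (partial_deriv j g) \<xi> - \<i> * of_real (\<xi> $ j) * fourier g \<xi>"
    by (simp only: pd fourier_def Bochner_Integration.integral_diff integrable_mult_right integral_mult_right_zero)
  ultimately show ?thesis by simp
qed

lemma fourier_iter_partial_deriv:
  assumes g: "g \<in> smooth_functions UNIV" and L: "compact L" "\<And>x. x \<notin> L \<Longrightarrow> g x = 0"
  shows "fourier (foldr partial_deriv (replicate m j) g) \<xi> = (\<i> * of_real (\<xi> $ j)) ^ m * fourier g \<xi>"
proof (induction m)
  case (Suc m)
  have "foldr partial_deriv (replicate m j) g x = 0" if "x \<notin> L" for x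
    by (rule iter_partial_deriv_zero_open[of "- L"]) (use that L in \<open>auto intro: compact_imp_closed\<close>)
  from fourier_partial_deriv[OF smooth_iter_partial_deriv[OF g] L(1) this] Suc
  show ?case by (simp add: mult.assoc)
qed simp

text \<open>Differentiating \<open>m\<close> times in the direction \<open>j\<close> of the largest
  component of \<xi> gains \<open>\<bar>\<xi> $ j\<bar> ^ m\<close>, which dominates
  \<open>norm \<xi> ^ m\<close> up to a power of the dimension. If that component is at most 1, the
  bound without derivatives is enough; the base \<open>1 + CARD('n)\<close> of the constant serves
  both cases.\<close>

lemma fourier_decay:
  fixes g :: "real^'n::finite \<Rightarrow> complex"
  assumes g: "g \<in> smooth_functions UNIV" and L: "compact L" "\<And>x. x \<notin> L \<Longrightarrow> g x = 0"
    and B: "\<And>js x. length js \<le> m \<Longrightarrow> x \<in> L \<Longrightarrow> norm (foldr partial_deriv js g x) \<le> B"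
  shows "norm (fourier g \<xi>) \<le> (1 + CARD('n)) ^ m * measure lborel L * B * inverse ((1 + norm \<xi>) ^ m)"
proof -
  let ?n = "real CARD('n)" and ?M = "measure lborel L * B"
  have bd: "norm (fourier (foldr partial_deriv js g) \<eta>) \<le> ?M" if "length js \<le> m" for js \<eta>
  proof -
    have z: "foldr partial_deriv js g x = 0" if "x \<notin> L" for x
      by (rule iter_partial_deriv_zero_open[of "- L"]) (use that L in \<open>auto intro: compact_imp_closed\<close>)
    show ?thesis unfolding fourier_def
    proof (rule norm_integral_zero_off_compact_le[OF _ L(1)])
      show "integrable lborel (\<lambda>x. exp (- \<i> * complex_of_real (x \<bullet> \<eta>)) * foldr partial_deriv js g x)"
        by (rule integrable_smooth[OF smooth_mult[OF open_UNIV smooth_iexp smooth_iter_partial_deriv[OF g]] L(1)])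
          (simp add: z)
    qed (simp_all add: z norm_mult B[OF that])
  qed
  have "Max (range (\<lambda>j. \<bar>\<xi> $ j\<bar>)) \<in> range (\<lambda>j. \<bar>\<xi> $ j\<bar>)" by (rule Max_in) auto
  then obtain j where j: "Max (range (\<lambda>j. \<bar>\<xi> $ j\<bar>)) = \<bar>\<xi> $ j\<bar>" by blast
  have "\<bar>\<xi> $ i\<bar> \<le> \<bar>\<xi> $ j\<bar>" for i unfolding j[symmetric] by (rule Max_ge) auto
  then have "(\<Sum>i\<in>UNIV. \<bar>\<xi> $ i\<bar>) \<le> (\<Sum>i\<in>(UNIV :: 'n set). \<bar>\<xi> $ j\<bar>)" by (intro sum_mono)
  then have nle: "norm \<xi> \<le> ?n * \<bar>\<xi> $ j\<bar>" using norm_le_l1_cart[of \<xi>] by simp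
  have "(1 + norm \<xi>) ^ m * norm (fourier g \<xi>) \<le> (1 + ?n) ^ m * ?M"
  proof (cases "\<bar>\<xi> $ j\<bar> \<le> 1")
    case True
    then have "norm \<xi> \<le> ?n" using order_trans[OF nle mult_left_le] by simp
    then show ?thesis using bd[of "[]" \<xi>] by (intro mult_mono power_mono) auto
  next
    case False
    then have "1 + norm \<xi> \<le> (1 + ?n) * \<bar>\<xi> $ j\<bar>" using nle by (simp add: algebra_simps)
    then have "(1 + norm \<xi>) ^ m * norm (fourier g \<xi>) \<le> ((1 + ?n) * \<bar>\<xi> $ j\<bar>) ^ m * norm (fourier g \<xi>)"
      by (intro mult_right_mono power_mono) auto
    also have "\<dots> = (1 + ?n) ^ m * norm (fourier (foldr partial_deriv (replicate m j) g) \<xi>)"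
      by (simp add: fourier_iter_partial_deriv[OF g L] norm_mult norm_power power_mult_distrib
          del: foldr_replicate)
    also have "\<dots> \<le> (1 + ?n) ^ m * ?M" by (intro mult_left_mono bd) auto
    finally show ?thesis .
  qed
  moreover have "(1 + norm \<xi>) ^ m > 0" by (simp add: add_pos_nonneg)
  ultimately show ?thesis by (simp add: field_simps)
qed

text \<open>The constant is explicit so that its independence of \<epsilon>, \<xi> and the functions
  is visible. Its factors stem from Fourier inversion, from \<open>fourier_decay\<close> with
  \<open>l + 2 * CARD('n)\<close> derivatives, from the two regions of the convolution, and from the
  integral of the remaining weight.\<close>

definition fourier_mult_const :: "(real^'n::finite) set \<Rightarrow> real \<Rightarrow> nat \<Rightarrow> real" where
  "fourier_mult_const L c l = inverse ((2 * pi) ^ CARD('n)) *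
     ((1 + real CARD('n)) ^ (l + 2 * CARD('n)) * measure lborel L * (inverse ((1 - c) ^ l) + inverse (c ^ l))
       * (\<integral>\<eta>. inverse ((1 + norm \<eta>) ^ (2 * CARD('n))) \<partial>(lborel :: (real^'n) measure)))"

text \<open>Where \<open>norm \<eta> \<le> c * norm \<xi>\<close>, the decay of order
  \<open>l\<close> comes from \<open>F\<close>, because \<xi> - \<eta> is close to \<xi> and has
  length at least \<open>(1 - c) * norm \<xi>\<close>. Elsewhere
  \<open>norm \<eta> > c * norm \<xi>\<close>, and it comes from \<open>fourier g\<close>, against
  the uniform bound \<open>A\<close>. The additional \<open>2 * CARD('n)\<close> derivatives of
  \<open>g\<close> pay for integrability in \<eta>.\<close>

lemma fourier_mult_estimate:
  fixes L :: "(real^'n::finite) set" and c A G :: real and l :: nat and F g :: "real^'n \<Rightarrow> complex"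
  assumes L: "compact L" and c: "0 < c" "c < 1" and F: "integrable lborel F"
    and g: "g \<in> smooth_functions UNIV" and gL: "\<And>x. x \<notin> L \<Longrightarrow> g x = 0"
    and G: "\<And>js x. length js \<le> l + 2 * CARD('n) \<Longrightarrow> x \<in> L \<Longrightarrow> norm (foldr partial_deriv js g x) \<le> G"
    and "0 \<le> G" "0 \<le> A" and A1: "\<And>\<eta>. norm (fourier F \<eta>) \<le> A"
    and A2: "\<And>\<eta>. norm (\<xi> - \<eta>) \<le> c * norm \<xi> \<Longrightarrow> norm (fourier F \<eta>) \<le> A * inverse ((1 + norm \<eta>) ^ l)"
    and "\<xi> \<noteq> 0"
  shows "norm (fourier (\<lambda>x. F x * g x) \<xi>) \<le> fourier_mult_const L c l * A * G * inverse (norm \<xi> ^ l)"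
proof -
  let ?n = "CARD('n)"
  define D where "D = (1 + real ?n) ^ (l + 2 * ?n) * measure lborel L"
  define E where "E = inverse ((1 - c) ^ l) + inverse (c ^ l)"
  define w where "w \<eta> = inverse ((1 + norm \<eta>) ^ (2 * ?n))" for \<eta> :: "real^'n"
  have C_def: "fourier_mult_const L c l = inverse ((2 * pi) ^ ?n) * (D * E * (\<integral>\<eta>. w \<eta> \<partial>lborel))"
    by (simp add: fourier_mult_const_def D_def E_def w_def)
  have w: "integrable lborel w"
    using integrable_inverse_norm_power[where 'a = "real^'n"] by (simp add: w_def[abs_def])
  have w0: "w \<eta> \<ge> 0" for \<eta> by (simp add: w_def)
  have DE: "D \<ge> 0" "E \<ge> 0" using c by (simp_all add: D_def E_def)
  have \<xi>: "norm \<xi> > 0" using \<open>\<xi> \<noteq> 0\<close> by simp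
  have dec: "norm (fourier g \<eta>) \<le> D * G * (inverse ((1 + norm \<eta>) ^ l) * w \<eta>)" for \<eta>
    using fourier_decay[OF g L gL, where m = "l + 2 * ?n" and B = G and \<xi> = \<eta>, OF _ G] by (simp add: D_def w_def power_add mult_ac)
  have inv1: "inverse ((1 + norm \<eta>) ^ l) \<le> 1" for \<eta> :: "real^'n"
    by (simp add: inverse_le_1_iff)
  have dec': "norm (fourier g \<eta>) \<le> D * G * w \<eta>" for \<eta>
    by (rule order_trans[OF dec]) (use inv1[of \<eta>] w0[of \<eta>] DE \<open>0 \<le> G\<close> in
        \<open>auto intro!: mult_left_mono mult_left_le_one_le\<close>)
  have contg: "continuous_on UNIV g" by (rule smooth_continuous_on[OF g])
  have [measurable]: "g \<in> borel_measurable borel" by (rule borel_measurable_continuous_onI[OF contg])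
  have fg: "integrable lborel (fourier g)"
    by (rule Bochner_Integration.integrable_bound[of _ "\<lambda>\<eta>. D * G * w \<eta>"])
      (use w dec' w0 DE \<open>0 \<le> G\<close> in \<open>auto intro!: AE_I2 simp: abs_of_nonneg\<close>)
  have gb: "norm (g x) \<le> G" for x using G[of "[]" x] gL[of x] \<open>0 \<le> G\<close> by (cases "x \<in> L") auto
  have ig: "integrable lborel g" using g L gL by (rule integrable_smooth)
  note conv = fourier_mult_eq_convolution[OF F contg gb ig fg, of \<xi>]
  have E: "inverse ((d * norm \<xi>) ^ l) \<le> E * inverse (norm \<xi> ^ l)" if "d = c \<or> d = 1 - c" for d
    using that c unfolding power_mult_distrib inverse_mult_distrib E_def by (intro mult_right_mono) auto
  \<comment> \<open>Both regions obey the same pointwise bound, thanks to the two summands in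
    \<open>E\<close>, so the convolution integral is never split.\<close>
  have pw: "norm (fourier g \<eta> * fourier F (\<xi> - \<eta>)) \<le> D * G * A * E * inverse (norm \<xi> ^ l) * w \<eta>" for \<eta>
  proof -
    have "inverse ((1 + norm \<eta>) ^ l) * norm (fourier F (\<xi> - \<eta>)) \<le> A * E * inverse (norm \<xi> ^ l)"
    proof (cases "norm \<eta> \<le> c * norm \<xi>")
      case True
      have "norm \<xi> \<le> norm (\<xi> - \<eta>) + norm \<eta>" using norm_triangle_ineq[of "\<xi> - \<eta>" \<eta>] by simp
      then have *: "(1 - c) * norm \<xi> \<le> 1 + norm (\<xi> - \<eta>)" using True by (simp add: algebra_simps)
      have "norm (fourier F (\<xi> - \<eta>)) \<le> A * inverse ((1 + norm (\<xi> - \<eta>)) ^ l)"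
        using A2[of "\<xi> - \<eta>"] True by simp
      also have "\<dots> \<le> A * inverse (((1 - c) * norm \<xi>) ^ l)"
        using c \<xi> * \<open>0 \<le> A\<close> by (intro mult_left_mono le_imp_inverse_le power_mono) auto
      also have "\<dots> \<le> A * (E * inverse (norm \<xi> ^ l))"
        using E[of "1 - c"] \<open>0 \<le> A\<close> by (intro mult_left_mono) auto
      also have "\<dots> = A * E * inverse (norm \<xi> ^ l)" by simp
      finally show ?thesis
        using mult_mono[OF inv1[of \<eta>], of "norm (fourier F (\<xi> - \<eta>))"] by simp
    next
      case False
      then have "inverse ((1 + norm \<eta>) ^ l) \<le> inverse ((c * norm \<xi>) ^ l)"
        using c \<xi> by (intro le_imp_inverse_le power_mono) auto
      then have "inverse ((1 + norm \<eta>) ^ l) * norm (fourier F (\<xi> - \<eta>)) \<le> inverse ((c * norm \<xi>) ^ l) * A"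
        using A1 c by (intro mult_mono) auto
      also have "\<dots> \<le> (E * inverse (norm \<xi> ^ l)) * A"
        using E[of c] \<open>0 \<le> A\<close> by (intro mult_right_mono) auto
      also have "\<dots> = A * E * inverse (norm \<xi> ^ l)" by simp
      finally show ?thesis .
    qed
    then have "D * G * w \<eta> * (inverse ((1 + norm \<eta>) ^ l) * norm (fourier F (\<xi> - \<eta>)))
        \<le> D * G * w \<eta> * (A * E * inverse (norm \<xi> ^ l))"
      using DE w0 \<open>0 \<le> G\<close> by (intro mult_left_mono) auto
    moreover have "norm (fourier g \<eta>) * norm (fourier F (\<xi> - \<eta>))
        \<le> D * G * (inverse ((1 + norm \<eta>) ^ l) * w \<eta>) * norm (fourier F (\<xi> - \<eta>))"
      by (intro mult_right_mono dec) auto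
    ultimately show ?thesis by (simp add: norm_mult mult_ac)
  qed
  have "(2 * pi) ^ ?n * norm (fourier (\<lambda>x. F x * g x) \<xi>)
      = norm (of_real ((2 * pi) ^ ?n) * fourier (\<lambda>x. F x * g x) \<xi>)"
    by (simp only: norm_mult norm_of_real) simp
  also have "\<dots> \<le> (\<integral>\<eta>. D * G * A * E * inverse (norm \<xi> ^ l) * w \<eta> \<partial>lborel)"
    unfolding conv(2) by (rule Bochner_Integration.integral_norm_bound_integral[OF conv(1)]) (use w pw in auto)
  also have "\<dots> = D * G * A * E * inverse (norm \<xi> ^ l) * (\<integral>\<eta>. w \<eta> \<partial>lborel)" by simp
  finally have "norm (fourier (\<lambda>x. F x * g x) \<xi>) * (2 * pi) ^ ?n
      \<le> D * G * A * E * inverse (norm \<xi> ^ l) * (\<integral>\<eta>. w \<eta> \<partial>lborel)" by (simp only: mult.commute)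
  then have "norm (fourier (\<lambda>x. F x * g x) \<xi>)
      \<le> D * G * A * E * inverse (norm \<xi> ^ l) * (\<integral>\<eta>. w \<eta> \<partial>lborel) / (2 * pi) ^ ?n"
    by (subst pos_le_divide_eq) auto
  then show "norm (fourier (\<lambda>x. F x * g x) \<xi>) \<le> fourier_mult_const L c l * A * G * inverse (norm \<xi> ^ l)"
    by (simp only: C_def divide_inverse mult_ac)
qed

section \<open>Cutoffs\<close>

text \<open>At \<open>k = 0\<close> this is the classical flat function. The extra powers make the
  family closed under differentiation up to linear combinations, so smoothness follows by induction
  for all \<open>k\<close> at once.\<close>

definition flat_exp :: "nat \<Rightarrow> real \<Rightarrow> real" where
  "flat_exp k t = (if t > 0 then exp (- inverse t) * inverse t ^ k else 0)"

lemma flat_exp_tendsto_0: "(flat_exp k \<longlongrightarrow> 0) (at 0)"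
proof -
  have "((\<lambda>t. inverse t ^ k / exp (inverse t)) \<longlongrightarrow> (0::real)) (at_right 0)"
    by (rule filterlim_compose[OF tendsto_power_div_exp_0 filterlim_inverse_at_top_right])
  then have "(flat_exp k \<longlongrightarrow> 0) (at_right 0)"
    by (rule Lim_transform_eventually)
      (auto simp: flat_exp_def exp_minus divide_inverse eventually_at_filter)
  moreover have "(flat_exp k \<longlongrightarrow> 0) (at_left 0)"
    by (rule Lim_transform_eventually[OF tendsto_const]) (auto simp: flat_exp_def eventually_at_filter)
  ultimately show ?thesis by (simp add: filterlim_split_at)
qed

lemma flat_exp_deriv:
  "(flat_exp k has_real_derivative flat_exp (k + 2) t - of_nat k * flat_exp (Suc k) t) (at t)"
proof -
  consider "t > 0" | "t < 0" | "t = 0" by linarith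
  then show ?thesis
  proof cases
    case 1
    have "((\<lambda>t. exp (- inverse t) * inverse t ^ k) has_real_derivative
        exp (- inverse t) * (inverse t * inverse t) * inverse t ^ k
          - of_nat k * (inverse t ^ (k - 1) * (inverse t * inverse t)) * exp (- inverse t)) (at t)"
      using 1 by (auto intro!: derivative_eq_intros simp: power2_eq_square)
    also have "exp (- inverse t) * (inverse t * inverse t) * inverse t ^ k
          - of_nat k * (inverse t ^ (k - 1) * (inverse t * inverse t)) * exp (- inverse t)
        = exp (- inverse t) * inverse t ^ (k + 2) - of_nat k * (exp (- inverse t) * inverse t ^ Suc k)"
      by (cases k) (auto simp: algebra_simps)
    finally have "((\<lambda>t. exp (- inverse t) * inverse t ^ k) has_real_derivative
        exp (- inverse t) * inverse t ^ (k + 2) - of_nat k * (exp (- inverse t) * inverse t ^ Suc k)) (at t)" .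
    from has_field_derivative_transform_within_open[OF this open_greaterThan, of 0 "flat_exp k"] 1
    show ?thesis by (simp add: flat_exp_def)
  next
    case 2
    from has_field_derivative_transform_within_open[OF DERIV_const open_lessThan, of t 0 0 "flat_exp k"] 2
    show ?thesis by (simp add: flat_exp_def)
  next
    case 3
    \<comment> \<open>At the origin the difference quotient of \<open>flat_exp k\<close> is
      \<open>flat_exp (Suc k)\<close> itself.\<close>
    have "((\<lambda>h. (flat_exp k (0 + h) - flat_exp k 0) / h) \<longlongrightarrow> 0) (at 0)"
      by (rule Lim_transform_eventually[OF flat_exp_tendsto_0[of "Suc k"]])
        (auto simp: flat_exp_def eventually_at_filter divide_inverse)
    then show ?thesis using 3 by (simp add: DERIV_def flat_exp_def)
  qed
qed

lemma smooth_flat_exp_ball: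
  fixes x\<^sub>0 :: "real^'n::finite"
  shows "(\<lambda>x. complex_of_real (flat_exp k (r\<^sup>2 - (x - x\<^sub>0) \<bullet> (x - x\<^sub>0)))) \<in> smooth_functions UNIV"
proof -
  let ?f = "\<lambda>k x. complex_of_real (flat_exp k (r\<^sup>2 - (x - x\<^sub>0) \<bullet> (x - x\<^sub>0)))"
  have d: "(?f k has_derivative (\<lambda>h. of_real ((flat_exp (k + 2) (r\<^sup>2 - (x - x\<^sub>0) \<bullet> (x - x\<^sub>0))
      - of_nat k * flat_exp (Suc k) (r\<^sup>2 - (x - x\<^sub>0) \<bullet> (x - x\<^sub>0))) * (- 2 * ((x - x\<^sub>0) \<bullet> h))))) (at x)" for k x
  proof -
    have b: "((\<lambda>x. r\<^sup>2 - (x - x\<^sub>0) \<bullet> (x - x\<^sub>0)) has_derivative (\<lambda>h. - 2 * ((x - x\<^sub>0) \<bullet> h))) (at x)"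
      by (auto intro!: derivative_eq_intros simp: inner_commute)
    show ?thesis
      by (rule bounded_linear.has_derivative[OF bounded_linear_of_real
            has_derivative_compose[OF b flat_exp_deriv[unfolded has_field_derivative_def]]])
  qed
  have p: "partial_deriv j (?f k) x = (?f (k + 2) x + (- of_nat k) * ?f (Suc k) x)
      * ((- 2) * (of_real (x \<bullet> axis j 1) + of_real (- (x\<^sub>0 \<bullet> axis j 1))))" for j k x
    by (subst partial_deriv_eq[OF d]) (simp add: inner_diff_left)
  have "smooth_upto n UNIV (?f k)" for n k
  proof (induction n arbitrary: k)
    case 0
    show ?case using d by (auto simp: smooth_upto_0 intro: differentiableI)
  next
    case (Suc n)
    have "smooth_upto n UNIV (partial_deriv j (?f k))" for j
    proof (rule smooth_upto_cong[OF _ p[symmetric]])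
      show "smooth_upto n UNIV (\<lambda>x. (?f (k + 2) x + (- of_nat k) * ?f (Suc k) x)
          * ((- 2) * (of_real (x \<bullet> axis j 1) + of_real (- (x\<^sub>0 \<bullet> axis j 1)))))"
        by (intro smooth_upto_mult smooth_upto_add smooth_upto_const Suc open_UNIV)
          (use smooth_inner smooth_functions_iff in blast)
    qed auto
    then show ?case using d by (auto simp: smooth_upto_Suc intro: differentiableI)
  qed
  then show ?thesis by (simp add: smooth_functions_iff)
qed

text \<open>The exact set where \<psi> is nonzero matters, since other cutoffs will be divided by
  \<psi>: nonvanishing on the whole ball takes the place of the usual value 1 on a smaller
  set.\<close>

lemma exists_bump:
  fixes x\<^sub>0 :: "real^'n::finite"
  assumes "r > 0"
  obtains \<psi> where "\<psi> \<in> smooth_functions UNIV" "\<And>x. \<psi> x \<noteq> 0 \<longleftrightarrow> x \<in> ball x\<^sub>0 r"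
proof
  show "(\<lambda>x. complex_of_real (flat_exp 0 (r\<^sup>2 - (x - x\<^sub>0) \<bullet> (x - x\<^sub>0)))) \<in> smooth_functions UNIV"
    by (rule smooth_flat_exp_ball)
  show "complex_of_real (flat_exp 0 (r\<^sup>2 - (x - x\<^sub>0) \<bullet> (x - x\<^sub>0))) \<noteq> 0 \<longleftrightarrow> x \<in> ball x\<^sub>0 r" for x
  proof -
    have "r\<^sup>2 - (x - x\<^sub>0) \<bullet> (x - x\<^sub>0) > 0 \<longleftrightarrow> norm (x - x\<^sub>0) < r"
      using assms abs_less_iff power2_less_imp_less[of "norm (x - x\<^sub>0)" r]
        power_strict_mono[of "norm (x - x\<^sub>0)" r 2]
      by (auto simp: power2_norm_eq_inner)
    then show ?thesis by (simp add: flat_exp_def dist_norm norm_minus_commute)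
  qed
qed

text \<open>Derivatives call for an open set and uniform bounds for a compact one. The pair keeps
  both inside \<open>V\<close>, away from the boundary, where functions such as the inverse of a
  bump blow up.\<close>

lemma compact_open_between:
  fixes L :: "'a::heine_borel set"
  assumes "compact L" "open V" "L \<subseteq> V"
  obtains W K where "open W" "compact K" "L \<subseteq> W" "W \<subseteq> K" "K \<subseteq> V"
proof (cases "L = {}")
  case False
  obtain e where e: "e > 0" "{x. infdist x L \<le> e} \<subseteq> V"
    using compact_in_open_separated[OF False assms] by blast
  show ?thesis
  proof
    show "open {x. infdist x L < e}" by (intro open_Collect_less continuous_intros)
    show "compact {x. infdist x L \<le> e}" by (rule compact_infdist_le[OF False assms(1) e(1)])
    show "L \<subseteq> {x. infdist x L < e}" using e(1) by auto
  qed (use e in auto)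
qed (use that[of "{}" "{}"] in auto)

section \<open>Families of smooth functions with slow scale derivatives\<close>

text \<open>A net \<open>r\<close> is bounded by a slow scale net if and only if
  \<open>r \<epsilon> \<le> \<epsilon> powr (- \<delta>)\<close> eventually, for every \<open>\<delta> > 0\<close>; the latter form needs no witness.
  The bounds are uniform over \<open>V\<close> and over a set of parameters \<open>\<Lambda>\<close>, below the covectors.\<close>

definition slow_upto :: "nat \<Rightarrow> (real^'n::finite) set \<Rightarrow> 'p set \<Rightarrow> (real \<Rightarrow> 'p \<Rightarrow> real^'n \<Rightarrow> complex) \<Rightarrow> bool" where
  "slow_upto n V \<Lambda> h \<longleftrightarrow> (\<forall>js. length js \<le> n \<longrightarrow> (\<forall>\<delta>>0. \<forall>\<^sub>F \<epsilon> in at_right 0.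
     \<forall>\<xi>\<in>\<Lambda>. \<forall>x\<in>V. norm (foldr partial_deriv js (h \<epsilon> \<xi>) x) \<le> \<epsilon> powr (- \<delta>)))"

definition slow_families :: "(real^'n::finite) set \<Rightarrow> 'p set \<Rightarrow> (real \<Rightarrow> 'p \<Rightarrow> real^'n \<Rightarrow> complex) set" where
  "slow_families V \<Lambda> = {h. (\<forall>\<^sub>F \<epsilon> in at_right 0. \<forall>\<xi>\<in>\<Lambda>. h \<epsilon> \<xi> \<in> smooth_functions V) \<and> (\<forall>n. slow_upto n V \<Lambda> h)}"

lemma eventually_le_powr:
  fixes C \<delta> :: real
  assumes "\<delta> > 0" shows "\<forall>\<^sub>F \<epsilon> in at_right 0. C \<le> \<epsilon> powr (- \<delta>)"
proof -
  \<comment> \<open>\<open>K\<close> solves \<open>K powr (- \<delta>) = max C 1\<close>.\<close>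
  define K where "K = max C 1 powr (- (1 / \<delta>))"
  have "K > 0" by (simp add: K_def)
  moreover have "C \<le> \<epsilon> powr (- \<delta>)" if "\<epsilon> > 0" "\<epsilon> < K" for \<epsilon>
  proof -
    have "C \<le> max C 1" by simp
    also have "\<dots> = K powr (- \<delta>)" using assms by (simp add: K_def powr_powr)
    also have "\<dots> \<le> \<epsilon> powr (- \<delta>)" using that assms by (intro powr_mono2') auto
    finally show ?thesis .
  qed
  ultimately show ?thesis by (auto simp: eventually_at_right intro: exI[of _ K])
qed

text \<open>A strictly larger exponent absorbs every constant; this is how factors such as 2
  disappear from slow scale bounds.\<close>

lemma eventually_mult_powr_le:
  fixes C a b :: real
  assumes "a < b" shows "\<forall>\<^sub>F \<epsilon> in at_right 0. C * \<epsilon> powr (- a) \<le> \<epsilon> powr (- b)"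
proof -
  have "\<forall>\<^sub>F \<epsilon> in at_right 0. C \<le> \<epsilon> powr (- (b - a))" using assms by (intro eventually_le_powr) simp
  then show ?thesis
  proof eventually_elim
    case (elim \<epsilon>)
    from mult_right_mono[OF this, of "\<epsilon> powr (- a)"] show ?case by (simp flip: powr_add)
  qed
qed

lemma slow_upto_mono: "slow_upto n V \<Lambda> h \<Longrightarrow> m \<le> n \<Longrightarrow> slow_upto m V \<Lambda> h"
  unfolding slow_upto_def by (meson order_trans)

lemma slow_upto_0:
  "slow_upto 0 V \<Lambda> h \<longleftrightarrow>
     (\<forall>\<delta>>0. \<forall>\<^sub>F \<epsilon> in at_right 0. \<forall>\<xi>\<in>\<Lambda>. \<forall>x\<in>V. norm (h \<epsilon> \<xi> x) \<le> \<epsilon> powr (- \<delta>))"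
  by (simp add: slow_upto_def)

lemma slow_upto_Suc:
  "slow_upto (Suc n) V \<Lambda> h \<longleftrightarrow>
     slow_upto 0 V \<Lambda> h \<and> (\<forall>j. slow_upto n V \<Lambda> (\<lambda>\<epsilon> \<xi>. partial_deriv j (h \<epsilon> \<xi>)))" (is "?L \<longleftrightarrow> ?R")
proof
  assume L: ?L
  have "slow_upto n V \<Lambda> (\<lambda>\<epsilon> \<xi>. partial_deriv j (h \<epsilon> \<xi>))" for j
    unfolding slow_upto_def
  proof (intro allI impI)
    fix js :: "'a list" and \<delta> :: real assume "length js \<le> n" "\<delta> > 0"
    then show "\<forall>\<^sub>F \<epsilon> in at_right 0. \<forall>\<xi>\<in>\<Lambda>. \<forall>x\<in>V. norm (foldr partial_deriv js (partial_deriv j (h \<epsilon> \<xi>)) x) \<le> \<epsilon> powr (- \<delta>)"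
      using L unfolding slow_upto_def by (auto dest!: spec[of _ "js @ [j]"])
  qed
  moreover have "slow_upto 0 V \<Lambda> h" using L by (rule slow_upto_mono) simp
  ultimately show ?R by blast
next
  assume R: ?R
  show ?L unfolding slow_upto_def
  proof (intro allI impI)
    fix js :: "'a list" and \<delta> :: real assume js: "length js \<le> Suc n" and "\<delta> > 0"
    then show "\<forall>\<^sub>F \<epsilon> in at_right 0. \<forall>\<xi>\<in>\<Lambda>. \<forall>x\<in>V. norm (foldr partial_deriv js (h \<epsilon> \<xi>) x) \<le> \<epsilon> powr (- \<delta>)"
      using R by (cases js rule: rev_cases) (simp_all add: slow_upto_def)
  qed
qed

lemma slow_upto_cong:
  assumes "open V" "\<forall>\<^sub>F \<epsilon> in at_right 0. \<forall>\<xi>\<in>\<Lambda>. \<forall>x\<in>V. h \<epsilon> \<xi> x = k \<epsilon> \<xi> x" "slow_upto n V \<Lambda> h"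
  shows "slow_upto n V \<Lambda> k"
  unfolding slow_upto_def
proof (intro allI impI)
  fix js :: "'a list" and \<delta> :: real assume "length js \<le> n" "\<delta> > 0"
  with assms(3) have "\<forall>\<^sub>F \<epsilon> in at_right 0. \<forall>\<xi>\<in>\<Lambda>. \<forall>x\<in>V. norm (foldr partial_deriv js (h \<epsilon> \<xi>) x) \<le> \<epsilon> powr (- \<delta>)"
    by (simp add: slow_upto_def)
  then show "\<forall>\<^sub>F \<epsilon> in at_right 0. \<forall>\<xi>\<in>\<Lambda>. \<forall>x\<in>V. norm (foldr partial_deriv js (k \<epsilon> \<xi>) x) \<le> \<epsilon> powr (- \<delta>)"
    using assms(2)
  proof eventually_elim
    case (elim \<epsilon>)
    show ?case
    proof (intro ballI)
      fix \<xi> x assume *: "\<xi> \<in> \<Lambda>" "x \<in> V"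
      have "foldr partial_deriv js (h \<epsilon> \<xi>) x = foldr partial_deriv js (k \<epsilon> \<xi>) x"
        by (rule iter_partial_deriv_cong_open[OF assms(1)]) (use elim * in auto)
      then show "norm (foldr partial_deriv js (k \<epsilon> \<xi>) x) \<le> \<epsilon> powr (- \<delta>)" using elim(1) * by metis
    qed
  qed
qed

lemma slow_upto_0_add:
  assumes "slow_upto 0 V \<Lambda> h" "slow_upto 0 V \<Lambda> k"
  shows "slow_upto 0 V \<Lambda> (\<lambda>\<epsilon> \<xi> x. h \<epsilon> \<xi> x + k \<epsilon> \<xi> x)"
  unfolding slow_upto_0
proof (intro allI impI)
  fix \<delta> :: real assume \<delta>: "\<delta> > 0"
  then have "\<forall>\<^sub>F \<epsilon> in at_right 0. \<forall>\<xi>\<in>\<Lambda>. \<forall>x\<in>V. norm (h \<epsilon> \<xi> x) \<le> \<epsilon> powr (- (\<delta> / 2))"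
    and "\<forall>\<^sub>F \<epsilon> in at_right 0. \<forall>\<xi>\<in>\<Lambda>. \<forall>x\<in>V. norm (k \<epsilon> \<xi> x) \<le> \<epsilon> powr (- (\<delta> / 2))"
    using assms unfolding slow_upto_0 by (meson half_gt_zero)+
  moreover have "\<forall>\<^sub>F \<epsilon> in at_right 0. 2 * \<epsilon> powr (- (\<delta> / 2)) \<le> \<epsilon> powr (- \<delta>)"
    by (rule eventually_mult_powr_le) (use \<delta> in simp)
  ultimately show "\<forall>\<^sub>F \<epsilon> in at_right 0. \<forall>\<xi>\<in>\<Lambda>. \<forall>x\<in>V. norm (h \<epsilon> \<xi> x + k \<epsilon> \<xi> x) \<le> \<epsilon> powr (- \<delta>)"
    by eventually_elim (smt (verit) norm_triangle_ineq)
qed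

text \<open>Each factor is granted \<open>\<delta> / 2\<close>. Here it pays that a bound is
  demanded for every positive exponent: a fixed one would double with each product.\<close>

lemma slow_upto_0_mult:
  assumes "slow_upto 0 V \<Lambda> h" "slow_upto 0 V \<Lambda> k"
  shows "slow_upto 0 V \<Lambda> (\<lambda>\<epsilon> \<xi> x. h \<epsilon> \<xi> x * k \<epsilon> \<xi> x)"
  unfolding slow_upto_0
proof (intro allI impI)
  fix \<delta> :: real assume \<delta>: "\<delta> > 0"
  then have "\<forall>\<^sub>F \<epsilon> in at_right 0. \<forall>\<xi>\<in>\<Lambda>. \<forall>x\<in>V. norm (h \<epsilon> \<xi> x) \<le> \<epsilon> powr (- (\<delta> / 2))"
    and "\<forall>\<^sub>F \<epsilon> in at_right 0. \<forall>\<xi>\<in>\<Lambda>. \<forall>x\<in>V. norm (k \<epsilon> \<xi> x) \<le> \<epsilon> powr (- (\<delta> / 2))"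
    using assms unfolding slow_upto_0 by (meson half_gt_zero)+
  then show "\<forall>\<^sub>F \<epsilon> in at_right 0. \<forall>\<xi>\<in>\<Lambda>. \<forall>x\<in>V. norm (h \<epsilon> \<xi> x * k \<epsilon> \<xi> x) \<le> \<epsilon> powr (- \<delta>)"
  proof eventually_elim
    case (elim \<epsilon>)
    have "\<epsilon> powr (- \<delta>) = \<epsilon> powr (- (\<delta> / 2)) * \<epsilon> powr (- (\<delta> / 2))" by (simp flip: powr_add)
    then show ?case using elim by (auto simp: norm_mult intro!: mult_mono)
  qed
qed

lemma eventually_smooth_partial_deriv:
  assumes "\<forall>\<^sub>F \<epsilon> in F. \<forall>\<xi>\<in>\<Lambda>. h \<epsilon> \<xi> \<in> smooth_functions V"
  shows "\<forall>\<^sub>F \<epsilon> in F. \<forall>\<xi>\<in>\<Lambda>. partial_deriv j (h \<epsilon> \<xi>) \<in> smooth_functions V"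
  using assms by eventually_elim (auto intro: smooth_partial_deriv)

section \<open>Slow scale families as a differential algebra\<close>

context
  fixes V :: "(real^'n::finite) set" and \<Lambda> :: "'p set"
  assumes V: "open V"
begin

lemma slow_upto_add:
  assumes "\<forall>\<^sub>F \<epsilon> in at_right 0. \<forall>\<xi>\<in>\<Lambda>. h \<epsilon> \<xi> \<in> smooth_functions V" "slow_upto n V \<Lambda> h"
    and "\<forall>\<^sub>F \<epsilon> in at_right 0. \<forall>\<xi>\<in>\<Lambda>. k \<epsilon> \<xi> \<in> smooth_functions V" "slow_upto n V \<Lambda> k"
  shows "slow_upto n V \<Lambda> (\<lambda>\<epsilon> \<xi> x. h \<epsilon> \<xi> x + k \<epsilon> \<xi> x)"
  using assms
proof (induction n arbitrary: h k)
  case (Suc n)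
  have "slow_upto n V \<Lambda> (\<lambda>\<epsilon> \<xi>. partial_deriv j (\<lambda>x. h \<epsilon> \<xi> x + k \<epsilon> \<xi> x))" for j
  proof (rule slow_upto_cong[OF V])
    show "slow_upto n V \<Lambda> (\<lambda>\<epsilon> \<xi> x. partial_deriv j (h \<epsilon> \<xi>) x + partial_deriv j (k \<epsilon> \<xi>) x)"
      using Suc.prems by (intro Suc.IH eventually_smooth_partial_deriv) (auto simp: slow_upto_Suc)
    show "\<forall>\<^sub>F \<epsilon> in at_right 0. \<forall>\<xi>\<in>\<Lambda>. \<forall>x\<in>V. partial_deriv j (h \<epsilon> \<xi>) x + partial_deriv j (k \<epsilon> \<xi>) x
        = partial_deriv j (\<lambda>x. h \<epsilon> \<xi> x + k \<epsilon> \<xi> x) x"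
      using Suc.prems(1,3) by eventually_elim (auto intro!: partial_deriv_add[symmetric] intro: smooth_differentiable)
  qed
  with Suc.prems show ?case by (auto simp: slow_upto_Suc slow_upto_0_add)
qed (simp add: slow_upto_0_add)

lemma slow_upto_mult:
  assumes "\<forall>\<^sub>F \<epsilon> in at_right 0. \<forall>\<xi>\<in>\<Lambda>. h \<epsilon> \<xi> \<in> smooth_functions V" "slow_upto n V \<Lambda> h"
    and "\<forall>\<^sub>F \<epsilon> in at_right 0. \<forall>\<xi>\<in>\<Lambda>. k \<epsilon> \<xi> \<in> smooth_functions V" "slow_upto n V \<Lambda> k"
  shows "slow_upto n V \<Lambda> (\<lambda>\<epsilon> \<xi> x. h \<epsilon> \<xi> x * k \<epsilon> \<xi> x)"
  using assms
proof (induction n arbitrary: h k)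
  case (Suc n)
  have sh: "\<forall>\<^sub>F \<epsilon> in at_right 0. \<forall>\<xi>\<in>\<Lambda>. partial_deriv j (h \<epsilon> \<xi>) \<in> smooth_functions V"
    and sk: "\<forall>\<^sub>F \<epsilon> in at_right 0. \<forall>\<xi>\<in>\<Lambda>. partial_deriv j (k \<epsilon> \<xi>) \<in> smooth_functions V" for j
    using eventually_smooth_partial_deriv[OF Suc.prems(1)] eventually_smooth_partial_deriv[OF Suc.prems(3)]
    by blast+
  have h: "slow_upto n V \<Lambda> h" "slow_upto n V \<Lambda> k"
    using Suc.prems(2,4) by (auto intro: slow_upto_mono)
  have dh: "slow_upto n V \<Lambda> (\<lambda>\<epsilon> \<xi>. partial_deriv j (h \<epsilon> \<xi>))" "slow_upto n V \<Lambda> (\<lambda>\<epsilon> \<xi>. partial_deriv j (k \<epsilon> \<xi>))" for j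
    using Suc.prems(2,4) by (auto simp: slow_upto_Suc)
  have "slow_upto n V \<Lambda> (\<lambda>\<epsilon> \<xi>. partial_deriv j (\<lambda>x. h \<epsilon> \<xi> x * k \<epsilon> \<xi> x))" for j
  proof (rule slow_upto_cong[OF V])
    have "\<forall>\<^sub>F \<epsilon> in at_right 0. \<forall>\<xi>\<in>\<Lambda>. (\<lambda>x. h \<epsilon> \<xi> x * partial_deriv j (k \<epsilon> \<xi>) x) \<in> smooth_functions V"
      using Suc.prems(1) sk[of j] by eventually_elim (auto intro: smooth_mult V)
    moreover have "\<forall>\<^sub>F \<epsilon> in at_right 0. \<forall>\<xi>\<in>\<Lambda>. (\<lambda>x. partial_deriv j (h \<epsilon> \<xi>) x * k \<epsilon> \<xi> x) \<in> smooth_functions V"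
      using Suc.prems(3) sh[of j] by eventually_elim (auto intro: smooth_mult V)
    ultimately show "slow_upto n V \<Lambda> (\<lambda>\<epsilon> \<xi> x. h \<epsilon> \<xi> x * partial_deriv j (k \<epsilon> \<xi>) x + partial_deriv j (h \<epsilon> \<xi>) x * k \<epsilon> \<xi> x)"
      using Suc.prems(1,3) by (intro slow_upto_add Suc.IH sh sk h dh)
    show "\<forall>\<^sub>F \<epsilon> in at_right 0. \<forall>\<xi>\<in>\<Lambda>. \<forall>x\<in>V. h \<epsilon> \<xi> x * partial_deriv j (k \<epsilon> \<xi>) x + partial_deriv j (h \<epsilon> \<xi>) x * k \<epsilon> \<xi> x
        = partial_deriv j (\<lambda>x. h \<epsilon> \<xi> x * k \<epsilon> \<xi> x) x"
      using Suc.prems(1,3) by eventually_elim (auto intro!: partial_deriv_mult[symmetric] intro: smooth_differentiable)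
  qed
  with Suc.prems show ?case by (auto simp: slow_upto_Suc slow_upto_0_mult)
qed (simp add: slow_upto_0_mult)

lemma slow_families_add:
  assumes "h \<in> slow_families V \<Lambda>" "k \<in> slow_families V \<Lambda>"
  shows "(\<lambda>\<epsilon> \<xi> x. h \<epsilon> \<xi> x + k \<epsilon> \<xi> x) \<in> slow_families V \<Lambda>"
proof -
  have s: "\<forall>\<^sub>F \<epsilon> in at_right 0. \<forall>\<xi>\<in>\<Lambda>. h \<epsilon> \<xi> \<in> smooth_functions V"
    "\<forall>\<^sub>F \<epsilon> in at_right 0. \<forall>\<xi>\<in>\<Lambda>. k \<epsilon> \<xi> \<in> smooth_functions V"
    using assms by (auto simp: slow_families_def)
  then have "\<forall>\<^sub>F \<epsilon> in at_right 0. \<forall>\<xi>\<in>\<Lambda>. (\<lambda>x. h \<epsilon> \<xi> x + k \<epsilon> \<xi> x) \<in> smooth_functions V"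
    by eventually_elim (auto intro: smooth_add V)
  with s show ?thesis using assms by (auto simp: slow_families_def slow_upto_add)
qed

lemma slow_families_mult:
  assumes "h \<in> slow_families V \<Lambda>" "k \<in> slow_families V \<Lambda>"
  shows "(\<lambda>\<epsilon> \<xi> x. h \<epsilon> \<xi> x * k \<epsilon> \<xi> x) \<in> slow_families V \<Lambda>"
proof -
  have s: "\<forall>\<^sub>F \<epsilon> in at_right 0. \<forall>\<xi>\<in>\<Lambda>. h \<epsilon> \<xi> \<in> smooth_functions V"
    "\<forall>\<^sub>F \<epsilon> in at_right 0. \<forall>\<xi>\<in>\<Lambda>. k \<epsilon> \<xi> \<in> smooth_functions V"
    using assms by (auto simp: slow_families_def)
  then have "\<forall>\<^sub>F \<epsilon> in at_right 0. \<forall>\<xi>\<in>\<Lambda>. (\<lambda>x. h \<epsilon> \<xi> x * k \<epsilon> \<xi> x) \<in> smooth_functions V"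
    by eventually_elim (auto intro: smooth_mult V)
  with s show ?thesis using assms by (auto simp: slow_families_def slow_upto_mult)
qed

lemma slow_families_partial_deriv:
  assumes "h \<in> slow_families V \<Lambda>"
  shows "(\<lambda>\<epsilon> \<xi>. partial_deriv j (h \<epsilon> \<xi>)) \<in> slow_families V \<Lambda>"
proof -
  have "slow_upto n V \<Lambda> (\<lambda>\<epsilon> \<xi>. partial_deriv j (h \<epsilon> \<xi>))" for n
    using assms slow_upto_Suc[of n V \<Lambda> h] by (auto simp: slow_families_def)
  then show ?thesis
    using assms eventually_smooth_partial_deriv[of \<Lambda> h] by (simp add: slow_families_def)
qed

lemma slow_families_const:
  assumes "\<And>\<delta>. \<delta> > 0 \<Longrightarrow> \<forall>\<^sub>F \<epsilon> in at_right 0. \<forall>\<xi>\<in>\<Lambda>. norm (c \<epsilon> \<xi>) \<le> \<epsilon> powr (- \<delta>)"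
  shows "(\<lambda>\<epsilon> \<xi> x. c \<epsilon> \<xi>) \<in> slow_families V \<Lambda>"
proof -
  have z: "slow_upto n V \<Lambda> (\<lambda>\<epsilon> \<xi> x. 0)" for n
    by (induction n) (auto simp: slow_upto_Suc slow_upto_0)
  have "slow_upto n V \<Lambda> (\<lambda>\<epsilon> \<xi> x. c \<epsilon> \<xi>)" for n
    using assms by (cases n) (auto simp: slow_upto_Suc slow_upto_0 z elim!: eventually_mono)
  then show ?thesis by (simp add: slow_families_def smooth_const)
qed

lemma slow_families_bounded_const:
  assumes "\<And>\<epsilon> \<xi>. \<xi> \<in> \<Lambda> \<Longrightarrow> norm (c \<epsilon> \<xi>) \<le> B"
  shows "(\<lambda>\<epsilon> \<xi> x. c \<epsilon> \<xi>) \<in> slow_families V \<Lambda>"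
  by (rule slow_families_const, rule eventually_mono[OF eventually_le_powr[of _ B]])
    (use assms order_trans in blast)+

lemma slow_families_sum:
  assumes "\<And>i. i \<in> I \<Longrightarrow> h i \<in> slow_families V \<Lambda>"
  shows "(\<lambda>\<epsilon> \<xi> x. \<Sum>i\<in>I. h i \<epsilon> \<xi> x) \<in> slow_families V \<Lambda>"
  using assms by (induction I rule: infinite_finite_induct)
    (auto intro!: slow_families_add slow_families_bounded_const[of _ 0])

lemma slow_families_smooth:
  assumes "f \<in> smooth_functions W" "compact K" "V \<subseteq> K" "K \<subseteq> W"
  shows "(\<lambda>\<epsilon> \<xi>. f) \<in> slow_families V \<Lambda>"
proof -
  have "\<forall>\<^sub>F \<epsilon> in at_right 0. \<forall>\<xi>\<in>\<Lambda>. \<forall>x\<in>V. norm (foldr partial_deriv js f x) \<le> \<epsilon> powr (- \<delta>)"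
    if "\<delta> > 0" for js and \<delta> :: real
  proof -
    have "bounded (foldr partial_deriv js f ` K)"
      by (intro compact_imp_bounded compact_continuous_image assms
          continuous_on_subset[OF smooth_continuous_on[OF smooth_iter_partial_deriv[OF assms(1)]]])
    then obtain B where "\<And>x. x \<in> K \<Longrightarrow> norm (foldr partial_deriv js f x) \<le> B" by (auto simp: bounded_iff)
    then show ?thesis
      using eventually_le_powr[OF that, of B] assms(3)
      by (auto elim!: eventually_mono) (meson order_trans subsetD)
  qed
  then show ?thesis using smooth_subset[OF assms(1)] assms(3,4) by (simp add: slow_families_def slow_upto_def)
qed

text \<open>The hypothesis \<open>low\<close> is the slow scale bound of order zero for the inverse.
  Its derivatives are \<open>- inverse h * inverse h\<close> times those of \<open>h\<close>, so
  control up to order \<open>n\<close> yields order \<open>Suc n\<close>.\<close>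

lemma slow_families_inverse:
  assumes h: "h \<in> slow_families V \<Lambda>"
    and low: "\<And>\<delta>. \<delta> > 0 \<Longrightarrow> \<forall>\<^sub>F \<epsilon> in at_right 0. \<forall>\<xi>\<in>\<Lambda>. \<forall>x\<in>V. \<epsilon> powr \<delta> \<le> norm (h \<epsilon> \<xi> x)"
  shows "(\<lambda>\<epsilon> \<xi> x. inverse (h \<epsilon> \<xi> x)) \<in> slow_families V \<Lambda>"
proof -
  have s: "\<forall>\<^sub>F \<epsilon> in at_right 0. \<forall>\<xi>\<in>\<Lambda>. h \<epsilon> \<xi> \<in> smooth_functions V"
    and sl: "slow_upto n V \<Lambda> h" for n
    using h by (auto simp: slow_families_def)
  have nz: "\<forall>\<^sub>F \<epsilon> in at_right 0. \<forall>\<xi>\<in>\<Lambda>. \<forall>x\<in>V. h \<epsilon> \<xi> x \<noteq> 0"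
    using low[OF zero_less_one] eventually_at_right_less[of 0]
    by eventually_elim (metis norm_zero not_le powr_gt_zero less_irrefl)
  have si: "\<forall>\<^sub>F \<epsilon> in at_right 0. \<forall>\<xi>\<in>\<Lambda>. (\<lambda>x. inverse (h \<epsilon> \<xi> x)) \<in> smooth_functions V"
    using s nz by eventually_elim (auto intro: smooth_inverse V)
  have sh: "(\<lambda>\<epsilon> \<xi>. partial_deriv j (h \<epsilon> \<xi>)) \<in> slow_families V \<Lambda>" for j
    by (rule slow_families_partial_deriv[OF h])
  have c: "(\<lambda>\<epsilon> \<xi> x. - 1) \<in> slow_families V \<Lambda>"
    by (rule slow_families_bounded_const[of _ 1]) simp
  have z: "slow_upto 0 V \<Lambda> (\<lambda>\<epsilon> \<xi> x. inverse (h \<epsilon> \<xi> x))"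
    unfolding slow_upto_0
  proof (intro allI impI)
    fix \<delta> :: real assume "\<delta> > 0"
    from low[OF this] eventually_at_right_less[of 0]
    show "\<forall>\<^sub>F \<epsilon> in at_right 0. \<forall>\<xi>\<in>\<Lambda>. \<forall>x\<in>V. norm (inverse (h \<epsilon> \<xi> x)) \<le> \<epsilon> powr (- \<delta>)"
      by eventually_elim (auto simp: powr_minus norm_inverse intro!: le_imp_inverse_le)
  qed
  have "slow_upto n V \<Lambda> (\<lambda>\<epsilon> \<xi> x. inverse (h \<epsilon> \<xi> x))" for n
  proof (induction n)
    case (Suc n)
    have "slow_upto n V \<Lambda> (\<lambda>\<epsilon> \<xi>. partial_deriv j (\<lambda>x. inverse (h \<epsilon> \<xi> x)))" for j
    proof (rule slow_upto_cong[OF V])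
      have q: "\<forall>\<^sub>F \<epsilon> in at_right 0. \<forall>\<xi>\<in>\<Lambda>. (\<lambda>x. inverse (h \<epsilon> \<xi> x) * inverse (h \<epsilon> \<xi> x)) \<in> smooth_functions V"
        using si by eventually_elim (auto intro: smooth_mult V)
      have r: "(\<lambda>\<epsilon> \<xi> x. - 1 * partial_deriv j (h \<epsilon> \<xi>) x) \<in> slow_families V \<Lambda>"
        by (rule slow_families_mult[OF c sh])
      show "slow_upto n V \<Lambda> (\<lambda>\<epsilon> \<xi> x. (inverse (h \<epsilon> \<xi> x) * inverse (h \<epsilon> \<xi> x)) * (- 1 * partial_deriv j (h \<epsilon> \<xi>) x))"
        by (rule slow_upto_mult[OF q slow_upto_mult[OF si Suc si Suc]]) (use r in \<open>auto simp: slow_families_def\<close>)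
      show "\<forall>\<^sub>F \<epsilon> in at_right 0. \<forall>\<xi>\<in>\<Lambda>. \<forall>x\<in>V. (inverse (h \<epsilon> \<xi> x) * inverse (h \<epsilon> \<xi> x)) * (- 1 * partial_deriv j (h \<epsilon> \<xi>) x)
          = partial_deriv j (\<lambda>x. inverse (h \<epsilon> \<xi> x)) x"
        using s nz
      proof eventually_elim
        case (elim \<epsilon>)
        show ?case
        proof (intro ballI)
          fix \<xi> x assume "\<xi> \<in> \<Lambda>" "x \<in> V"
          with elim partial_deriv_chain(2)[OF smooth_differentiable DERIV_inverse, of "h \<epsilon> \<xi>" V x j]
          show "(inverse (h \<epsilon> \<xi> x) * inverse (h \<epsilon> \<xi> x)) * (- 1 * partial_deriv j (h \<epsilon> \<xi>) x)
            = partial_deriv j (\<lambda>x. inverse (h \<epsilon> \<xi> x)) x" by simp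
        qed
      qed
    qed
    with z show ?case by (simp add: slow_upto_Suc)
  qed (rule z)
  with si show ?thesis by (simp add: slow_families_def)
qed

end

text \<open>Slow scale growth is exchanged for one fixed power of \<open>1 / \<epsilon>\<close>.
  There are finitely many lists of bounded length, so a common range of \<epsilon> exists for all
  these derivatives.\<close>

lemma slow_families_bound:
  fixes V :: "(real^'n::finite) set"
  assumes "w \<in> slow_families V \<Lambda>"
  shows "\<forall>\<^sub>F \<epsilon> in at_right 0. \<forall>js\<in>{js. length js \<le> m}. \<forall>\<xi>\<in>\<Lambda>. \<forall>x\<in>V.
    norm (foldr partial_deriv js (w \<epsilon> \<xi>) x) \<le> \<epsilon> powr (- 1)"
proof (rule eventually_ball_finite)
  show "finite {js :: 'n list. length js \<le> m}"
    using finite_lists_length_le[OF finite_class.finite_UNIV, of m] by simp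
  show "\<forall>js\<in>{js. length js \<le> m}. \<forall>\<^sub>F \<epsilon> in at_right 0. \<forall>\<xi>\<in>\<Lambda>. \<forall>x\<in>V.
      norm (foldr partial_deriv js (w \<epsilon> \<xi>) x) \<le> \<epsilon> powr (- 1)"
  proof
    fix js :: "'n list" assume "js \<in> {js. length js \<le> m}"
    then have "\<forall>\<delta>>0. \<forall>\<^sub>F \<epsilon> in at_right 0. \<forall>\<xi>\<in>\<Lambda>. \<forall>x\<in>V. norm (foldr partial_deriv js (w \<epsilon> \<xi>) x) \<le> \<epsilon> powr (- \<delta>)"
      using assms by (simp add: slow_families_def slow_upto_def)
    then show "\<forall>\<^sub>F \<epsilon> in at_right 0. \<forall>\<xi>\<in>\<Lambda>. \<forall>x\<in>V. norm (foldr partial_deriv js (w \<epsilon> \<xi>) x) \<le> \<epsilon> powr (- 1)"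
      using zero_less_one by blast
  qed
qed

lemma slow_families_subset:
  fixes V :: "(real^'n::finite) set"
  assumes w: "w \<in> slow_families V \<Lambda>" and W: "W \<subseteq> V"
  shows "w \<in> slow_families W \<Lambda>"
proof -
  have "slow_upto n W \<Lambda> w" for n
    unfolding slow_upto_def
  proof (intro allI impI)
    fix js :: "'n list" and \<delta> :: real assume "length js \<le> n" "\<delta> > 0"
    then have "\<forall>\<^sub>F \<epsilon> in at_right 0. \<forall>\<xi>\<in>\<Lambda>. \<forall>x\<in>V. norm (foldr partial_deriv js (w \<epsilon> \<xi>) x) \<le> \<epsilon> powr (- \<delta>)"
      using w by (simp add: slow_families_def slow_upto_def)
    then show "\<forall>\<^sub>F \<epsilon> in at_right 0. \<forall>\<xi>\<in>\<Lambda>. \<forall>x\<in>W. norm (foldr partial_deriv js (w \<epsilon> \<xi>) x) \<le> \<epsilon> powr (- \<delta>)"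
      by eventually_elim (use W in blast)
  qed
  moreover have "\<forall>\<^sub>F \<epsilon> in at_right 0. \<forall>\<xi>\<in>\<Lambda>. w \<epsilon> \<xi> \<in> smooth_functions V"
    using w by (simp add: slow_families_def)
  then have "\<forall>\<^sub>F \<epsilon> in at_right 0. \<forall>\<xi>\<in>\<Lambda>. w \<epsilon> \<xi> \<in> smooth_functions W"
    by eventually_elim (use W smooth_subset in blast)
  ultimately show ?thesis by (simp add: slow_families_def)
qed

section \<open>Representatives of Colombeau functions\<close>

lemma eventually_Ioc_0_1: "\<forall>\<^sub>F \<epsilon> in at_right 0. \<epsilon> \<in> {0<..1::real}"
  unfolding eventually_at_right_field by (intro exI[of _ 1]) auto

lemma slow_scale_net_le_powr:
  assumes "slow_scale_net r" "\<delta> > 0"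
  shows "\<forall>\<^sub>F \<epsilon> in at_right 0. \<bar>r \<epsilon>\<bar> \<le> \<epsilon> powr (- \<delta>)"
proof -
  \<comment> \<open>With the exponent \<open>2 / \<delta>\<close> the net is bounded by a constant
    times \<open>\<epsilon> powr (- (\<delta> / 2))\<close>; the other half of \<delta> absorbs the
    constant.\<close>
  have "(\<lambda>\<epsilon>. \<bar>r \<epsilon>\<bar> powr (2 / \<delta>)) \<in> O[at_right 0](\<lambda>\<epsilon>. 1 / \<epsilon>)"
    using assms by (simp add: slow_scale_net_def)
  then obtain c where c: "c > 0" "\<forall>\<^sub>F \<epsilon> in at_right 0. norm (\<bar>r \<epsilon>\<bar> powr (2 / \<delta>)) \<le> c * norm (1 / \<epsilon>)"
    by (rule landau_o.bigE)
  have "\<forall>\<^sub>F \<epsilon> in at_right 0. c powr (\<delta> / 2) * \<epsilon> powr (- (\<delta> / 2)) \<le> \<epsilon> powr (- \<delta>)"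
    by (rule eventually_mult_powr_le) (use assms in simp)
  with c(2) eventually_Ioc_0_1 show ?thesis
  proof eventually_elim
    case (elim \<epsilon>)
    have "\<bar>r \<epsilon>\<bar> = (\<bar>r \<epsilon>\<bar> powr (2 / \<delta>)) powr (\<delta> / 2)" using assms(2) by (simp add: powr_powr)
    also have "\<dots> \<le> (c * (1 / \<epsilon>)) powr (\<delta> / 2)" using elim(1,2) assms(2) by (intro powr_mono2) simp_all
    also have "1 / \<epsilon> = \<epsilon> powr (- 1)" using elim(2) by (simp add: powr_minus_divide)
    also have "(c * \<epsilon> powr (- 1)) powr (\<delta> / 2) = c powr (\<delta> / 2) * \<epsilon> powr (- (\<delta> / 2))"
      by (simp only: powr_mult powr_powr) simp
    finally show ?case using elim by linarith
  qed
qed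

section \<open>Estimates for representatives on compact sets\<close>

lemma iter_partial_deriv_diff:
  assumes "open V" "f \<in> smooth_functions V" "g \<in> smooth_functions V" "x \<in> V"
  shows "foldr partial_deriv js (\<lambda>x. f x - g x) x = foldr partial_deriv js f x - foldr partial_deriv js g x"
  using assms(4)
proof (induction js arbitrary: x)
  case (Cons j js)
  have "partial_deriv j (foldr partial_deriv js (\<lambda>x. f x - g x)) x
      = partial_deriv j (\<lambda>x. foldr partial_deriv js f x - foldr partial_deriv js g x) x"
    by (rule partial_deriv_cong_open[OF assms(1) Cons.prems Cons.IH])
  also have "\<dots> = partial_deriv j (foldr partial_deriv js f) x - partial_deriv j (foldr partial_deriv js g) x"
    by (subst partial_deriv_eq[OF has_derivative_diff[OF
            has_derivative_frechet[OF smooth_differentiable[OF smooth_iter_partial_deriv[OF assms(2)] Cons.prems]]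
            has_derivative_frechet[OF smooth_differentiable[OF smooth_iter_partial_deriv[OF assms(3)] Cons.prems]]]])
      (simp add: partial_deriv_def)
  finally show ?case by simp
qed simp

lemma negligible_iter_partial_deriv:
  assumes "open \<Omega>" "u \<in> negligible_nets \<Omega>" "compact K" "K \<subseteq> \<Omega>" "q \<ge> 0"
  obtains C where "\<forall>\<^sub>F \<epsilon> in at_right 0. \<forall>x\<in>K. norm (foldr partial_deriv js (u \<epsilon>) x) \<le> C * \<epsilon> powr q"
proof -
  from assms obtain C where
    "\<forall>\<^sub>F \<epsilon> in at_right 0. \<forall>x\<in>K. cmod (mi_deriv (\<chi> j. count_list js j) (u \<epsilon>) x) \<le> C * \<epsilon> powr q"
    unfolding negligible_nets_def by blast
  then have "\<forall>\<^sub>F \<epsilon> in at_right 0. \<forall>x\<in>K. norm (foldr partial_deriv js (u \<epsilon>) x) \<le> C * \<epsilon> powr q"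
    using eventually_Ioc_0_1
  proof eventually_elim
    case (elim \<epsilon>)
    then have "u \<epsilon> \<in> smooth_functions \<Omega>" using assms(2) by (simp add: negligible_nets_def)
    then show ?case using elim(1) assms(1,4) mi_deriv_count_list[of \<Omega> "u \<epsilon>" _ js] by (metis subsetD)
  qed
  then show ?thesis by (rule that)
qed

lemma moderate_smooth: "u \<in> moderate_nets \<Omega> \<Longrightarrow> \<epsilon> \<in> {0<..1} \<Longrightarrow> u \<epsilon> \<in> smooth_functions \<Omega>"
  by (simp add: moderate_nets_def)

lemma moderate_bound:
  assumes "open \<Omega>" "u \<in> moderate_nets \<Omega>" "compact K" "K \<subseteq> \<Omega>"
  obtains p C where "\<forall>\<^sub>F \<epsilon> in at_right 0. \<forall>x\<in>K. norm (u \<epsilon> x) \<le> C * \<epsilon> powr (- p)"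
proof -
  from assms obtain p C where
    "\<forall>\<^sub>F \<epsilon> in at_right 0. \<forall>x\<in>K. cmod (mi_deriv (\<chi> j. count_list [] j) (u \<epsilon>) x) \<le> C * \<epsilon> powr (- p)"
    unfolding moderate_nets_def by blast
  then have "\<forall>\<^sub>F \<epsilon> in at_right 0. \<forall>x\<in>K. norm (u \<epsilon> x) \<le> C * \<epsilon> powr (- p)"
    using eventually_Ioc_0_1
  proof eventually_elim
    case (elim \<epsilon>)
    have "mi_deriv (\<chi> j. count_list [] j) (u \<epsilon>) x = u \<epsilon> x" if "x \<in> K" for x
      using mi_deriv_count_list[OF assms(1) moderate_smooth[OF assms(2) elim(2)], of x "[]"] assms(4) that by auto
    then show ?case using elim(1) by metis
  qed
  then show ?thesis by (rule that)
qed

lemma colombeau_moderate: "a \<in> colombeau \<Omega> \<Longrightarrow> x \<in> a \<Longrightarrow> x \<in> moderate_nets \<Omega>"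
  by (auto simp: colombeau_def colombeau_rel_def elim!: quotientE)

lemma colombeau_representatives_diff:
  assumes \<Omega>: "open \<Omega>" and a: "a \<in> colombeau \<Omega>" "x \<in> a" "y \<in> a"
    and K: "compact K" "K \<subseteq> \<Omega>" and q: "q \<ge> 0"
  obtains C where "\<forall>\<^sub>F \<epsilon> in at_right 0. \<forall>z\<in>K.
    norm (foldr partial_deriv js (\<lambda>z. x \<epsilon> z - y \<epsilon> z) z) \<le> C * \<epsilon> powr q"
proof -
  from a(1) obtain w where w: "a = colombeau_rel \<Omega> `` {w}"
    unfolding colombeau_def by (rule quotientE)
  have n: "(\<lambda>\<epsilon> z. w \<epsilon> z - v \<epsilon> z) \<in> negligible_nets \<Omega>" and m: "w \<in> moderate_nets \<Omega>" "v \<in> moderate_nets \<Omega>" if "v \<in> a" for v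
    using that w by (auto simp: colombeau_rel_def)
  obtain C1 where C1: "\<forall>\<^sub>F \<epsilon> in at_right 0. \<forall>z\<in>K. norm (foldr partial_deriv js (\<lambda>z. w \<epsilon> z - x \<epsilon> z) z) \<le> C1 * \<epsilon> powr q"
    using negligible_iter_partial_deriv[OF \<Omega> n[OF a(2)] K q, of js] by blast
  obtain C2 where C2: "\<forall>\<^sub>F \<epsilon> in at_right 0. \<forall>z\<in>K. norm (foldr partial_deriv js (\<lambda>z. w \<epsilon> z - y \<epsilon> z) z) \<le> C2 * \<epsilon> powr q"
    using negligible_iter_partial_deriv[OF \<Omega> n[OF a(3)] K q, of js] by blast
  have "\<forall>\<^sub>F \<epsilon> in at_right 0. \<forall>z\<in>K. norm (foldr partial_deriv js (\<lambda>z. x \<epsilon> z - y \<epsilon> z) z) \<le> (C1 + C2) * \<epsilon> powr q"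
    using C1 C2 eventually_Ioc_0_1
  proof eventually_elim
    case (elim \<epsilon>)
    have s: "w \<epsilon> \<in> smooth_functions \<Omega>" "x \<epsilon> \<in> smooth_functions \<Omega>" "y \<epsilon> \<in> smooth_functions \<Omega>"
      using elim(3) m a(2,3) by (auto intro: moderate_smooth)
    show ?case
    proof
      fix z assume z: "z \<in> K"
      then have z': "z \<in> \<Omega>" using K by auto
      have "foldr partial_deriv js (\<lambda>z. x \<epsilon> z - y \<epsilon> z) z = foldr partial_deriv js (\<lambda>z. w \<epsilon> z - y \<epsilon> z) z
          - foldr partial_deriv js (\<lambda>z. w \<epsilon> z - x \<epsilon> z) z"
        using s z' \<Omega> by (simp add: iter_partial_deriv_diff)
      also have "norm \<dots> \<le> C2 * \<epsilon> powr q + C1 * \<epsilon> powr q"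
        using elim(1,2) z by (intro order_trans[OF norm_triangle_ineq4] add_mono) auto
      finally show "norm (foldr partial_deriv js (\<lambda>z. x \<epsilon> z - y \<epsilon> z) z) \<le> (C1 + C2) * \<epsilon> powr q"
        by (simp add: algebra_simps)
    qed
  qed
  then show ?thesis by (rule that)
qed

text \<open>Slow scale is granted for one representative only. Any other one differs from it by a
  negligible net, whose derivatives are in particular bounded on \<open>K\<close>, so the
  representatives through which the operator acts qualify too.\<close>

lemma slow_families_coefficient:
  assumes \<Omega>: "open \<Omega>" and a: "a \<in> colombeau \<Omega>" "slow_scale \<Omega> a" "b \<in> a"
    and K: "compact K" "K \<subseteq> \<Omega>" "V \<subseteq> K"
  shows "(\<lambda>\<epsilon> \<xi>. b \<epsilon>) \<in> slow_families V \<Lambda>"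
proof -
  have "\<forall>\<^sub>F \<epsilon> in at_right 0. \<forall>\<xi>\<in>\<Lambda>. \<forall>x\<in>V. norm (foldr partial_deriv js (b \<epsilon>) x) \<le> \<epsilon> powr (- \<delta>)"
    if \<delta>: "\<delta> > 0" for js and \<delta> :: real
  proof -
    from a(2) obtain w where w: "w \<in> a" and w': "\<forall>K \<alpha>. compact K \<and> K \<subseteq> \<Omega> \<longrightarrow> (\<exists>r. pos_slow_scale_net r \<and>
       (\<forall>\<^sub>F \<epsilon> in at_right 0. \<forall>x\<in>K. cmod (mi_deriv \<alpha> (w \<epsilon>) x) \<le> r \<epsilon>))"
      unfolding slow_scale_def by (elim bexE)
    obtain r where r: "pos_slow_scale_net r"
      "\<forall>\<^sub>F \<epsilon> in at_right 0. \<forall>x\<in>K. cmod (mi_deriv (\<chi> j. count_list js j) (w \<epsilon>) x) \<le> r \<epsilon>"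
      using w'[rule_format, OF conjI[OF K(1,2)]] by blast
    obtain C where C: "\<forall>\<^sub>F \<epsilon> in at_right 0. \<forall>z\<in>K.
        norm (foldr partial_deriv js (\<lambda>z. b \<epsilon> z - w \<epsilon> z) z) \<le> C * \<epsilon> powr 0"
      by (rule colombeau_representatives_diff[OF \<Omega> a(1) a(3) w K(1,2) order_refl, where js = js])
    have "\<forall>\<^sub>F \<epsilon> in at_right 0. \<bar>r \<epsilon>\<bar> \<le> \<epsilon> powr (- (\<delta> / 2))"
      using r(1) \<delta> by (intro slow_scale_net_le_powr) (auto simp: pos_slow_scale_net_def)
    moreover have "\<forall>\<^sub>F \<epsilon> in at_right 0. C \<le> \<epsilon> powr (- (\<delta> / 2))"
      by (rule eventually_le_powr) (use \<delta> in simp)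
    moreover have "\<forall>\<^sub>F \<epsilon> in at_right 0. 2 * \<epsilon> powr (- (\<delta> / 2)) \<le> \<epsilon> powr (- \<delta>)"
      by (rule eventually_mult_powr_le) (use \<delta> in simp)
    ultimately show ?thesis using C r(2) eventually_Ioc_0_1
    proof eventually_elim
      case (elim \<epsilon>)
      have s: "b \<epsilon> \<in> smooth_functions \<Omega>" "w \<epsilon> \<in> smooth_functions \<Omega>"
        using elim(6) colombeau_moderate[OF a(1)] a(3) w by (auto intro: moderate_smooth)
      show ?case
      proof (intro ballI)
        fix x assume "x \<in> V"
        then have x: "x \<in> K" "x \<in> \<Omega>" using K by auto
        have "foldr partial_deriv js (b \<epsilon>) x = foldr partial_deriv js (\<lambda>z. b \<epsilon> z - w \<epsilon> z) x
            + mi_deriv (\<chi> j. count_list js j) (w \<epsilon>) x"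
          using s x \<Omega> by (simp add: iter_partial_deriv_diff mi_deriv_count_list)
        also have "norm \<dots> \<le> C * \<epsilon> powr 0 + r \<epsilon>"
          using elim x by (intro order_trans[OF norm_triangle_ineq] add_mono) auto
        also have "\<dots> \<le> \<epsilon> powr (- \<delta>)" using elim by simp
        finally show "norm (foldr partial_deriv js (b \<epsilon>) x) \<le> \<epsilon> powr (- \<delta>)" .
      qed
    qed
  qed
  moreover have "\<forall>\<^sub>F \<epsilon> in at_right 0. b \<epsilon> \<in> smooth_functions V"
    using eventually_Ioc_0_1
    by eventually_elim (use K moderate_smooth[OF colombeau_moderate[OF a(1,3)]] smooth_subset in blast)
  ultimately show ?thesis by (auto simp: slow_families_def slow_upto_def elim!: eventually_mono)
qed

lemma slow_families_negligible:
  assumes "open \<Omega>" "u \<in> negligible_nets \<Omega>" "compact K" "K \<subseteq> \<Omega>" "V \<subseteq> K"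
  shows "(\<lambda>\<epsilon> \<xi>. u \<epsilon>) \<in> slow_families V \<Lambda>"
proof -
  have "\<forall>\<^sub>F \<epsilon> in at_right 0. \<forall>\<xi>\<in>\<Lambda>. \<forall>x\<in>V. norm (foldr partial_deriv js (u \<epsilon>) x) \<le> \<epsilon> powr (- \<delta>)"
    if "\<delta> > 0" for js and \<delta> :: real
  proof -
    obtain C where "\<forall>\<^sub>F \<epsilon> in at_right 0. \<forall>x\<in>K. norm (foldr partial_deriv js (u \<epsilon>) x) \<le> C * \<epsilon> powr 0"
      by (rule negligible_iter_partial_deriv[OF assms(1-4) order_refl])
    then show ?thesis using eventually_le_powr[OF that, of C] eventually_Ioc_0_1
    proof eventually_elim
      case (elim \<epsilon>)
      show ?case
      proof (intro ballI)
        fix x assume "x \<in> V"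
        then have "norm (foldr partial_deriv js (u \<epsilon>) x) \<le> C * \<epsilon> powr 0" using elim(1) assms(5) by blast
        also have "\<dots> \<le> \<epsilon> powr (- \<delta>)" using elim(2,3) by simp
        finally show "norm (foldr partial_deriv js (u \<epsilon>) x) \<le> \<epsilon> powr (- \<delta>)" .
      qed
    qed
  qed
  moreover have "\<forall>\<^sub>F \<epsilon> in at_right 0. \<forall>\<xi>\<in>\<Lambda>. u \<epsilon> \<in> smooth_functions V"
    using eventually_Ioc_0_1
  proof eventually_elim
    case (elim \<epsilon>)
    then have "u \<epsilon> \<in> smooth_functions \<Omega>" using assms(2) by (simp add: negligible_nets_def)
    then show ?case using assms(4,5) smooth_subset by blast
  qed
  ultimately show ?thesis by (simp add: slow_families_def slow_upto_def)
qed

text \<open>This serves to replace one representative of \<open>P u\<close> by another. The exponent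
  does not depend on \<open>l\<close>, because all derivatives of a negligible net are of slow scale
  near \<open>L\<close>.\<close>

lemma fourier_negligible_decay:
  fixes \<Omega> :: "(real^'n::finite) set"
  assumes \<Omega>: "open \<Omega>" and u: "u \<in> negligible_nets \<Omega>" and \<psi>: "\<psi> \<in> smooth_functions UNIV"
    and L: "compact L" "L \<subseteq> \<Omega>" "\<And>x. x \<notin> L \<Longrightarrow> \<psi> x = 0"
  obtains C where "\<forall>\<^sub>F \<epsilon> in at_right 0. \<forall>\<eta>.
    norm (fourier (\<lambda>x. \<psi> x * u \<epsilon> x) \<eta>) \<le> C * \<epsilon> powr (- 1) * inverse ((1 + norm \<eta>) ^ l)"
proof -
  obtain W J where W: "open W" "compact J" "L \<subseteq> W" "W \<subseteq> J" "J \<subseteq> \<Omega>"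
    using compact_open_between[OF L(1) \<Omega> L(2)] .
  \<comment> \<open>No covector enters here, so the parameter set is a singleton.\<close>
  have g: "(\<lambda>\<epsilon> \<xi> x. \<psi> x * u \<epsilon> x) \<in> slow_families W {()}"
    by (rule slow_families_mult[OF W(1) slow_families_smooth[OF W(1) \<psi> W(2,4) subset_UNIV]
          slow_families_negligible[OF \<Omega> u W(2,5,4)]])
  then have "\<forall>\<^sub>F \<epsilon> in at_right 0. \<forall>\<xi>\<in>{()}. (\<lambda>x. \<psi> x * u \<epsilon> x) \<in> smooth_functions W"
    by (simp add: slow_families_def)
  then have "\<forall>\<^sub>F \<epsilon> in at_right 0. \<forall>\<eta>. norm (fourier (\<lambda>x. \<psi> x * u \<epsilon> x) \<eta>)
      \<le> ((1 + CARD('n)) ^ l * measure lborel L) * \<epsilon> powr (- 1) * inverse ((1 + norm \<eta>) ^ l)"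
    using slow_families_bound[OF g, of l]
  proof eventually_elim
    case (elim \<epsilon>)
    have z: "\<psi> x * u \<epsilon> x = 0" if "x \<notin> L" for x using L(3)[OF that] by simp
    have "(\<lambda>x. \<psi> x * u \<epsilon> x) \<in> smooth_functions W" using elim(1) by simp
    then have s: "(\<lambda>x. \<psi> x * u \<epsilon> x) \<in> smooth_functions UNIV"
      by (rule smooth_extend_zero[OF _ compact_imp_closed[OF L(1)] W(3)]) (rule z)
    have "norm (foldr partial_deriv js (\<lambda>x. \<psi> x * u \<epsilon> x) x) \<le> \<epsilon> powr (- 1)"
      if "length js \<le> l" "x \<in> L" for js x using elim(2) that W(3) by blast
    from fourier_decay[OF s L(1) z this] show ?case by simp
  qed
  then show ?thesis by (rule that)
qed

section \<open>First order operators\<close>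

lemma mi_order_axis [simp]: "mi_order (axis j 1 :: nat^'n::finite) = 1"
proof -
  have "axis j (1::nat) $ i = (if i = j then 1 else 0)" for i by (simp add: axis_def)
  then show ?thesis by (simp add: mi_order_def)
qed

lemma mi_order_0 [simp]: "mi_order 0 = 0"
  by (simp add: mi_order_def)

lemma sum_mi_order_le_1:
  "(\<Sum>\<alpha> | mi_order \<alpha> \<le> 1. F \<alpha>) = F 0 + (\<Sum>j\<in>UNIV. F (axis j 1 :: nat^'n::finite))"
proof -
  have "{\<alpha> :: nat^'n. mi_order \<alpha> \<le> 1} = insert 0 (range (\<lambda>j. axis j 1))"
  proof (intro set_eqI iffI)
    fix \<alpha> :: "nat^'n" assume \<alpha>: "\<alpha> \<in> {\<alpha>. mi_order \<alpha> \<le> 1}"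
    show "\<alpha> \<in> insert 0 (range (\<lambda>j. axis j 1))"
    proof (cases "\<alpha> = 0")
      case False
      then obtain j where j: "\<alpha> $ j \<noteq> 0" by (auto simp: vec_eq_iff)
      define S where "S = (\<Sum>i\<in>UNIV - {j}. \<alpha> $ i)"
      have "mi_order \<alpha> = \<alpha> $ j + S"
        unfolding mi_order_def S_def by (rule sum.remove) auto
      with \<alpha> j have "\<alpha> $ j = 1" and "S = 0" by auto
      then have "\<alpha> $ i = (if i = j then 1 else 0)" for i
        by (cases "i = j") (auto simp: S_def)
      then have "\<alpha> = axis j 1" by (simp add: vec_eq_iff axis_def)
      then show ?thesis by blast
    qed auto
  qed (auto simp del: One_nat_def)
  moreover have "0 \<notin> range (\<lambda>j. axis j 1 :: nat^'n)"
    by (auto simp: axis_eq_0_iff dest: sym)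
  moreover have "inj (\<lambda>j. axis j 1 :: nat^'n)" by (auto simp: inj_def axis_eq_axis)
  ultimately show ?thesis by (simp add: sum.reindex o_def)
qed

lemma mi_D_0:
  fixes f :: "real^'n::finite \<Rightarrow> complex"
  shows "mi_D 0 f = f"
proof -
  have "(SOME js. \<forall>j. count_list js j = (0 :: nat^'n) $ j) = []"
    by (rule some_equality) (auto simp: count_list_0_iff)
  then show ?thesis by (simp add: mi_D_def mi_deriv_def del: zero_index)
qed

lemma mi_D_axis: "mi_D (axis j 1) f = (\<lambda>x. - \<i> * partial_deriv j f x)"
proof -
  have "(SOME js. \<forall>i. count_list js i = axis j 1 $ i) = [j]"
  proof (rule some_equality)
    show "\<forall>i. count_list [j] i = axis j 1 $ i" by (auto simp: axis_def)
    fix js assume "\<forall>i. count_list js i = axis j 1 $ i"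
    then have "mset js = {#j#}" by (intro multiset_eqI) (simp add: count_mset axis_def)
    then show "js = [j]" by (cases js) (auto simp: add_mset_eq_single)
  qed
  then show ?thesis by (simp add: mi_D_def mi_deriv_def del: One_nat_def)
qed

lemma first_order_pdo_axis [simp]: "first_order_pdo a\<^sub>0 a (axis j 1) = a j"
proof -
  have "(THE i. axis j (1::nat) = axis i 1) = j" by (rule the_equality) (auto simp: axis_eq_axis)
  then show ?thesis by (simp add: first_order_pdo_def axis_eq_0_iff)
qed

lemma pdo_symbol_1:
  "pdo_symbol 1 b \<epsilon> x \<xi> = b 0 \<epsilon> x + (\<Sum>j\<in>UNIV. b (axis j 1) \<epsilon> x * of_real (\<xi> $ j))"
proof -
  have "mi_power \<xi> (axis j 1) = \<xi> $ j" for j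
  proof -
    have "(\<xi> $ i) ^ (axis j 1 $ i) = (if i = j then \<xi> $ j else 1)" for i by (simp add: axis_def)
    then show ?thesis by (simp add: mi_power_def)
  qed
  moreover have "mi_power \<xi> 0 = 1" by (simp add: mi_power_def)
  ultimately show ?thesis by (simp only: pdo_symbol_def sum_mi_order_le_1) simp
qed

text \<open>By homogeneity neither the radius nor the negligible zeroth order coefficient in
  the definition of ellipticity matters.\<close>

lemma elliptic_homogeneous_bound:
  fixes p b :: complex
  assumes "\<And>t. t > 0 \<Longrightarrow> r \<le> t * d \<Longrightarrow> s * (1 + t * d) \<le> norm (b + of_real t * p)" and "d > 0" "s \<ge> 0"
  shows "s * d \<le> norm p"
proof (rule field_le_epsilon)
  fix e :: real assume e: "e > 0"
  \<comment> \<open>Scaling by \<open>t\<close> passes the radius \<open>r\<close> and makes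
    \<open>norm b \<le> t * e\<close>; the entry 1 ensures positivity.\<close>
  define t where "t = max 1 (max (r / d) (norm b / e))"
  have "t > 0" by (simp add: t_def)
  have "r / d \<le> t" "norm b / e \<le> t" by (simp_all add: t_def)
  then have t: "r \<le> t * d" "norm b \<le> t * e" using assms(2) e by (simp_all add: pos_divide_le_eq)
  have "t * (s * d) \<le> s * (1 + t * d)" using assms(3) by (simp add: algebra_simps)
  also have "\<dots> \<le> norm (b + of_real t * p)" using assms(1) \<open>t > 0\<close> t(1) by blast
  also have "\<dots> \<le> norm b + t * norm p" using norm_triangle_ineq[of b "of_real t * p"] \<open>t > 0\<close> by (simp add: norm_mult)
  also have "\<dots> \<le> t * (norm p + e)" using t(2) by (simp add: algebra_simps)
  finally show "s * d \<le> norm p + e" using \<open>t > 0\<close> by simp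
qed

text \<open>Ellipticity supplies its own representatives \<open>b'\<close>, while the bound is
  needed for the \<open>b\<close> through which the operator acts. On \<open>K\<close> they differ
  by \<open>O(\<epsilon>)\<close>, so a lower bound by a power of \<epsilon> with exponent below 1
  survives the exchange.\<close>

lemma elliptic_lower_bound:
  assumes \<Omega>: "open \<Omega>" and a: "\<And>j. a j \<in> colombeau \<Omega>" and b: "\<And>j. b j \<in> a j" "\<And>j. b' (axis j 1) \<in> a j"
    and K: "compact K" "K \<subseteq> \<Omega>" "V \<subseteq> K" "V \<subseteq> U"
    and \<Gamma>: "\<And>\<xi> t. \<xi> \<in> \<Gamma> \<Longrightarrow> t > 0 \<Longrightarrow> t *\<^sub>R \<xi> \<in> \<Gamma>" "0 \<notin> \<Gamma>" and s: "pos_slow_scale_net s"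
    and ell: "\<forall>\<^sub>F \<epsilon> in at_right 0. \<forall>x\<in>U. \<forall>\<xi>\<in>\<Gamma>. norm \<xi> \<ge> r \<epsilon> \<longrightarrow>
        cmod (pdo_symbol 1 b' \<epsilon> x \<xi>) \<ge> inverse (s \<epsilon>) * (1 + norm \<xi>) ^ 1"
    and \<delta>: "\<delta> > 0"
  shows "\<forall>\<^sub>F \<epsilon> in at_right 0. \<forall>\<xi>\<in>\<Gamma>. \<forall>x\<in>V.
    \<epsilon> powr \<delta> * norm \<xi> \<le> norm (\<Sum>j\<in>UNIV. b j \<epsilon> x * of_real (\<xi> $ j))"
proof -
  let ?n = "real CARD('a)"
  have "\<exists>C. \<forall>\<^sub>F \<epsilon> in at_right 0. \<forall>z\<in>K.
      norm (foldr partial_deriv [] (\<lambda>z. b' (axis j 1) \<epsilon> z - b j \<epsilon> z) z) \<le> C * \<epsilon> powr 1" for j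
    by (rule colombeau_representatives_diff[OF \<Omega> a b(2) b(1) K(1,2) zero_le_one, where js = "[]"]) (rule exI)
  then have "\<forall>j. \<exists>C. \<forall>\<^sub>F \<epsilon> in at_right 0. \<forall>z\<in>K. norm (b' (axis j 1) \<epsilon> z - b j \<epsilon> z) \<le> C * \<epsilon> powr 1"
    by (simp only: foldr.simps id_apply) blast
  from choice[OF this] obtain C where
    C: "\<forall>j. \<forall>\<^sub>F \<epsilon> in at_right 0. \<forall>z\<in>K. norm (b' (axis j 1) \<epsilon> z - b j \<epsilon> z) \<le> C j * \<epsilon> powr 1" ..
  \<comment> \<open>\<open>\<delta>' < 1\<close> keeps the difference of the representatives below
    half of \<open>\<epsilon> powr \<delta>'\<close>, and \<open>\<delta>' < \<delta>\<close>
    absorbs the factor 1/2 that is lost.\<close>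
  define \<delta>' where "\<delta>' = min \<delta> 1 / 2"
  have \<delta>': "\<delta>' > 0" "\<delta>' < \<delta>" "\<delta>' < 1" using \<delta> by (auto simp: \<delta>'_def)
  have "\<forall>\<^sub>F \<epsilon> in at_right 0. \<bar>s \<epsilon>\<bar> \<le> \<epsilon> powr (- \<delta>')"
    using s \<delta>'(1) by (intro slow_scale_net_le_powr) (auto simp: pos_slow_scale_net_def)
  moreover have "\<forall>\<^sub>F \<epsilon> in at_right 0. 2 * \<epsilon> powr \<delta> \<le> \<epsilon> powr \<delta>'"
    using eventually_mult_powr_le[of "- \<delta>" "- \<delta>'" 2] \<delta>' by simp
  moreover have "\<forall>\<^sub>F \<epsilon> in at_right 0. (2 * (\<Sum>j\<in>UNIV. C j)) * \<epsilon> powr 1 \<le> \<epsilon> powr \<delta>'"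
    using eventually_mult_powr_le[of "- 1" "- \<delta>'" "2 * (\<Sum>j\<in>UNIV. C j)"] \<delta>' by simp
  moreover have "\<forall>\<^sub>F \<epsilon> in at_right 0. \<forall>j\<in>UNIV. \<forall>z\<in>K. norm (b' (axis j 1) \<epsilon> z - b j \<epsilon> z) \<le> C j * \<epsilon> powr 1"
    by (intro eventually_ball_finite finite) (use C in auto)
  ultimately show ?thesis using ell eventually_Ioc_0_1
  proof eventually_elim
    case (elim \<epsilon>)
    have s0: "s \<epsilon> > 0" using s elim(6) by (simp add: pos_slow_scale_net_def)
    show ?case
    proof (intro ballI)
      fix \<xi> x assume \<xi>: "\<xi> \<in> \<Gamma>" and x: "x \<in> V"
      define p where "p = (\<Sum>j\<in>UNIV. b j \<epsilon> x * of_real (\<xi> $ j))"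
      define p' where "p' = (\<Sum>j\<in>UNIV. b' (axis j 1) \<epsilon> x * of_real (\<xi> $ j))"
      have n\<xi>: "norm \<xi> > 0" using \<Gamma>(2) \<xi> by auto
      have "inverse (s \<epsilon>) * norm \<xi> \<le> norm p'"
      proof (rule elliptic_homogeneous_bound)
        fix t :: real assume t: "t > 0" "r \<epsilon> \<le> t * norm \<xi>"
        have "pdo_symbol 1 b' \<epsilon> x (t *\<^sub>R \<xi>) = b' 0 \<epsilon> x + of_real t * p'"
          unfolding pdo_symbol_1 p'_def by (simp add: sum_distrib_left mult_ac)
        moreover have "t *\<^sub>R \<xi> \<in> \<Gamma>" "norm (t *\<^sub>R \<xi>) = t * norm \<xi>" using \<Gamma>(1) \<xi> t by auto
        moreover have "x \<in> U" using x K by auto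
        ultimately show "inverse (s \<epsilon>) * (1 + t * norm \<xi>) \<le> norm (b' 0 \<epsilon> x + of_real t * p')"
          using elim(5) t(2) by (metis power_one_right)
      qed (use n\<xi> s0 in auto)
      moreover have "\<epsilon> powr \<delta>' \<le> inverse (s \<epsilon>)"
        using le_imp_inverse_le[OF elim(1)[THEN order_trans[OF abs_ge_self]] s0] by (simp add: powr_minus)
      ultimately have 1: "\<epsilon> powr \<delta>' * norm \<xi> \<le> norm p'"
        using mult_right_mono[of "\<epsilon> powr \<delta>'" "inverse (s \<epsilon>)" "norm \<xi>"] by simp
      have "norm (p' - p) \<le> (\<Sum>j\<in>UNIV. norm ((b' (axis j 1) \<epsilon> x - b j \<epsilon> x) * of_real (\<xi> $ j)))"
        unfolding p_def p'_def by (simp add: sum_subtractf[symmetric] left_diff_distrib[symmetric] norm_sum)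
      also have "\<dots> \<le> (\<Sum>j\<in>UNIV. (C j * \<epsilon> powr 1) * norm \<xi>)"
        using elim(4) x K(3) by (intro sum_mono) (auto simp: norm_mult intro!: mult_mono component_le_norm_cart
            intro: order_trans[OF norm_ge_zero])
      also have "\<dots> = ((\<Sum>j\<in>UNIV. C j) * \<epsilon> powr 1) * norm \<xi>" by (simp add: sum_distrib_right)
      also have "\<dots> \<le> (\<epsilon> powr \<delta>' / 2) * norm \<xi>" using elim(3) by (intro mult_right_mono) auto
      finally have "norm p \<ge> (\<epsilon> powr \<delta>' / 2) * norm \<xi>"
        using 1 norm_triangle_ineq2[of p' p] by simp
      moreover have "\<epsilon> powr \<delta> * norm \<xi> \<le> (\<epsilon> powr \<delta>' / 2) * norm \<xi>"
        using elim(2) by (intro mult_right_mono) auto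
      ultimately show "\<epsilon> powr \<delta> * norm \<xi> \<le> norm (\<Sum>j\<in>UNIV. b j \<epsilon> x * of_real (\<xi> $ j))"
        by (simp add: p_def)
    qed
  qed
qed

section \<open>Microlocal elliptic regularity\<close>

text \<open>Up to a constant factor, the two sides differ by the integral of the divergence of the
  compactly supported field \<open>e * h j\<close>. As \<open>v\<close> vanishes off
  \<open>L\<close>, all products extend by zero, and smoothness on \<open>V\<close> is all that
  \<open>u\<close> and the coefficients have to offer.\<close>

lemma fourier_first_order_transpose:
  fixes V L :: "(real^'n::finite) set" and u f v b\<^sub>0 :: "real^'n \<Rightarrow> complex" and b :: "'n \<Rightarrow> real^'n \<Rightarrow> complex"
  assumes V: "open V" and L: "compact L" "L \<subseteq> V"
    and u: "u \<in> smooth_functions V" and b: "b\<^sub>0 \<in> smooth_functions V" "\<And>j. b j \<in> smooth_functions V"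
    and v: "v \<in> smooth_functions V" "\<And>x. x \<notin> L \<Longrightarrow> v x = 0"
    and f: "\<And>x. x \<in> V \<Longrightarrow> f x = b\<^sub>0 x * u x + (\<Sum>j\<in>UNIV. b j x * (- \<i> * partial_deriv j u x))"
  shows "fourier (\<lambda>x. f x * v x) \<xi>
    = fourier (\<lambda>x. u x * ((\<Sum>j\<in>UNIV. b j x * of_real (\<xi> $ j)) * v x)) \<xi>
      + fourier (\<lambda>x. u x * (b\<^sub>0 x * v x + (\<Sum>j\<in>UNIV. \<i> * partial_deriv j (\<lambda>x. b j x * v x) x))) \<xi>"
proof -
  define e where "e x = exp (- \<i> * complex_of_real (x \<bullet> \<xi>))" for x
  define h where "h j x = u x * (b j x * v x)" for j x
  define T where "T x = b\<^sub>0 x * v x + (\<Sum>j\<in>UNIV. \<i> * partial_deriv j (\<lambda>x. b j x * v x) x)" for x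
  define p where "p x = (\<Sum>j\<in>UNIV. b j x * of_real (\<xi> $ j))" for x
  have ext: "g \<in> smooth_functions UNIV" if "g \<in> smooth_functions V" "\<And>x. x \<notin> L \<Longrightarrow> g x = 0" for g
    using smooth_extend_zero[OF that(1) compact_imp_closed[OF L(1)] L(2) that(2)] .
  have int: "integrable lborel g" if "g \<in> smooth_functions V" "\<And>x. x \<notin> L \<Longrightarrow> g x = 0" for g
    using integrable_smooth[OF ext[OF that] L(1) that(2)] .
  have d0: "partial_deriv j g x = 0" if "\<And>x. x \<notin> L \<Longrightarrow> g x = 0" "x \<notin> L" for j x and g :: "real^'n \<Rightarrow> complex"
    using iter_partial_deriv_zero_open[of "- L" g x "[j]"] that open_Compl[OF compact_imp_closed[OF L(1)]] by auto
  have e: "e \<in> smooth_functions V" "e \<in> smooth_functions UNIV"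
    using smooth_iexp smooth_subset[OF smooth_iexp] unfolding e_def[abs_def] by auto
  have bv: "(\<lambda>x. b j x * v x) \<in> smooth_functions V" for j by (intro smooth_mult V b v)
  have h: "h j \<in> smooth_functions V" "x \<notin> L \<Longrightarrow> h j x = 0" for j x
    unfolding h_def[abs_def] using v(2) by (auto intro!: smooth_mult V u b v(1))
  have T: "T \<in> smooth_functions V" "x \<notin> L \<Longrightarrow> T x = 0" for x
    unfolding T_def[abs_def] using v(2) d0[of "\<lambda>x. b _ x * v x"]
    by (auto intro!: smooth_add smooth_sum smooth_mult smooth_const smooth_partial_deriv V b v(1))
  have p: "p \<in> smooth_functions V"
    unfolding p_def[abs_def] by (auto intro!: smooth_sum smooth_mult smooth_const V b)
  have dh: "partial_deriv j (\<lambda>x. e x * h j x) x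
      = e x * (u x * partial_deriv j (\<lambda>x. b j x * v x) x + partial_deriv j u x * (b j x * v x) - \<i> * of_real (\<xi> $ j) * h j x)"
    if "x \<in> V" for j x
  proof -
    have "partial_deriv j (h j) x = u x * partial_deriv j (\<lambda>x. b j x * v x) x + partial_deriv j u x * (b j x * v x)"
      unfolding h_def[abs_def] by (rule partial_deriv_mult) (auto intro: smooth_differentiable u bv that)
    then show ?thesis
      unfolding e_def[abs_def] partial_deriv_iexp_mult[OF smooth_differentiable[OF h(1) that]] by simp
  qed
  \<comment> \<open>Off \<open>V\<close> nothing is known about \<open>f\<close>, but off
    \<open>L\<close> every term vanishes, so the identity holds everywhere.\<close>
  have eq: "e x * (f x * v x) = e x * (u x * (p x * v x)) + e x * (u x * T x)
      - \<i> * (\<Sum>j\<in>UNIV. partial_deriv j (\<lambda>x. e x * h j x) x)" for x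
  proof (cases "x \<in> L")
    case True
    then have x: "x \<in> V" using L by auto
    have "\<i> * (\<Sum>j\<in>UNIV. partial_deriv j (\<lambda>x. e x * h j x) x)
        = (\<Sum>j\<in>UNIV. e x * (u x * (\<i> * partial_deriv j (\<lambda>x. b j x * v x) x))
          + e x * (v x * (b j x * (\<i> * partial_deriv j u x))) + e x * (u x * (v x * (b j x * of_real (\<xi> $ j)))))"
      unfolding sum_distrib_left dh[OF x]
      by (intro sum.cong refl) (simp add: h_def algebra_simps)
    also have "\<dots> = e x * (u x * (\<Sum>j\<in>UNIV. \<i> * partial_deriv j (\<lambda>x. b j x * v x) x))
          + e x * (v x * (\<Sum>j\<in>UNIV. b j x * (\<i> * partial_deriv j u x))) + e x * (u x * (v x * p x))"
      by (simp only: sum.distrib sum_distrib_left p_def)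
    finally show ?thesis
      unfolding f[OF x] T_def by (simp add: sum_negf algebra_simps)
  next
    case False
    have "partial_deriv j (\<lambda>x. e x * h j x) x = 0" for j by (rule d0) (use False h in auto)
    then show ?thesis using False v(2) T(2) by simp
  qed
  have "(\<integral>x. e x * (f x * v x) \<partial>lborel) = (\<integral>x. e x * (u x * (p x * v x)) \<partial>lborel) + (\<integral>x. e x * (u x * T x) \<partial>lborel)
      - \<i> * (\<Sum>j\<in>UNIV. \<integral>x. partial_deriv j (\<lambda>x. e x * h j x) x \<partial>lborel)"
  proof -
    have 1: "integrable lborel (\<lambda>x. e x * (u x * (p x * v x)))" "integrable lborel (\<lambda>x. e x * (u x * T x))"
      by (intro int smooth_mult V e u p v(1) T(1); simp add: v(2) T(2))+
    have eh: "(\<lambda>x. e x * h j x) \<in> smooth_functions V" for j by (intro smooth_mult V e h)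
    have 2: "integrable lborel (\<lambda>x. partial_deriv j (\<lambda>x. e x * h j x) x)" for j
      by (rule int[OF smooth_partial_deriv[OF eh]], rule d0) (simp_all add: h(2))
    show ?thesis
      unfolding eq using 1 2
      by (simp add: Bochner_Integration.integral_diff Bochner_Integration.integral_add
          Bochner_Integration.integral_sum integrable_mult_right Bochner_Integration.integrable_sum)
  qed
  moreover have "(\<integral>x. partial_deriv j (\<lambda>x. e x * h j x) x \<partial>lborel) = 0" for j
    by (rule integral_partial_deriv_zero[OF ext L(1)]) (use h in \<open>auto intro!: smooth_mult V e\<close>)
  ultimately show ?thesis by (simp add: fourier_def e_def p_def T_def)
qed

text \<open>All representatives are fixed here and only estimates remain. \<Lambda> holds the
  covectors for which decay is to be shown, \<Gamma> those at which the transform of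
  \<open>\<psi> f\<close> decays; \<open>c\<close> measures the room between them in the form in
  which the convolution is split. The exponent \<open>N\<close> is a parameter of the locale, hence
  common to all \<open>l\<close> in \<open>f_regular\<close>.\<close>

locale microlocally_elliptic =
  fixes V K :: "(real^'n::finite) set" and \<Lambda> \<Gamma> :: "(real^'n) set" and c :: real
    and \<psi> :: "real^'n \<Rightarrow> complex" and u f :: "real \<Rightarrow> real^'n \<Rightarrow> complex"
    and b\<^sub>0 :: "real \<Rightarrow> real^'n \<Rightarrow> complex" and b :: "'n \<Rightarrow> real \<Rightarrow> real^'n \<Rightarrow> complex"
    and p\<^sub>u C\<^sub>u p\<^sub>f C\<^sub>f N :: real
  assumes V: "open V" "V \<subseteq> K" and K: "compact K"
    and \<Lambda>: "\<And>\<xi>. \<xi> \<in> \<Lambda> \<Longrightarrow> \<xi> \<noteq> 0" and c: "0 < c" "c < 1"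
    and \<Gamma>: "\<And>\<xi> \<eta>. \<xi> \<in> \<Lambda> \<Longrightarrow> norm (\<xi> - \<eta>) \<le> c * norm \<xi> \<Longrightarrow> \<eta> \<in> \<Gamma>"
    and \<psi>: "\<psi> \<in> smooth_functions UNIV" "\<And>x. \<psi> x \<noteq> 0 \<longleftrightarrow> x \<in> V"
    and u: "\<forall>\<^sub>F \<epsilon> in at_right 0. u \<epsilon> \<in> smooth_functions V"
    and u_bound: "\<forall>\<^sub>F \<epsilon> in at_right 0. \<forall>x\<in>K. norm (u \<epsilon> x) \<le> C\<^sub>u * \<epsilon> powr (- p\<^sub>u)"
    and \<psi>f: "\<forall>\<^sub>F \<epsilon> in at_right 0. (\<lambda>x. \<psi> x * f \<epsilon> x) \<in> smooth_functions UNIV"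
    and f_bound: "\<forall>\<^sub>F \<epsilon> in at_right 0. \<forall>x\<in>K. norm (f \<epsilon> x) \<le> C\<^sub>f * \<epsilon> powr (- p\<^sub>f)"
    and coeffs: "(\<lambda>\<epsilon> \<xi>. b\<^sub>0 \<epsilon>) \<in> slow_families V \<Lambda>" "\<And>j. (\<lambda>\<epsilon> \<xi>. b j \<epsilon>) \<in> slow_families V \<Lambda>"
    and f_eq: "\<forall>\<^sub>F \<epsilon> in at_right 0. \<forall>x\<in>V.
      f \<epsilon> x = b\<^sub>0 \<epsilon> x * u \<epsilon> x + (\<Sum>j\<in>UNIV. b j \<epsilon> x * (- \<i> * partial_deriv j (u \<epsilon>) x))"
    and f_regular: "\<And>l::nat. \<exists>C. \<forall>\<^sub>F \<epsilon> in at_right 0. \<forall>\<eta>\<in>\<Gamma>.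
      norm (fourier (\<lambda>x. \<psi> x * f \<epsilon> x) \<eta>) \<le> C * \<epsilon> powr (- N) * inverse ((1 + norm \<eta>) ^ l)"
    and elliptic: "\<And>\<delta>. \<delta> > 0 \<Longrightarrow> \<forall>\<^sub>F \<epsilon> in at_right 0. \<forall>\<xi>\<in>\<Lambda>. \<forall>x\<in>V.
      \<epsilon> powr \<delta> * norm \<xi> \<le> norm (\<Sum>j\<in>UNIV. b j \<epsilon> x * of_real (\<xi> $ j))"
begin

text \<open>In the notation of the overview this is \<open>1 / q\<close>. Only the direction of
  \<xi> enters, which makes slow scale bounds uniform over an unbounded set of covectors.\<close>

definition normalized_symbol :: "real \<Rightarrow> real^'n \<Rightarrow> real^'n \<Rightarrow> complex" where
  "normalized_symbol \<epsilon> \<xi> x = (\<Sum>j\<in>UNIV. b j \<epsilon> x * of_real (\<xi> $ j / norm \<xi>))"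

lemma normalized_symbol_eq:
  assumes "\<xi> \<in> \<Lambda>"
  shows "(\<Sum>j\<in>UNIV. b j \<epsilon> x * of_real (\<xi> $ j)) = of_real (norm \<xi>) * normalized_symbol \<epsilon> \<xi> x"
proof -
  have "norm \<xi> \<noteq> 0" using \<Lambda>[OF assms] by auto
  then show ?thesis by (simp add: normalized_symbol_def sum_distrib_left)
qed

lemma normalized_symbol_lower:
  assumes "\<delta> > 0"
  shows "\<forall>\<^sub>F \<epsilon> in at_right 0. \<forall>\<xi>\<in>\<Lambda>. \<forall>x\<in>V. \<epsilon> powr \<delta> \<le> norm (normalized_symbol \<epsilon> \<xi> x)"
  using elliptic[OF assms]
proof eventually_elim
  case (elim \<epsilon>)
  show ?case
  proof (intro ballI)
    fix \<xi> x assume *: "\<xi> \<in> \<Lambda>" "x \<in> V"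
    then have "norm \<xi> > 0" using \<Lambda> by simp
    then show "\<epsilon> powr \<delta> \<le> norm (normalized_symbol \<epsilon> \<xi> x)"
      using elim * by (auto simp: normalized_symbol_eq norm_mult)
  qed
qed

lemma inverse_normalized_symbol_slow:
  "(\<lambda>\<epsilon> \<xi> x. inverse (normalized_symbol \<epsilon> \<xi> x)) \<in> slow_families V \<Lambda>"
proof (rule slow_families_inverse[OF V(1) _ normalized_symbol_lower])
  have "(\<lambda>\<epsilon> \<xi> x. complex_of_real (\<xi> $ j / norm \<xi>)) \<in> slow_families V \<Lambda>" for j
  proof (rule slow_families_bounded_const[OF V(1)])
    fix \<xi> assume "\<xi> \<in> \<Lambda>"
    then have "norm \<xi> > 0" using \<Lambda> by simp
    then show "norm (complex_of_real (\<xi> $ j / norm \<xi>)) \<le> 1"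
      using component_le_norm_cart[of \<xi> j] by (simp add: norm_divide)
  qed
  then show "normalized_symbol \<in> slow_families V \<Lambda>"
    unfolding normalized_symbol_def[abs_def]
    by (intro slow_families_sum slow_families_mult V(1) coeffs)
qed

text \<open>\<open>M\<close> and \<open>l\<close> are separate parameters because one
  \<open>M\<close> has to serve all \<open>l\<close>. The weight is \<open>norm \<xi>\<close> in
  place of \<open>1 + norm \<xi>\<close>, matching the division by \<open>norm \<xi>\<close> in each
  round.\<close>

definition moderate_decay :: "real \<Rightarrow> nat \<Rightarrow> (real \<Rightarrow> real^'n \<Rightarrow> complex) \<Rightarrow> bool" where
  "moderate_decay M l G \<longleftrightarrow> (\<exists>C. \<forall>\<^sub>F \<epsilon> in at_right 0. \<forall>\<xi>\<in>\<Lambda>. norm (G \<epsilon> \<xi>) \<le> C * \<epsilon> powr (- M) * inverse (norm \<xi> ^ l))"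

text \<open>Dividing by the bump \<open>\<psi>\<close>, which is harmless on the support of \<open>w\<close>, lets the regularity
  of the single product \<open>\<psi> f\<close> control all \<open>w f\<close>, with an exponent that depends on neither \<open>w\<close> nor \<open>l\<close>.\<close>

lemma main_term:
  assumes L: "compact L" "L \<subseteq> V" and w: "w \<in> slow_families V \<Lambda>"
    and wL: "\<And>\<epsilon> \<xi> x. x \<notin> L \<Longrightarrow> w \<epsilon> \<xi> x = 0"
  shows "moderate_decay (max p\<^sub>f N + 1) l (\<lambda>\<epsilon> \<xi>. fourier (\<lambda>x. f \<epsilon> x * w \<epsilon> \<xi> x) \<xi>)"
proof -
  \<comment> \<open>The inverse of \<psi> may blow up at the boundary of \<open>V\<close>, so bounds
    for \<open>g\<close> are taken on a smaller neighbourhood of \<open>L\<close>.\<close>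
  obtain W J where W: "open W" "compact J" "L \<subseteq> W" "W \<subseteq> J" "J \<subseteq> V"
    using compact_open_between[OF L(1) V(1) L(2)] .
  define g where "g \<epsilon> \<xi> x = inverse (\<psi> x) * w \<epsilon> \<xi> x" for \<epsilon> \<xi> x
  have gL: "g \<epsilon> \<xi> x = 0" if "x \<notin> L" for \<epsilon> \<xi> x using wL[OF that] by (simp add: g_def)
  have "(\<lambda>x. inverse (\<psi> x)) \<in> smooth_functions V"
    by (rule smooth_inverse[OF V(1) smooth_subset[OF \<psi>(1)]]) (use \<psi>(2) in auto)
  then have "(\<lambda>\<epsilon> \<xi> x. inverse (\<psi> x)) \<in> slow_families W \<Lambda>"
    by (rule slow_families_smooth[OF W(1) _ W(2,4,5)])
  moreover have "w \<in> slow_families W \<Lambda>" using slow_families_subset[OF w] W by auto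
  ultimately have g: "g \<in> slow_families W \<Lambda>"
    unfolding g_def[abs_def] by (rule slow_families_mult[OF W(1)])
  then have gW: "\<forall>\<^sub>F \<epsilon> in at_right 0. \<forall>\<xi>\<in>\<Lambda>. g \<epsilon> \<xi> \<in> smooth_functions W" by (simp add: slow_families_def)
  define E where "E = fourier_mult_const L c l"
  obtain C1 where C1: "\<forall>\<^sub>F \<epsilon> in at_right 0. \<forall>\<eta>\<in>\<Gamma>.
      norm (fourier (\<lambda>x. \<psi> x * f \<epsilon> x) \<eta>) \<le> C1 * \<epsilon> powr (- N) * inverse ((1 + norm \<eta>) ^ l)"
    using f_regular[of l] by blast
  have "bounded (\<psi> ` K)"
    by (intro compact_imp_bounded compact_continuous_image K continuous_on_subset[OF smooth_continuous_on[OF \<psi>(1)]]) auto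
  then obtain B where B: "\<And>x. x \<in> K \<Longrightarrow> norm (\<psi> x) \<le> B" by (auto simp: bounded_iff)
  define M where "M = max p\<^sub>f N"
  define C2 where "C2 = \<bar>measure lborel K * (B * C\<^sub>f)\<bar> + \<bar>C1\<bar>"
  have "\<forall>\<^sub>F \<epsilon> in at_right 0. \<forall>\<xi>\<in>\<Lambda>.
      norm (fourier (\<lambda>x. f \<epsilon> x * w \<epsilon> \<xi> x) \<xi>) \<le> (E * C2) * \<epsilon> powr (- (M + 1)) * inverse (norm \<xi> ^ l)"
    using gW slow_families_bound[OF g, of "l + 2 * CARD('n)"] C1 \<psi>f f_bound eventually_Ioc_0_1
  proof eventually_elim
    case (elim \<epsilon>)
    define A where "A = C2 * \<epsilon> powr (- M)"
    have pw: "\<epsilon> powr (- p\<^sub>f) \<le> \<epsilon> powr (- M)" "\<epsilon> powr (- N) \<le> \<epsilon> powr (- M)"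
      using elim(6) by (auto simp: M_def intro!: powr_mono')
    have z: "\<psi> x * f \<epsilon> x = 0" if "x \<notin> K" for x using \<psi>(2)[of x] V(2) that by auto
    have iF: "integrable lborel (\<lambda>x. \<psi> x * f \<epsilon> x)" by (rule integrable_smooth[OF elim(4) K z])
    \<comment> \<open>Away from \<Gamma> this bound by size and support is all there is;
      \<open>C2\<close> is large enough to serve for the decay in \<Gamma> as well.\<close>
    have A1: "norm (fourier (\<lambda>x. \<psi> x * f \<epsilon> x) \<eta>) \<le> A" for \<eta>
    proof -
      have "norm (fourier (\<lambda>x. \<psi> x * f \<epsilon> x) \<eta>) \<le> measure lborel K * (B * (C\<^sub>f * \<epsilon> powr (- p\<^sub>f)))"
        unfolding fourier_def
      proof (rule norm_integral_zero_off_compact_le[OF _ K])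
        show "integrable lborel (\<lambda>x. exp (- \<i> * complex_of_real (x \<bullet> \<eta>)) * (\<psi> x * f \<epsilon> x))"
          by (rule integrable_smooth[OF smooth_mult[OF open_UNIV smooth_iexp elim(4)] K]) (simp add: z)
        show "norm (exp (- \<i> * complex_of_real (x \<bullet> \<eta>)) * (\<psi> x * f \<epsilon> x)) \<le> B * (C\<^sub>f * \<epsilon> powr (- p\<^sub>f))"
          if "x \<in> K" for x
          using B[OF that] elim(5) that by (auto simp: norm_mult intro!: mult_mono intro: order_trans[OF norm_ge_zero])
      qed (simp add: z)
      also have "\<dots> = (measure lborel K * (B * C\<^sub>f)) * \<epsilon> powr (- p\<^sub>f)" by simp
      also have "\<dots> \<le> A" unfolding A_def C2_def by (intro mult_mono pw) auto
      finally show ?thesis .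
    qed
    show ?case
    proof
      fix \<xi> assume \<xi>: "\<xi> \<in> \<Lambda>"
      have fg: "(\<lambda>x. f \<epsilon> x * w \<epsilon> \<xi> x) = (\<lambda>x. (\<psi> x * f \<epsilon> x) * g \<epsilon> \<xi> x)"
      proof
        fix x show "f \<epsilon> x * w \<epsilon> \<xi> x = (\<psi> x * f \<epsilon> x) * g \<epsilon> \<xi> x"
          using wL[of x \<epsilon> \<xi>] \<psi>(2)[of x] L(2) by (cases "x \<in> L") (auto simp: g_def)
      qed
      have "norm (fourier (\<lambda>x. (\<psi> x * f \<epsilon> x) * g \<epsilon> \<xi> x) \<xi>) \<le> E * A * \<epsilon> powr (- 1) * inverse (norm \<xi> ^ l)"
      unfolding E_def
      proof (rule fourier_mult_estimate[OF L(1) c iF])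
        show "g \<epsilon> \<xi> \<in> smooth_functions UNIV"
          by (rule smooth_extend_zero[of _ W L]) (use elim(1) \<xi> W gL compact_imp_closed[OF L(1)] in auto)
        show "norm (foldr partial_deriv js (g \<epsilon> \<xi>) x) \<le> \<epsilon> powr (- 1)"
          if "length js \<le> l + 2 * CARD('n)" "x \<in> L" for js x
          using elim(2) that \<xi> W(3) by blast
        show "norm (fourier (\<lambda>x. \<psi> x * f \<epsilon> x) \<eta>) \<le> A * inverse ((1 + norm \<eta>) ^ l)"
          if "norm (\<xi> - \<eta>) \<le> c * norm \<xi>" for \<eta>
        proof -
          have "norm (fourier (\<lambda>x. \<psi> x * f \<epsilon> x) \<eta>) \<le> C1 * \<epsilon> powr (- N) * inverse ((1 + norm \<eta>) ^ l)"
            using elim(3) \<Gamma>[OF \<xi> that] by blast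
          also have "\<dots> \<le> A * inverse ((1 + norm \<eta>) ^ l)"
            unfolding A_def C2_def by (intro mult_right_mono mult_mono pw) auto
          finally show ?thesis .
        qed
      qed (use gL A1 \<Lambda>[OF \<xi>] in \<open>auto simp: A_def C2_def\<close>)
      also have "\<dots> = (E * C2) * (\<epsilon> powr (- M) * \<epsilon> powr (- 1)) * inverse (norm \<xi> ^ l)" by (simp add: A_def)
      also have "\<epsilon> powr (- M) * \<epsilon> powr (- 1) = \<epsilon> powr (- (M + 1))"
        by (subst powr_add[symmetric]) simp
      finally show "norm (fourier (\<lambda>x. f \<epsilon> x * w \<epsilon> \<xi> x) \<xi>)
          \<le> (E * C2) * \<epsilon> powr (- (M + 1)) * inverse (norm \<xi> ^ l)" unfolding fg .
    qed
  qed
  then show ?thesis unfolding moderate_decay_def M_def by blast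
qed

text \<open>The induction covers all slow families \<open>w\<close> carried by \<open>L\<close> at
  once, since a round replaces \<open>w\<close> by \<open>P\<^sup>t(q w)\<close>. A slow family
  costs one power of \<open>1 / \<epsilon>\<close>, however many rounds have produced it; so the
  largest of the exponents for \<open>u\<close>, \<open>f\<close> and the transform of
  \<open>\<psi> f\<close>, plus one, is right for every \<open>l\<close>.\<close>

theorem moderate_decay_solution:
  assumes L: "compact L" "L \<subseteq> V" and "w \<in> slow_families V \<Lambda>"
    and "\<And>\<epsilon> \<xi> x. x \<notin> L \<Longrightarrow> w \<epsilon> \<xi> x = 0"
  shows "moderate_decay (max p\<^sub>u (max p\<^sub>f N) + 1) l (\<lambda>\<epsilon> \<xi>. fourier (\<lambda>x. u \<epsilon> x * w \<epsilon> \<xi> x) \<xi>)"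
  using assms(3,4)
proof (induction l arbitrary: w)
  case 0
  note w = 0(1) and wL = 0(2)
  have "\<forall>\<^sub>F \<epsilon> in at_right 0. \<forall>\<xi>\<in>\<Lambda>. w \<epsilon> \<xi> \<in> smooth_functions V" using w by (simp add: slow_families_def)
  with u slow_families_bound[OF w, of 0] u_bound eventually_Ioc_0_1
  have "\<forall>\<^sub>F \<epsilon> in at_right 0. \<forall>\<xi>\<in>\<Lambda>. norm (fourier (\<lambda>x. u \<epsilon> x * w \<epsilon> \<xi> x) \<xi>)
      \<le> \<bar>measure lborel L * C\<^sub>u\<bar> * \<epsilon> powr (- (max p\<^sub>u (max p\<^sub>f N) + 1)) * inverse (norm \<xi> ^ 0)"
  proof eventually_elim
    case (elim \<epsilon>)
    show ?case
    proof
      fix \<xi> assume \<xi>: "\<xi> \<in> \<Lambda>"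
      have z: "u \<epsilon> x * w \<epsilon> \<xi> x = 0" if "x \<notin> L" for x using wL[OF that] by simp
      have "(\<lambda>x. u \<epsilon> x * w \<epsilon> \<xi> x) \<in> smooth_functions UNIV"
        by (rule smooth_extend_zero[OF smooth_mult[OF V(1) elim(1)] compact_imp_closed[OF L(1)] L(2)])
          (use elim(5) \<xi> z in auto)
      then have int: "integrable lborel (\<lambda>x. exp (- \<i> * complex_of_real (x \<bullet> \<xi>)) * (u \<epsilon> x * w \<epsilon> \<xi> x))"
        by (intro integrable_smooth[OF smooth_mult[OF open_UNIV smooth_iexp] L(1)]) (simp_all add: z)
      have "norm (fourier (\<lambda>x. u \<epsilon> x * w \<epsilon> \<xi> x) \<xi>) \<le> measure lborel L * (C\<^sub>u * \<epsilon> powr (- p\<^sub>u) * \<epsilon> powr (- 1))"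
        unfolding fourier_def
      proof (rule norm_integral_zero_off_compact_le[OF int L(1)])
        fix x assume x: "x \<in> L"
        then have "norm (u \<epsilon> x) \<le> C\<^sub>u * \<epsilon> powr (- p\<^sub>u)" "norm (w \<epsilon> \<xi> x) \<le> \<epsilon> powr (- 1)"
          using elim(2,3) L(2) V(2) \<xi> by auto
        then have "norm (u \<epsilon> x * w \<epsilon> \<xi> x) \<le> C\<^sub>u * \<epsilon> powr (- p\<^sub>u) * \<epsilon> powr (- 1)"
          unfolding norm_mult by (intro mult_mono) (auto intro: order_trans[OF norm_ge_zero])
        moreover have "norm (exp (- \<i> * complex_of_real (x \<bullet> \<xi>)) * (u \<epsilon> x * w \<epsilon> \<xi> x)) = norm (u \<epsilon> x * w \<epsilon> \<xi> x)"
          by (simp add: norm_mult)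
        ultimately show "norm (exp (- \<i> * complex_of_real (x \<bullet> \<xi>)) * (u \<epsilon> x * w \<epsilon> \<xi> x)) \<le> C\<^sub>u * \<epsilon> powr (- p\<^sub>u) * \<epsilon> powr (- 1)"
          by (simp only:)
      qed (simp add: z)
      also have "\<dots> = (measure lborel L * C\<^sub>u) * (\<epsilon> powr (- p\<^sub>u) * \<epsilon> powr (- 1))"
        by (simp only: mult.assoc)
      also have "\<epsilon> powr (- p\<^sub>u) * \<epsilon> powr (- 1) = \<epsilon> powr (- (p\<^sub>u + 1))"
        by (subst powr_add[symmetric]) simp
      also have "(measure lborel L * C\<^sub>u) * \<epsilon> powr (- (p\<^sub>u + 1)) \<le> \<bar>measure lborel L * C\<^sub>u\<bar> * \<epsilon> powr (- (max p\<^sub>u (max p\<^sub>f N) + 1))"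
        using elim(4) by (intro mult_mono powr_mono') auto
      finally show "norm (fourier (\<lambda>x. u \<epsilon> x * w \<epsilon> \<xi> x) \<xi>)
        \<le> \<bar>measure lborel L * C\<^sub>u\<bar> * \<epsilon> powr (- (max p\<^sub>u (max p\<^sub>f N) + 1)) * inverse (norm \<xi> ^ 0)" by simp
    qed
  qed
  then show ?case unfolding moderate_decay_def by blast
next
  case (Suc l)
  note w = Suc.prems(1) and wL = Suc.prems(2)
  let ?M = "max p\<^sub>u (max p\<^sub>f N) + 1" and ?M' = "max p\<^sub>f N + 1"
  define v where "v \<epsilon> \<xi> x = inverse (normalized_symbol \<epsilon> \<xi> x) * w \<epsilon> \<xi> x" for \<epsilon> \<xi> x
  \<comment> \<open>The transpose of \<open>P\<close> applied to \<open>v\<close>; moving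
    \<open>- \<i> * partial_deriv j\<close> to the other factor changes its sign.\<close>
  define T where "T \<epsilon> \<xi> x = b\<^sub>0 \<epsilon> x * v \<epsilon> \<xi> x + (\<Sum>j\<in>UNIV. \<i> * partial_deriv j (\<lambda>x. b j \<epsilon> x * v \<epsilon> \<xi> x) x)" for \<epsilon> \<xi> x
  have v: "v \<in> slow_families V \<Lambda>"
    unfolding v_def[abs_def] by (intro slow_families_mult V(1) inverse_normalized_symbol_slow w)
  have vL: "v \<epsilon> \<xi> x = 0" if "x \<notin> L" for \<epsilon> \<xi> x using wL[OF that] by (simp add: v_def)
  have "(\<lambda>\<epsilon> \<xi> x. \<i>) \<in> slow_families V \<Lambda>"
    by (rule slow_families_bounded_const[OF V(1), of _ _ 1]) simp
  then have "T \<in> slow_families V \<Lambda>"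
    unfolding T_def[abs_def]
    by (intro slow_families_add slow_families_sum slow_families_mult slow_families_partial_deriv V(1) coeffs v)
  moreover have "T \<epsilon> \<xi> x = 0" if "x \<notin> L" for \<epsilon> \<xi> x
  proof -
    have "partial_deriv j (\<lambda>x. b j \<epsilon> x * v \<epsilon> \<xi> x) x = 0" for j
      using iter_partial_deriv_zero_open[of "- L" "\<lambda>x. b j \<epsilon> x * v \<epsilon> \<xi> x" x "[j]"]
        that vL open_Compl[OF compact_imp_closed[OF L(1)]] by auto
    then show ?thesis using vL[OF that] by (simp add: T_def)
  qed
  ultimately have "moderate_decay ?M l (\<lambda>\<epsilon> \<xi>. fourier (\<lambda>x. u \<epsilon> x * T \<epsilon> \<xi> x) \<xi>)"
    by (rule Suc.IH)
  then obtain C1 where C1: "\<forall>\<^sub>F \<epsilon> in at_right 0. \<forall>\<xi>\<in>\<Lambda>.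
      norm (fourier (\<lambda>x. u \<epsilon> x * T \<epsilon> \<xi> x) \<xi>) \<le> C1 * \<epsilon> powr (- ?M) * inverse (norm \<xi> ^ l)"
    unfolding moderate_decay_def by blast
  obtain C2 where C2: "\<forall>\<^sub>F \<epsilon> in at_right 0. \<forall>\<xi>\<in>\<Lambda>.
      norm (fourier (\<lambda>x. f \<epsilon> x * v \<epsilon> \<xi> x) \<xi>) \<le> C2 * \<epsilon> powr (- ?M') * inverse (norm \<xi> ^ l)"
    using main_term[OF L v vL, of l] unfolding moderate_decay_def by blast
  have sm: "\<forall>\<^sub>F \<epsilon> in at_right 0. \<forall>\<xi>\<in>\<Lambda>. v \<epsilon> \<xi> \<in> smooth_functions V"
    "\<forall>\<^sub>F \<epsilon> in at_right 0. \<forall>\<xi>\<in>\<Lambda>. b\<^sub>0 \<epsilon> \<in> smooth_functions V"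
    using v coeffs by (auto simp: slow_families_def)
  have smb: "\<forall>\<^sub>F \<epsilon> in at_right 0. \<forall>j\<in>UNIV. \<forall>\<xi>\<in>\<Lambda>. b j \<epsilon> \<in> smooth_functions V"
    using coeffs(2) by (intro eventually_ball_finite finite) (auto simp: slow_families_def)
  have "\<forall>\<^sub>F \<epsilon> in at_right 0. \<forall>\<xi>\<in>\<Lambda>. norm (fourier (\<lambda>x. u \<epsilon> x * w \<epsilon> \<xi> x) \<xi>)
      \<le> (\<bar>C1\<bar> + \<bar>C2\<bar>) * \<epsilon> powr (- ?M) * inverse (norm \<xi> ^ Suc l)"
    using C1 C2 sm smb u f_eq normalized_symbol_lower[OF zero_less_one] eventually_Ioc_0_1
  proof eventually_elim
    case (elim \<epsilon>)
    show ?case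
    proof
      fix \<xi> assume \<xi>: "\<xi> \<in> \<Lambda>"
      have n: "norm \<xi> > 0" using \<Lambda>[OF \<xi>] by simp
      \<comment> \<open>Off \<open>L\<close> the symbol may vanish, but there \<open>v\<close> and
        \<open>w\<close> are both zero; on \<open>L\<close> the lower bound rules this out.\<close>
      have pv: "(\<Sum>j\<in>UNIV. b j \<epsilon> x * of_real (\<xi> $ j)) * v \<epsilon> \<xi> x = of_real (norm \<xi>) * w \<epsilon> \<xi> x" for x
      proof (cases "x \<in> L")
        case True
        then have "normalized_symbol \<epsilon> \<xi> x \<noteq> 0"
          using elim(8,9) \<xi> L(2) by force
        then show ?thesis by (simp add: normalized_symbol_eq[OF \<xi>] v_def)
      qed (simp add: vL wL)
      have "fourier (\<lambda>x. f \<epsilon> x * v \<epsilon> \<xi> x) \<xi>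
        = fourier (\<lambda>x. u \<epsilon> x * ((\<Sum>j\<in>UNIV. b j \<epsilon> x * of_real (\<xi> $ j)) * v \<epsilon> \<xi> x)) \<xi>
          + fourier (\<lambda>x. u \<epsilon> x * T \<epsilon> \<xi> x) \<xi>"
        unfolding T_def by (rule fourier_first_order_transpose[OF V(1) L]) (use elim \<xi> vL in auto)
      also have "fourier (\<lambda>x. u \<epsilon> x * ((\<Sum>j\<in>UNIV. b j \<epsilon> x * of_real (\<xi> $ j)) * v \<epsilon> \<xi> x)) \<xi>
          = of_real (norm \<xi>) * fourier (\<lambda>x. u \<epsilon> x * w \<epsilon> \<xi> x) \<xi>"
        unfolding pv fourier_def by (subst integral_mult_right_zero[symmetric]) (simp add: mult_ac)
      finally have "of_real (norm \<xi>) * fourier (\<lambda>x. u \<epsilon> x * w \<epsilon> \<xi> x) \<xi>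
          = fourier (\<lambda>x. f \<epsilon> x * v \<epsilon> \<xi> x) \<xi> - fourier (\<lambda>x. u \<epsilon> x * T \<epsilon> \<xi> x) \<xi>" by simp
      then have "norm \<xi> * norm (fourier (\<lambda>x. u \<epsilon> x * w \<epsilon> \<xi> x) \<xi>)
          = norm (fourier (\<lambda>x. f \<epsilon> x * v \<epsilon> \<xi> x) \<xi> - fourier (\<lambda>x. u \<epsilon> x * T \<epsilon> \<xi> x) \<xi>)"
        by (metis abs_norm_cancel norm_mult norm_of_real)
      also have "\<dots> \<le> C2 * \<epsilon> powr (- ?M') * inverse (norm \<xi> ^ l) + C1 * \<epsilon> powr (- ?M) * inverse (norm \<xi> ^ l)"
        using elim(1,2) \<xi> by (intro order_trans[OF norm_triangle_ineq4] add_mono) auto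
      also have "C2 * \<epsilon> powr (- ?M') * inverse (norm \<xi> ^ l) \<le> \<bar>C2\<bar> * \<epsilon> powr (- ?M) * inverse (norm \<xi> ^ l)"
        using elim(9) by (intro mult_right_mono mult_mono powr_mono') auto
      also have "C1 * \<epsilon> powr (- ?M) * inverse (norm \<xi> ^ l) \<le> \<bar>C1\<bar> * \<epsilon> powr (- ?M) * inverse (norm \<xi> ^ l)"
        by (intro mult_right_mono) auto
      finally have "norm \<xi> * norm (fourier (\<lambda>x. u \<epsilon> x * w \<epsilon> \<xi> x) \<xi>)
          \<le> (\<bar>C1\<bar> + \<bar>C2\<bar>) * \<epsilon> powr (- ?M) * inverse (norm \<xi> ^ l)" by (simp add: algebra_simps)
      then have "norm (fourier (\<lambda>x. u \<epsilon> x * w \<epsilon> \<xi> x) \<xi>)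
          \<le> (\<bar>C1\<bar> + \<bar>C2\<bar>) * \<epsilon> powr (- ?M) * inverse (norm \<xi> ^ l) / norm \<xi>"
        using n by (simp add: pos_le_divide_eq mult.commute)
      then show "norm (fourier (\<lambda>x. u \<epsilon> x * w \<epsilon> \<xi> x) \<xi>)
          \<le> (\<bar>C1\<bar> + \<bar>C2\<bar>) * \<epsilon> powr (- ?M) * inverse (norm \<xi> ^ Suc l)"
        by (simp add: divide_inverse mult_ac)
    qed
  qed
  then show ?case unfolding moderate_decay_def by blast
qed

end

text \<open>After scaling, a covector of \<Gamma> lies within \<open>d / 2\<close> of
  \<open>\<xi>\<^sub>0\<close>, and the perturbation moves it by at most another
  \<open>d / 2\<close>.\<close>

lemma conic_nbhd_shrink:
  fixes \<Gamma>\<^sub>1 \<Gamma>\<^sub>2 :: "(real^'n::finite) set"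
  assumes "conic_nbhd \<xi>\<^sub>0 \<Gamma>\<^sub>1" "conic_nbhd \<xi>\<^sub>0 \<Gamma>\<^sub>2"
  obtains \<Gamma> c where "conic_nbhd \<xi>\<^sub>0 \<Gamma>" "0 < c" "c < 1" "\<Gamma> \<subseteq> \<Gamma>\<^sub>2"
    "\<And>\<xi> \<eta>. \<xi> \<in> \<Gamma> \<Longrightarrow> norm (\<xi> - \<eta>) \<le> c * norm \<xi> \<Longrightarrow> \<eta> \<in> \<Gamma>\<^sub>1"
proof -
  have o: "open (\<Gamma>\<^sub>1 \<inter> \<Gamma>\<^sub>2)" "\<xi>\<^sub>0 \<in> \<Gamma>\<^sub>1 \<inter> \<Gamma>\<^sub>2" using assms by (auto simp: conic_nbhd_def)
  then obtain d where d: "d > 0" "ball \<xi>\<^sub>0 d \<subseteq> \<Gamma>\<^sub>1 \<inter> \<Gamma>\<^sub>2" by (meson openE)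
  have nz: "norm \<xi>\<^sub>0 > 0" using assms by (auto simp: conic_nbhd_def)
  define e where "e = d / 2"
  have e: "e > 0" using d by (simp add: e_def)
  define \<Gamma> where "\<Gamma> = (\<Union>t\<in>{0<..}. (\<lambda>\<xi>. t *\<^sub>R \<xi>) ` ball \<xi>\<^sub>0 e)"
  \<comment> \<open>Points of \<open>ball \<xi>\<^sub>0 e\<close> have norm at most
    \<open>norm \<xi>\<^sub>0 + e\<close>, so a relative error \<open>c\<close> is an absolute error
    of at most \<open>e\<close>.\<close>
  define c where "c = e / (norm \<xi>\<^sub>0 + e)"
  have cone: "t *\<^sub>R \<xi> \<in> \<Gamma>\<^sub>1" if "t > 0" "\<xi> \<in> \<Gamma>\<^sub>1" for t \<xi> using assms(1) that by (auto simp: conic_nbhd_def)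
  have sub: "\<Gamma> \<subseteq> \<Gamma>\<^sub>2"
    using assms(2) d e by (auto simp: \<Gamma>_def conic_nbhd_def e_def subset_iff)
  show ?thesis
  proof
    show "0 < c" "c < 1" using e nz add_pos_pos[OF nz e] by (simp_all add: c_def)
    show "\<Gamma> \<subseteq> \<Gamma>\<^sub>2" by (rule sub)
    have "open \<Gamma>" unfolding \<Gamma>_def by (intro open_UN ballI open_scaling) auto
    moreover have "\<xi>\<^sub>0 \<in> \<Gamma>" unfolding \<Gamma>_def using e by (intro UN_I[of 1]) auto
    moreover have "0 \<notin> \<Gamma>" using sub assms(2) by (auto simp: conic_nbhd_def)
    moreover have "t *\<^sub>R \<xi> \<in> \<Gamma>" if \<xi>: "\<xi> \<in> \<Gamma>" and t: "t > 0" for t \<xi>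
    proof -
      from \<xi> obtain r z where "r > 0" "z \<in> ball \<xi>\<^sub>0 e" "\<xi> = r *\<^sub>R z" by (auto simp: \<Gamma>_def)
      then show ?thesis unfolding \<Gamma>_def using t by (intro UN_I[of "t * r"]) auto
    qed
    ultimately show "conic_nbhd \<xi>\<^sub>0 \<Gamma>" by (auto simp: conic_nbhd_def)
    fix \<xi> \<eta> assume "\<xi> \<in> \<Gamma>" and le: "norm (\<xi> - \<eta>) \<le> c * norm \<xi>"
    then obtain t z where t: "t > 0" "z \<in> ball \<xi>\<^sub>0 e" "\<xi> = t *\<^sub>R z" by (auto simp: \<Gamma>_def)
    define y where "y = \<eta> /\<^sub>R t"
    have \<eta>: "\<eta> = t *\<^sub>R y" using t by (simp add: y_def)
    have "t * norm (z - y) \<le> t * (c * norm z)"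
      using le t(1) by (simp add: t(3) \<eta> scaleR_diff_right[symmetric] mult.left_commute)
    then have "norm (z - y) \<le> c * norm z" using t(1) by simp
    also have "\<dots> \<le> c * (norm \<xi>\<^sub>0 + e)"
      using t(2) norm_triangle_ineq2[of z \<xi>\<^sub>0] e by (intro mult_left_mono) (auto simp: dist_norm norm_minus_commute c_def)
    also have "\<dots> = e" using e nz by (simp add: c_def add_pos_pos less_imp_neq[symmetric])
    finally have "dist \<xi>\<^sub>0 y < d"
      using t(2) dist_triangle[of \<xi>\<^sub>0 y z] by (simp add: e_def dist_norm)
    then have "y \<in> \<Gamma>\<^sub>1" using d by auto
    then show "\<eta> \<in> \<Gamma>\<^sub>1" unfolding \<eta> using t(1) by (rule cone[rotated])
  qed
qed

text \<open>The witness for the regularity of \<open>u\<close> is the representative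
  \<open>v\<close> from which \<open>pdo_apply\<close> forms \<open>f\<close>, so that the
  differential equation holds exactly. Decay is moved from \<open>h\<close> to \<open>f\<close>, and
  ellipticity from \<open>b'\<close> to \<open>b\<close>.\<close>

lemma microlocally_regular_of_elliptic:
  fixes \<Omega> :: "(real^'n::finite) set"
  assumes \<Omega>: "open \<Omega>" and a\<^sub>0: "a\<^sub>0 \<in> colombeau \<Omega>" "slow_scale \<Omega> a\<^sub>0"
    and a: "\<And>j. a j \<in> colombeau \<Omega>" "\<And>j. slow_scale \<Omega> (a j)" and u: "u \<in> colombeau \<Omega>"
    and reg: "microlocally_regular \<Omega> (pdo_apply \<Omega> 1 (first_order_pdo a\<^sub>0 a) u) x\<^sub>0 \<xi>\<^sub>0"
    and ell: "Wsc_elliptic_at \<Omega> 1 (principal_part \<Omega> 1 (first_order_pdo a\<^sub>0 a)) x\<^sub>0 \<xi>\<^sub>0"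
  shows "microlocally_regular \<Omega> u x\<^sub>0 \<xi>\<^sub>0"
proof -
  let ?P = "first_order_pdo a\<^sub>0 a"
  obtain h U\<^sub>1 \<Gamma>\<^sub>1 where h: "h \<in> pdo_apply \<Omega> 1 ?P u" and U1: "open U\<^sub>1" "x\<^sub>0 \<in> U\<^sub>1" "U\<^sub>1 \<subseteq> \<Omega>"
    and \<Gamma>1: "conic_nbhd \<xi>\<^sub>0 \<Gamma>\<^sub>1"
    and hreg: "\<forall>\<phi>\<in>test_functions U\<^sub>1. \<exists>N::real. \<forall>l::nat. \<exists>C>0. \<forall>\<^sub>F \<epsilon> in at_right 0. \<forall>\<xi>\<in>\<Gamma>\<^sub>1.
          cmod (fourier (\<lambda>x. \<phi> x * h \<epsilon> x) \<xi>) \<le> C * \<epsilon> powr (- N) * (1 + norm \<xi>) powr (- real l)"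
    using reg unfolding microlocally_regular_def by (elim bexE exE conjE) (rule that)
  obtain b v where b: "b \<in> coeff_reps 1 ?P" and v: "v \<in> u"
    and hf: "h \<in> colombeau_class \<Omega> (\<lambda>\<epsilon> x. \<Sum>\<alpha> | mi_order \<alpha> \<le> 1. b \<alpha> \<epsilon> x * mi_D \<alpha> (v \<epsilon>) x)"
    using h unfolding pdo_apply_def by blast
  define f where "f \<epsilon> x = (\<Sum>\<alpha> | mi_order \<alpha> \<le> 1. b \<alpha> \<epsilon> x * mi_D \<alpha> (v \<epsilon>) x)" for \<epsilon> x
  have f: "f \<in> moderate_nets \<Omega>" and h': "h \<in> moderate_nets \<Omega>"
    and fh: "(\<lambda>\<epsilon> x. f \<epsilon> x - h \<epsilon> x) \<in> negligible_nets \<Omega>"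
    using hf unfolding f_def[abs_def] colombeau_class_def colombeau_rel_def by auto
  have f_eq: "f \<epsilon> x = b 0 \<epsilon> x * v \<epsilon> x + (\<Sum>j\<in>UNIV. b (axis j 1) \<epsilon> x * (- \<i> * partial_deriv j (v \<epsilon>) x))" for \<epsilon> x
    unfolding f_def sum_mi_order_le_1 mi_D_0 mi_D_axis ..
  have v': "v \<in> moderate_nets \<Omega>" by (rule colombeau_moderate[OF u v])
  have bP: "b \<alpha> \<in> ?P \<alpha>" if "mi_order \<alpha> \<le> 1" for \<alpha>
    using b that by (simp add: coeff_reps_def)
  have b0: "b 0 \<in> a\<^sub>0" using bP[of 0] by (simp add: first_order_pdo_def)
  have bj: "b (axis j 1) \<in> a j" for j using bP[of "axis j 1"] by (simp del: One_nat_def)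
  obtain b' U\<^sub>2 \<Gamma>\<^sub>2 s r where b': "b' \<in> coeff_reps 1 (principal_part \<Omega> 1 ?P)"
    and U2: "open U\<^sub>2" "x\<^sub>0 \<in> U\<^sub>2" "U\<^sub>2 \<subseteq> \<Omega>" and \<Gamma>2: "conic_nbhd \<xi>\<^sub>0 \<Gamma>\<^sub>2" and s: "pos_slow_scale_net s"
    and low: "\<forall>\<^sub>F \<epsilon> in at_right 0. \<forall>x\<in>U\<^sub>2. \<forall>\<xi>\<in>\<Gamma>\<^sub>2. norm \<xi> \<ge> r \<epsilon> \<longrightarrow>
        cmod (pdo_symbol 1 b' \<epsilon> x \<xi>) \<ge> inverse (s \<epsilon>) * (1 + norm \<xi>) ^ 1"
    using ell unfolding Wsc_elliptic_at_def by blast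
  have b'j: "b' (axis j 1) \<in> a j" for j
  proof -
    have "b' (axis j 1) \<in> principal_part \<Omega> 1 ?P (axis j 1)"
      using b' unfolding coeff_reps_def by (simp del: One_nat_def)
    then show ?thesis by (simp add: principal_part_def del: One_nat_def)
  qed
  \<comment> \<open>The closed ball in both neighbourhoods becomes \<open>K\<close>: it carries the
    uniform bounds, and it is the support of a bump living on its interior \<open>V\<close>.\<close>
  obtain \<rho> where \<rho>: "\<rho> > 0" "cball x\<^sub>0 \<rho> \<subseteq> U\<^sub>1 \<inter> U\<^sub>2"
    using open_contains_cball[of "U\<^sub>1 \<inter> U\<^sub>2"] U1 U2 by (metis IntI open_Int)
  define V K where "V = ball x\<^sub>0 \<rho>" and "K = cball x\<^sub>0 \<rho>"
  have V: "open V" "x\<^sub>0 \<in> V" "V \<subseteq> K" and K: "compact K" "K \<subseteq> \<Omega>" "K \<subseteq> U\<^sub>1" "K \<subseteq> U\<^sub>2"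
    using \<rho> U1(3) by (auto simp: V_def K_def)
  obtain \<Gamma> c where \<Gamma>: "conic_nbhd \<xi>\<^sub>0 \<Gamma>" "0 < c" "c < 1" "\<Gamma> \<subseteq> \<Gamma>\<^sub>2"
    and \<Gamma>c: "\<And>\<xi> \<eta>. \<xi> \<in> \<Gamma> \<Longrightarrow> norm (\<xi> - \<eta>) \<le> c * norm \<xi> \<Longrightarrow> \<eta> \<in> \<Gamma>\<^sub>1"
    using conic_nbhd_shrink[OF \<Gamma>1 \<Gamma>2] by metis
  obtain \<psi> where \<psi>: "\<psi> \<in> smooth_functions UNIV" "\<And>x. \<psi> x \<noteq> 0 \<longleftrightarrow> x \<in> V"
    using exists_bump[OF \<rho>(1), of x\<^sub>0] unfolding V_def by blast
  have \<psi>K: "\<psi> x = 0" if "x \<notin> K" for x using \<psi>(2)[of x] V(3) that by auto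
  have "{x. \<psi> x \<noteq> 0} = V" using \<psi>(2) by auto
  then have "closure {x. \<psi> x \<noteq> 0} = K" using \<rho>(1) by (simp add: V_def K_def)
  then have "\<psi> \<in> test_functions U\<^sub>1" using \<psi>(1) K by (simp add: test_functions_def del: compact_closure)
  \<comment> \<open>The regularity of \<open>P u\<close> is used for this bump alone, which yields
    one exponent for all cutoffs.\<close>
  then obtain N\<^sub>0 where N0: "\<And>l::nat. \<exists>C>0. \<forall>\<^sub>F \<epsilon> in at_right 0. \<forall>\<xi>\<in>\<Gamma>\<^sub>1.
          cmod (fourier (\<lambda>x. \<psi> x * h \<epsilon> x) \<xi>) \<le> C * \<epsilon> powr (- N\<^sub>0) * (1 + norm \<xi>) powr (- real l)"
    using bspec[OF hreg] by blast
  have pw: "(1 + norm \<eta>) powr (- real l) = inverse ((1 + norm \<eta>) ^ l)" for \<eta> :: "real^'n" and l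
    by (simp add: powr_minus powr_realpow add_pos_nonneg)
  \<comment> \<open>The entry 1 accounts for the negligible difference between \<open>f\<close> and
    \<open>h\<close>.\<close>
  define N where "N = max N\<^sub>0 1"
  have f_regular: "\<exists>C. \<forall>\<^sub>F \<epsilon> in at_right 0. \<forall>\<eta>\<in>\<Gamma>\<^sub>1.
      norm (fourier (\<lambda>x. \<psi> x * f \<epsilon> x) \<eta>) \<le> C * \<epsilon> powr (- N) * inverse ((1 + norm \<eta>) ^ l)" for l
  proof -
    obtain C1 where C1: "C1 > 0" "\<forall>\<^sub>F \<epsilon> in at_right 0. \<forall>\<xi>\<in>\<Gamma>\<^sub>1.
          cmod (fourier (\<lambda>x. \<psi> x * h \<epsilon> x) \<xi>) \<le> C1 * \<epsilon> powr (- N\<^sub>0) * inverse ((1 + norm \<xi>) ^ l)"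
      using N0[of l] unfolding pw by blast
    obtain C2 where C2: "\<forall>\<^sub>F \<epsilon> in at_right 0. \<forall>\<eta>.
      norm (fourier (\<lambda>x. \<psi> x * (f \<epsilon> x - h \<epsilon> x)) \<eta>) \<le> C2 * \<epsilon> powr (- 1) * inverse ((1 + norm \<eta>) ^ l)"
      by (rule fourier_negligible_decay[OF \<Omega> fh \<psi>(1) K(1,2) \<psi>K])
    have "\<forall>\<^sub>F \<epsilon> in at_right 0. \<forall>\<eta>\<in>\<Gamma>\<^sub>1.
      norm (fourier (\<lambda>x. \<psi> x * f \<epsilon> x) \<eta>) \<le> (C1 + \<bar>C2\<bar>) * \<epsilon> powr (- N) * inverse ((1 + norm \<eta>) ^ l)"
      using C1(2) C2 eventually_Ioc_0_1
    proof eventually_elim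
      case (elim \<epsilon>)
      have int: "integrable lborel (\<lambda>x. exp (- \<i> * complex_of_real (x \<bullet> \<eta>)) * (\<psi> x * g x))"
        if "g \<in> smooth_functions \<Omega>" for g \<eta>
      proof -
        have "(\<lambda>x. \<psi> x * g x) \<in> smooth_functions UNIV"
          by (rule smooth_extend_zero[OF smooth_mult[OF \<Omega> smooth_subset[OF \<psi>(1)] that]
                compact_imp_closed[OF K(1)] K(2)]) (simp_all add: \<psi>K)
        then show ?thesis
          by (intro integrable_smooth[OF smooth_mult[OF open_UNIV smooth_iexp] K(1)]) (simp_all add: \<psi>K)
      qed
      show ?case
      proof
        fix \<eta> assume \<eta>: "\<eta> \<in> \<Gamma>\<^sub>1"
        have "fourier (\<lambda>x. \<psi> x * f \<epsilon> x) \<eta>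
            = fourier (\<lambda>x. \<psi> x * h \<epsilon> x) \<eta> + fourier (\<lambda>x. \<psi> x * (f \<epsilon> x - h \<epsilon> x)) \<eta>"
          unfolding fourier_def
          by (subst Bochner_Integration.integral_add[symmetric])
            (use int[of "h \<epsilon>" \<eta>] int[of "\<lambda>x. f \<epsilon> x - h \<epsilon> x" \<eta>] smooth_diff[OF \<Omega>]
              moderate_smooth[OF f elim(3)] moderate_smooth[OF h' elim(3)] in \<open>auto simp: algebra_simps\<close>)
        also have "norm \<dots> \<le> C1 * \<epsilon> powr (- N\<^sub>0) * inverse ((1 + norm \<eta>) ^ l)
            + C2 * \<epsilon> powr (- 1) * inverse ((1 + norm \<eta>) ^ l)"
          using elim(1,2) \<eta> by (intro order_trans[OF norm_triangle_ineq] add_mono) auto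
        also have "\<dots> \<le> C1 * \<epsilon> powr (- N) * inverse ((1 + norm \<eta>) ^ l)
            + \<bar>C2\<bar> * \<epsilon> powr (- N) * inverse ((1 + norm \<eta>) ^ l)"
          using elim(3) C1(1) by (intro add_mono mult_right_mono mult_mono powr_mono') (auto simp: N_def)
        finally show "norm (fourier (\<lambda>x. \<psi> x * f \<epsilon> x) \<eta>)
            \<le> (C1 + \<bar>C2\<bar>) * \<epsilon> powr (- N) * inverse ((1 + norm \<eta>) ^ l)"
          by (simp add: algebra_simps)
      qed
    qed
    then show ?thesis by blast
  qed
  obtain p\<^sub>u C\<^sub>u where u_bound: "\<forall>\<^sub>F \<epsilon> in at_right 0. \<forall>x\<in>K. norm (v \<epsilon> x) \<le> C\<^sub>u * \<epsilon> powr (- p\<^sub>u)"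
    by (rule moderate_bound[OF \<Omega> v' K(1,2)])
  obtain p\<^sub>f C\<^sub>f where f_bound: "\<forall>\<^sub>F \<epsilon> in at_right 0. \<forall>x\<in>K. norm (f \<epsilon> x) \<le> C\<^sub>f * \<epsilon> powr (- p\<^sub>f)"
    by (rule moderate_bound[OF \<Omega> f K(1,2)])
  have cone2: "\<And>\<xi> t. \<xi> \<in> \<Gamma>\<^sub>2 \<Longrightarrow> t > 0 \<Longrightarrow> t *\<^sub>R \<xi> \<in> \<Gamma>\<^sub>2" "0 \<notin> \<Gamma>\<^sub>2"
    using \<Gamma>2 by (auto simp: conic_nbhd_def)
  interpret ME: microlocally_elliptic V K \<Gamma> \<Gamma>\<^sub>1 c \<psi> v f "b 0" "\<lambda>j. b (axis j 1)" p\<^sub>u C\<^sub>u p\<^sub>f C\<^sub>f N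
  proof
    show "\<xi> \<noteq> 0" if "\<xi> \<in> \<Gamma>" for \<xi> using \<Gamma>(1) that by (auto simp: conic_nbhd_def)
    show "\<forall>\<^sub>F \<epsilon> in at_right 0. v \<epsilon> \<in> smooth_functions V"
      using eventually_Ioc_0_1 by eventually_elim (use moderate_smooth[OF v'] smooth_subset V(3) K(2) in blast)
    show "\<forall>\<^sub>F \<epsilon> in at_right 0. (\<lambda>x. \<psi> x * f \<epsilon> x) \<in> smooth_functions UNIV"
      using eventually_Ioc_0_1
    proof eventually_elim
      case (elim \<epsilon>)
      show ?case
        by (rule smooth_extend_zero[OF smooth_mult[OF \<Omega> smooth_subset[OF \<psi>(1)] moderate_smooth[OF f elim]]
              compact_imp_closed[OF K(1)] K(2)]) (simp_all add: \<psi>K)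
    qed
    show "(\<lambda>\<epsilon> \<xi>. b 0 \<epsilon>) \<in> slow_families V \<Gamma>"
      by (rule slow_families_coefficient[OF \<Omega> a\<^sub>0 b0 K(1,2) V(3)])
    show "(\<lambda>\<epsilon> \<xi>. b (axis j 1) \<epsilon>) \<in> slow_families V \<Gamma>" for j
      by (rule slow_families_coefficient[OF \<Omega> a bj K(1,2) V(3)])
    fix \<delta> :: real assume "\<delta> > 0"
    then have "\<forall>\<^sub>F \<epsilon> in at_right 0. \<forall>\<xi>\<in>\<Gamma>\<^sub>2. \<forall>x\<in>V.
      \<epsilon> powr \<delta> * norm \<xi> \<le> norm (\<Sum>j\<in>UNIV. b (axis j 1) \<epsilon> x * of_real (\<xi> $ j))"
      by (intro elliptic_lower_bound[OF \<Omega> a(1) bj b'j K(1,2) V(3) order_trans[OF V(3) K(4)] _ cone2(2) s low] cone2(1))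
    then show "\<forall>\<^sub>F \<epsilon> in at_right 0. \<forall>\<xi>\<in>\<Gamma>. \<forall>x\<in>V.
      \<epsilon> powr \<delta> * norm \<xi> \<le> norm (\<Sum>j\<in>UNIV. b (axis j 1) \<epsilon> x * of_real (\<xi> $ j))"
      by eventually_elim (use \<Gamma>(4) in blast)
  qed (use V K \<Gamma> \<Gamma>c \<psi> u_bound f_bound f_eq f_regular in auto)
  \<comment> \<open>This exponent is fixed before \<phi> and \<open>l\<close>.\<close>
  define M where "M = max p\<^sub>u (max p\<^sub>f N) + 1"
  have "\<exists>C>0. \<forall>\<^sub>F \<epsilon> in at_right 0. \<forall>\<xi>\<in>\<Gamma>.
      cmod (fourier (\<lambda>x. \<phi> x * v \<epsilon> x) \<xi>) \<le> C * \<epsilon> powr (- M) * (1 + norm \<xi>) powr (- real l)"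
    if \<phi>: "\<phi> \<in> test_functions V" for \<phi> l
  proof -
    define L where "L = closure {x. \<phi> x \<noteq> 0}"
    have L: "compact L" "L \<subseteq> V" and \<phi>s: "\<phi> \<in> smooth_functions UNIV"
      using \<phi> by (auto simp: test_functions_def L_def)
    have \<phi>L: "\<phi> x = 0" if "x \<notin> L" for x
      using that closure_subset[of "{x. \<phi> x \<noteq> 0}"] by (auto simp: L_def)
    have "(\<lambda>\<epsilon> \<xi>. \<phi>) \<in> slow_families V \<Gamma>"
      by (rule slow_families_smooth[OF V(1) \<phi>s K(1) V(3) subset_UNIV])
    from ME.moderate_decay_solution[OF L this \<phi>L]
    have md: "ME.moderate_decay M k (\<lambda>\<epsilon> \<xi>. fourier (\<lambda>x. \<phi> x * v \<epsilon> x) \<xi>)" for k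
      by (simp add: M_def mult.commute)
    \<comment> \<open>The bound of order zero is for small covectors, where
      \<open>inverse (norm \<xi> ^ l)\<close> is large.\<close>
    obtain C1 where C1: "\<forall>\<^sub>F \<epsilon> in at_right 0. \<forall>\<xi>\<in>\<Gamma>.
        norm (fourier (\<lambda>x. \<phi> x * v \<epsilon> x) \<xi>) \<le> C1 * \<epsilon> powr (- M) * inverse (norm \<xi> ^ 0)"
      using md[of 0] unfolding ME.moderate_decay_def by blast
    obtain C2 where C2: "\<forall>\<^sub>F \<epsilon> in at_right 0. \<forall>\<xi>\<in>\<Gamma>.
        norm (fourier (\<lambda>x. \<phi> x * v \<epsilon> x) \<xi>) \<le> C2 * \<epsilon> powr (- M) * inverse (norm \<xi> ^ l)"
      using md[of l] unfolding ME.moderate_decay_def by blast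
    \<comment> \<open>The summand 1 makes the constant positive; the factor \<open>2 ^ l\<close>
      below comes from \<open>1 + norm \<xi> \<le> 2 * max 1 (norm \<xi>)\<close>.\<close>
    define C where "C = 1 + \<bar>C1\<bar> + \<bar>C2\<bar>"
    have "\<forall>\<^sub>F \<epsilon> in at_right 0. \<forall>\<xi>\<in>\<Gamma>.
      cmod (fourier (\<lambda>x. \<phi> x * v \<epsilon> x) \<xi>) \<le> (2 ^ l * C) * \<epsilon> powr (- M) * (1 + norm \<xi>) powr (- real l)"
      using C1 C2
    proof eventually_elim
      case (elim \<epsilon>)
      show ?case
      proof
        fix \<xi> assume \<xi>: "\<xi> \<in> \<Gamma>"
        define m where "m = max 1 (norm \<xi>)"
        have "norm (fourier (\<lambda>x. \<phi> x * v \<epsilon> x) \<xi>) \<le> C * \<epsilon> powr (- M) * inverse (m ^ l)"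
        proof (cases "norm \<xi> \<le> 1")
          case True
          have "norm (fourier (\<lambda>x. \<phi> x * v \<epsilon> x) \<xi>) \<le> C1 * \<epsilon> powr (- M)" using elim(1) \<xi> by simp
          also have "\<dots> \<le> C * \<epsilon> powr (- M)" by (intro mult_right_mono) (auto simp: C_def)
          finally show ?thesis using True by (simp add: m_def max_absorb1)
        next
          case False
          have "norm (fourier (\<lambda>x. \<phi> x * v \<epsilon> x) \<xi>) \<le> C2 * \<epsilon> powr (- M) * inverse (norm \<xi> ^ l)" using elim(2) \<xi> by simp
          also have "\<dots> \<le> C * \<epsilon> powr (- M) * inverse (norm \<xi> ^ l)" by (intro mult_right_mono) (auto simp: C_def)
          finally show ?thesis using False by (simp add: m_def max_absorb2)
        qed
        also have "\<dots> \<le> C * \<epsilon> powr (- M) * (2 ^ l * inverse ((1 + norm \<xi>) ^ l))"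
        proof (intro mult_left_mono)
          have "(1 + norm \<xi>) ^ l \<le> (2 * m) ^ l" by (intro power_mono) (auto simp: m_def)
          then have "inverse ((2 * m) ^ l) \<le> inverse ((1 + norm \<xi>) ^ l)"
            by (intro le_imp_inverse_le) (auto simp: add_pos_nonneg)
          then have "2 ^ l * inverse ((2 * m) ^ l) \<le> 2 ^ l * inverse ((1 + norm \<xi>) ^ l)"
            by (intro mult_left_mono) auto
          moreover have "2 ^ l * inverse ((2 * m) ^ l) = inverse (m ^ l)"
            by (simp add: power_mult_distrib)
          ultimately show "inverse (m ^ l) \<le> 2 ^ l * inverse ((1 + norm \<xi>) ^ l)"
            by (simp only:)
        qed (simp add: C_def)
        finally show "cmod (fourier (\<lambda>x. \<phi> x * v \<epsilon> x) \<xi>) \<le> (2 ^ l * C) * \<epsilon> powr (- M) * (1 + norm \<xi>) powr (- real l)"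
          unfolding pw by (simp add: mult_ac)
      qed
    qed
    moreover have "2 ^ l * C > 0" by (simp add: C_def)
    ultimately show ?thesis by blast
  qed
  then show ?thesis
    unfolding microlocally_regular_def using v V K \<Gamma>(1) by (meson order_trans)
qed

theorem theorem6p7:
  fixes \<Omega> :: "(real^'n::finite) set"
    and a\<^sub>0 :: "'n net set" and a :: "'n \<Rightarrow> 'n net set" and u :: "'n net set"
  assumes "open \<Omega>"
    and "a\<^sub>0 \<in> colombeau \<Omega>" and "slow_scale \<Omega> a\<^sub>0"
    and "\<And>j. a j \<in> colombeau \<Omega>" and "\<And>j. slow_scale \<Omega> (a j)"
    and "u \<in> colombeau \<Omega>"
  shows "WF_g \<Omega> u \<subseteq> WF_g \<Omega> (pdo_apply \<Omega> 1 (first_order_pdo a\<^sub>0 a) u) \<union>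
    (cotangent_nonzero \<Omega> - Wsc_Ell \<Omega> 1 (principal_part \<Omega> 1 (first_order_pdo a\<^sub>0 a)))"
  using microlocally_regular_of_elliptic[OF assms] by (auto simp: WF_g_def Wsc_Ell_def)

end
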